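(* Let $\mathcal{Q}$ be a join with $|\mathcal{Q}|$ and $|\mathit{schema}(\mathcal{Q})|$ constant, and let $\mathsf{DC}$ be an acyclic set of degree constraints over $\mathit{schema}(\mathcal{Q})$ such that $\mathcal{Q}$ is consistent with $\mathsf{DC}$. Then one can build, in $O(\mathrm{IN})$ expected time, a data structure on $\mathcal{Q}$ that supports each join sampling operation in $$O\left(\frac{\mathit{polymat}(\mathsf{DC})}{\max\{1,\mathrm{OUT}\}}\right)$$ expected time, where $\mathrm{IN}$ and $\mathrm{OUT}$ are the input size and the output size of $\mathcal{Q}$, and $\mathit{polymat}(\mathsf{DC})$ is the polymatroid bound of $\mathsf{DC}$.
   Context: **Relations and joins.** Fix a finite set of attributes and a countably infinite set $\mathbf{dom}$ of values. A tuple over a set $\mathcal{X}$ of attributes is a function $u:\mathcal{X}\to\mathbf{dom}$; for $\mathcal{Y}\subseteq\mathcal{X}$, $u[\mathcal{Y}]$ is its restriction to $\mathcal{Y}$. A relation $R$ is a finite set of tuples over a common attribute set $\mathit{schema}(R)$. A join is a finite collection $\mathcal{Q}$ of relations (several may have the same schema); $\mathit{schema}(\mathcal{Q})=\bigcup_{R\in\mathcal{Q}}\mathit{schema}(R)$, and $\mathit{join}(\mathcal{Q})$ is the set of tuples $u$ over $\mathit{schema}(\mathcal{Q})$ with $u[\mathit{schema}(R)]\in R$ for all $R\in\mathcal{Q}$. $\mathrm{IN}=\sum_{R\in\mathcal{Q}}|R|$ and $\mathrm{OUT}=|\mathit{join}(\mathcal{Q})|$. The sizes of $\mathcal{Q}$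 and $\mathit{schema}(\mathcal{Q})$ are regarded as constants (data complexity), so constants hidden in $O(\cdot)$ may depend on them. **Degree constraints.** For $\mathcal{X}\subsetneq\mathcal{Y}\subseteq\mathit{schema}(R)$, let $\mathit{deg}_{\mathcal{Y}\mid\mathcal{X}}(R)=\max_{u\text{ over }\mathcal{X}}|\{v[\mathcal{Y}] : v\in R,\ v[\mathcal{X}]=u\}|$. A degree constraint is a triple $(\mathcal{X},\mathcal{Y},N_{\mathcal{Y}\mid\mathcal{X}})$ with $\mathcal{X}\subsetneq\mathcal{Y}\subseteq\mathit{schema}(\mathcal{Q})$ and $N_{\mathcal{Y}\mid\mathcal{X}}\ge1$ an integer. A relation $R\in\mathcal{Q}$ guards it if $\mathcal{Y}\subseteq\mathit{schema}(R)$ and $\mathit{deg}_{\mathcal{Y}\mid\mathcal{X}}(R)\le N_{\mathcal{Y}\mid\mathcal{X}}$. $\mathcal{Q}$ is consistent with $\mathsf{DC}$ if every constraint of $\mathsf{DC}$ is guarded by at least one relation of $\mathcal{Q}$. It is assumed that $\mathsf{DC}$ does not contain two constraints with the same pair $(\mathcal{X},\mathcal{Y})$, and that $\mathsf{DC}$ always contains, for each $R\in\mathcal{Q}$, the cardinality constraint $(\emptyset,\mathit{schema}(R),|R|)$ (if relations share a schema, the one with the smaller bound is kept). **Acyclicity.** The constraint dependency graph $G_{\mathsf{DC}}$ is the directed graph with vertex set $\mathit{schema}(\mathcal{Q})$ having an edge $(X,Y)$ for every constraint $(\mathcal{X},\mathcal{Y},N)\in\mathsf{DC}$ with $\mathcal{X}\neq\emptyset$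 and every $(X,Y)\in\mathcal{X}\times(\mathcal{Y}\setminus\mathcal{X})$. $\mathsf{DC}$ is acyclic if $G_{\mathsf{DC}}$ has no directed cycle. **Polymatroid bound.** With $\mathcal{S}=\mathit{schema}(\mathcal{Q})$, $$\mathit{polymat}(\mathsf{DC})=2^{\max_h h(\mathcal{S})},$$ where $h$ ranges over all functions $h:2^{\mathcal{S}}\to\mathbb{R}_{\ge0}$ that satisfy $h(\emptyset)=0$, are monotone ($h(\mathcal{X})\le h(\mathcal{Y})$ for $\mathcal{X}\subseteq\mathcal{Y}$), submodular ($h(\mathcal{X}\cup\mathcal{Y})+h(\mathcal{X}\cap\mathcal{Y})\le h(\mathcal{X})+h(\mathcal{Y})$), and satisfy $h(\mathcal{Y})-h(\mathcal{X})\le\log_2 N_{\mathcal{Y}\mid\mathcal{X}}$ for every $(\mathcal{X},\mathcal{Y},N_{\mathcal{Y}\mid\mathcal{X}})\in\mathsf{DC}$. **Join sampling operation.** Such an operation returns a tuple drawn uniformly at random from $\mathit{join}(\mathcal{Q})$, or declares $\mathit{join}(\mathcal{Q})=\emptyset$ (when this is the case). The outcomes of all operations must be mutually independent. **Model.** Randomized algorithms in the standard RAM model, where attribute values fit in a machine word, and arithmetic on numbers, random choices and (expected, randomized) hashing operations take constant time. *)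

theory Defs
  imports "HOL-Probability.Probability"
begin

text \<open>Attributes and values are natural numbers (the values form the countably infinite set dom).
  A tuple over a set of attributes is a partial map with exactly that domain, so that restriction
  to a set of attributes is the library's restriction of maps.\<close>

type_synonym attribute = nat
type_synonym tuple = "attribute \<rightharpoonup> nat"

datatype relation = Relation (schema: "attribute set") (tuples: "tuple set")

definition is_relation :: "relation \<Rightarrow> bool" where
  "is_relation R \<longleftrightarrow> finite (schema R) \<and> finite (tuples R) \<and> (\<forall>u\<in>tuples R. dom u = schema R)"

text \<open>A join is a list, so that several relations may share a schema; its size is the length.\<close>

type_synonym join_query = "relation list"

definition is_join :: "join_query \<Rightarrow> bool" where
  "is_join Q \<longleftrightarrow> (\<forall>R\<in>set Q. is_relation R)"

definition join_schema :: "join_query \<Rightarrow> attribute set" where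
  "join_schema Q = (\<Union>R\<in>set Q. schema R)"

definition join :: "join_query \<Rightarrow> tuple set" where
  "join Q = {u. dom u = join_schema Q \<and> (\<forall>R\<in>set Q. u |` schema R \<in> tuples R)}"

definition input_size :: "join_query \<Rightarrow> nat" where
  "input_size Q = (\<Sum>R\<leftarrow>Q. card (tuples R))"

definition output_size :: "join_query \<Rightarrow> nat" where
  "output_size Q = card (join Q)"

definition degree :: "attribute set \<Rightarrow> attribute set \<Rightarrow> relation \<Rightarrow> nat" where
  "degree Y X R = (MAX u\<in>{u. dom u = X}. card {v |` Y | v. v \<in> tuples R \<and> v |` X = u})"

type_synonym degree_constraint = "attribute set \<times> attribute set \<times> nat"

definition guards :: "relation \<Rightarrow> degree_constraint \<Rightarrow> bool" where
  "guards R = (\<lambda>(X, Y, N). Y \<subseteq> schema R \<and> degree Y X R \<le> N)"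

definition consistent :: "join_query \<Rightarrow> degree_constraint set \<Rightarrow> bool" where
  "consistent Q DC \<longleftrightarrow> (\<forall>c\<in>DC. \<exists>R\<in>set Q. guards R c)"

text \<open>Among relations with the same schema, only the smallest contributes its cardinality
  constraint; this is the role of the minimum. As bounds are at least 1, the relations of a join
  with a legal set of degree constraints are nonempty.\<close>

definition degree_constraints :: "join_query \<Rightarrow> degree_constraint set \<Rightarrow> bool" where
  "degree_constraints Q DC \<longleftrightarrow>
     (\<forall>(X, Y, N)\<in>DC. X \<subset> Y \<and> Y \<subseteq> join_schema Q \<and> N \<ge> 1) \<and>
     (\<forall>X Y N N'. (X, Y, N) \<in> DC \<and> (X, Y, N') \<in> DC \<longrightarrow> N = N') \<and>
     (\<forall>R\<in>set Q. ({}, schema R, MIN R'\<in>{R'\<in>set Q. schema R' = schema R}. card (tuples R')) \<in> DC)"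

definition dependency_graph :: "degree_constraint set \<Rightarrow> (attribute \<times> attribute) set" where
  "dependency_graph DC = {(A, B). \<exists>X Y N. (X, Y, N) \<in> DC \<and> X \<noteq> {} \<and> A \<in> X \<and> B \<in> Y - X}"

definition acyclic_constraints :: "degree_constraint set \<Rightarrow> bool" where
  "acyclic_constraints DC \<longleftrightarrow> acyclic (dependency_graph DC)"

definition polymatroid :: "attribute set \<Rightarrow> (attribute set \<Rightarrow> real) \<Rightarrow> bool" where
  "polymatroid S h \<longleftrightarrow>
     h {} = 0 \<and>
     (\<forall>X\<subseteq>S. h X \<ge> 0) \<and>
     (\<forall>X Y. X \<subseteq> Y \<and> Y \<subseteq> S \<longrightarrow> h X \<le> h Y) \<and>
     (\<forall>X Y. X \<subseteq> S \<and> Y \<subseteq> S \<longrightarrow> h (X \<union> Y) + h (X \<inter> Y) \<le> h X + h Y)"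

text \<open>The supremum below is a maximum as soon as the cardinality constraints are present: up to
  values outside the powerset of S, the admissible h then form a nonempty compact polytope.\<close>

definition polymat :: "attribute set \<Rightarrow> degree_constraint set \<Rightarrow> real" where
  "polymat S DC =
     2 powr (SUP h\<in>{h. polymatroid S h \<and> (\<forall>(X, Y, N)\<in>DC. h Y - h X \<le> log 2 (real N))}. h S)"

text \<open>
  The model of computation is a randomized word RAM. A program is a finite list of commands over registers, a word-addressed memory and a hash table
  whose keys are tuples of words. All of these hold words of W bits and are zero initially, and
  arithmetic is modulo 2 ^ W (subtraction is truncated at 0, division by 0 gives 0). Hash table
  access is a primitive of unit cost, and the command Rand r e draws a uniformly random element
  of {0..e} into register r.

  Each step costs one unit. The evaluation of an expression counts as part of the step; as an
  expression is part of the program, this only affects constant factors.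
\<close>

datatype operator = Add | Sub | Mul | Div | Mod | Less | Eq

datatype expr =
    Num nat
  | Reg nat
  | Mem expr
  | Table "expr list"
  | Op operator expr expr

datatype command =
    SetReg nat expr
  | SetMem expr expr
  | SetTable "expr list" expr
  | Rand nat expr
  | If expr "command list" "command list"
  | While expr "command list"

type_synonym program = "command list"

record machine =
  reg :: "nat \<Rightarrow> nat"
  mem :: "nat \<Rightarrow> nat"
  table :: "nat list \<Rightarrow> nat"

definition word :: "nat \<Rightarrow> nat \<Rightarrow> nat" where
  "word W n = n mod 2 ^ W"

fun apply_op :: "operator \<Rightarrow> nat \<Rightarrow> nat \<Rightarrow> nat" where
  "apply_op Add a b = a + b"
| "apply_op Sub a b = a - b"
| "apply_op Mul a b = a * b"
| "apply_op Div a b = a div b"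
| "apply_op Mod a b = a mod b"
| "apply_op Less a b = of_bool (a < b)"
| "apply_op Eq a b = of_bool (a = b)"

fun eval :: "nat \<Rightarrow> machine \<Rightarrow> expr \<Rightarrow> nat" where
  "eval W s (Num n) = word W n"
| "eval W s (Reg r) = reg s r"
| "eval W s (Mem e) = mem s (eval W s e)"
| "eval W s (Table es) = table s (map (eval W s) es)"
| "eval W s (Op f e e') = word W (apply_op f (eval W s e) (eval W s e'))"

text \<open>A configuration consists of the commands still to be executed and the machine state; the
  machine has halted when no commands are left.\<close>

type_synonym config = "program \<times> machine"

fun step :: "nat \<Rightarrow> config \<Rightarrow> config pmf" where
  "step W ([], s) = return_pmf ([], s)"
| "step W (SetReg r e # K, s) = return_pmf (K, s\<lparr>reg := (reg s)(r := eval W s e)\<rparr>)"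
| "step W (SetMem a e # K, s) =
     return_pmf (K, s\<lparr>mem := (mem s)(eval W s a := eval W s e)\<rparr>)"
| "step W (SetTable es e # K, s) =
     return_pmf (K, s\<lparr>table := (table s)(map (eval W s) es := eval W s e)\<rparr>)"
| "step W (Rand r e # K, s) =
     map_pmf (\<lambda>x. (K, s\<lparr>reg := (reg s)(r := x)\<rparr>)) (pmf_of_set {0..eval W s e})"
| "step W (If e P P' # K, s) = return_pmf ((if eval W s e \<noteq> 0 then P else P') @ K, s)"
| "step W (While e P # K, s) =
     return_pmf (if eval W s e \<noteq> 0 then P @ While e P # K else K, s)"

primrec steps :: "nat \<Rightarrow> nat \<Rightarrow> config \<Rightarrow> config pmf" where
  "steps W 0 c = return_pmf c"
| "steps W (Suc n) c = bind_pmf (steps W n c) (step W)"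

text \<open>The running time T (possibly infinite) is the number of steps until the machine halts; its
  expectation is the sum over all n of the probability that T > n.\<close>

definition expected_time :: "nat \<Rightarrow> program \<Rightarrow> machine \<Rightarrow> ennreal" where
  "expected_time W P s =
     (\<Sum>n. emeasure (measure_pmf (steps W n (P, s))) {c. fst c \<noteq> []})"

text \<open>The distribution of the state in which the machine halts; the missing mass of this
  subdistribution is the probability of running forever.\<close>

partial_function (spmf) run_config :: "nat \<Rightarrow> config \<Rightarrow> machine spmf" where
  "run_config W c =
     (if fst c = [] then return_spmf (snd c)
      else bind_spmf (spmf_of_pmf (step W c)) (run_config W))"

definition run :: "nat \<Rightarrow> program \<Rightarrow> machine \<Rightarrow> machine spmf" where
  "run W P s = run_config W (P, s)"

text \<open>Attributes are presented in increasing order. A set of attributes becomes a list of flags,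
  and a tuple becomes the list of its values, padded with 0 at the attributes outside its domain.
  The tuples of each relation and the constraints come in an arbitrary order.\<close>

definition attributes :: "join_query \<Rightarrow> attribute list" where
  "attributes Q = sorted_list_of_set (join_schema Q)"

definition encode_set :: "attribute list \<Rightarrow> attribute set \<Rightarrow> nat list" where
  "encode_set as X = map (\<lambda>A. of_bool (A \<in> X)) as"

definition encode_tuple :: "attribute list \<Rightarrow> tuple \<Rightarrow> nat list" where
  "encode_tuple as u = map (\<lambda>A. case u A of None \<Rightarrow> 0 | Some x \<Rightarrow> x) as"

definition encode_relation :: "attribute list \<Rightarrow> relation \<Rightarrow> tuple list \<Rightarrow> nat list" where
  "encode_relation as R us =
     encode_set as (schema R) @ length us # concat (map (encode_tuple as) us)"

definition encode_constraint :: "attribute list \<Rightarrow> degree_constraint \<Rightarrow> nat list" where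
  "encode_constraint as = (\<lambda>(X, Y, N). encode_set as X @ encode_set as Y @ [N])"

definition encodings :: "join_query \<Rightarrow> degree_constraint set \<Rightarrow> nat list set" where
  "encodings Q DC =
     {length cs # concat (map (encode_constraint (attributes Q)) cs)
        @ concat (map2 (encode_relation (attributes Q)) Q uss) | cs uss.
      distinct cs \<and> set cs = DC \<and>
      list_all2 (\<lambda>R us. distinct us \<and> set us = tuples R) Q uss}"

definition initial :: "nat \<Rightarrow> nat list \<Rightarrow> machine" where
  "initial W xs =
     \<lparr>reg = (\<lambda>_. 0), mem = (\<lambda>a. if a < length xs then word W (xs ! a) else 0), table = (\<lambda>_. 0)\<rparr>"

text \<open>The numbers of the input fit in w bits. Programs are run on words of W = c * w bits, where c may
  only depend on the size of the query: constantly many w-bit words can be handled as one number.\<close>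

definition fits_word :: "nat \<Rightarrow> join_query \<Rightarrow> degree_constraint set \<Rightarrow> bool" where
  "fits_word w Q DC \<longleftrightarrow>
     w \<ge> 1 \<and> input_size Q < 2 ^ w \<and>
     (\<forall>R\<in>set Q. \<forall>u\<in>tuples R. \<forall>x\<in>ran u. x < 2 ^ w) \<and>
     (\<forall>(X, Y, N)\<in>DC. N < 2 ^ w)"

text \<open>The result of a sampling operation is left in the registers: register 0 is 0 if the join is
  declared empty (None), and otherwise registers 1, 2, ... hold the values of the sampled tuple.\<close>

definition outcome :: "join_query \<Rightarrow> machine \<Rightarrow> tuple option" where
  "outcome Q s =
     (if reg s 0 = 0 then None
      else Some (map_of (zip (attributes Q) (map (\<lambda>i. reg s (Suc i)) [0..<length (attributes Q)]))))"

definition sample_law :: "join_query \<Rightarrow> tuple option pmf" where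
  "sample_law Q =
     (if join Q = {} then return_pmf None else map_pmf Some (pmf_of_set (join Q)))"

text \<open>Joint distribution of the outcomes of the first t sampling operations and of the state after
  them, where the operations are executed one after the other following the construction.\<close>

primrec session ::
  "nat \<Rightarrow> join_query \<Rightarrow> program \<Rightarrow> program \<Rightarrow> machine \<Rightarrow> nat \<Rightarrow> (tuple option list \<times> machine) spmf" where
  "session W Q build sample s 0 = map_spmf (\<lambda>s'. ([], s')) (run W build s)"
| "session W Q build sample s (Suc t) =
     bind_spmf (session W Q build sample s t) (\<lambda>(os, s').
       map_spmf (\<lambda>s''. (os @ [outcome Q s''], s'')) (run W sample s'))"

definition expected_sample_time ::
  "nat \<Rightarrow> join_query \<Rightarrow> program \<Rightarrow> program \<Rightarrow> machine \<Rightarrow> nat \<Rightarrow> ennreal" where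
  "expected_sample_time W Q build sample s t =
     (\<integral>\<^sup>+ x. expected_time W sample (snd x) \<partial>measure_spmf (session W Q build sample s t))"

text \<open>Every operation is uniform on the join, and the outcomes of any number of operations are
  mutually independent: their joint distribution is the product distribution.\<close>

definition samples_independently ::
  "nat \<Rightarrow> join_query \<Rightarrow> program \<Rightarrow> program \<Rightarrow> machine \<Rightarrow> bool" where
  "samples_independently W Q build sample s \<longleftrightarrow>
     (\<forall>t. map_spmf fst (session W Q build sample s t) =
          spmf_of_pmf (replicate_pmf t (sample_law Q)))"

end

theory Submission
  imports Defs
begin

text \<open>
  Order the attributes such that X precedes Y - X for every constraint. For a relation R, a set Z of
  its attributes and a tuple t, let d(i) be the number of tuples in the projection of R to Z that agree
  with t on those of the first i attributes that lie in Z. Choose for every attribute the pair (R, Z)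
  for which d(i+1) / d(i) is largest. The logarithms of the inverses of these ratios define a modular
  function, and for a constraint (X, Y, N) the ratios of its guard and Z = Y telescope to at least
  1 / N. So the function is admissible in the polymatroid bound, and the product of the chosen ratios
  is at least 1 / polymat; no linear programming duality is needed.

  For a fixed choice of pairs, the prefix trees of the projections place the tuples of the join in
  disjoint subintervals of [0,1), the length of the interval of t being the product of the ratios. If
  this length is at least 1 / B, then the interval contains a first multiple of 1 / B. If B is large
  enough for the largest ratios of all tuples, every tuple t thus has exactly one seed, made of the
  first choice that gives t an interval of length at least 1 / B and of this multiple. Hash tables
  decode a seed in constant time. There are O(B) seeds, so uniform seeds are drawn until one is the
  seed of a tuple; a simultaneous scan of all seeds detects the empty join.

  Such a power of two B <= 2^k polymat is found by trying all assignments of powers of two to the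
  attributes that respect the constraints, which takes time O(log^k IN); the factor 2^k makes up for
  rounding logarithms down to integers.

  For given m and k there are finitely many schemas and constraint sets, so that the program is a case
  distinction between programs that are specialised to them.
\<close>

section \<open>Running programs\<close>

text \<open>The best pairs depend on the tuple, which is unknown while a seed is being decoded.
  Hence the choice is guessed as part of the seed; there are constantly many choices, so this costs
  a constant factor. Uniformity rests on nothing but the uniqueness of seeds: every tuple of the
  join is hit with the same probability, and no probability has to be corrected by further coin
  flips. The maximum over all relations and all subsets of their schemas covers the guard of each
  constraint, although the program does not know which relation this is. Acyclicity enters at one
  point: at the first level that fixes an attribute of Y - X, all of X has been fixed, so the
  telescoping product starts from at most N tuples. Interval endpoints are fractions whose terms are
  bounded by products of k cardinalities; a word length that is a constant multiple of w lets all of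
  this be computed exactly, without rounding.\<close>

lemma steps_add: "steps W (a + b) c = bind_pmf (steps W a c) (steps W b)"
  by (induction b) (simp_all add: bind_return_pmf' bind_assoc_pmf)

lemma steps_Suc_left: "steps W (Suc n) c = bind_pmf (step W c) (steps W n)"
  using steps_add[of W 1 n c] by (simp add: bind_return_pmf)

lemma step_halted: "fst c = [] \<Longrightarrow> step W c = return_pmf c"
  by (cases c) simp

lemma steps_halted: "fst c = [] \<Longrightarrow> steps W n c = return_pmf c"
  by (induction n) (simp_all add: step_halted bind_return_pmf)

text \<open>Truncating the running time at \<open>N\<close> steps allows induction on
  \<open>N\<close> for loops whose number of rounds is unbounded. The expected time is the limit of
  the truncations, so bounds that are uniform in \<open>N\<close> carry over.\<close>

definition time_upto :: "nat \<Rightarrow> nat \<Rightarrow> config \<Rightarrow> ennreal" where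
  "time_upto W N c = (\<Sum>i<N. emeasure (measure_pmf (steps W i c)) {c. fst c \<noteq> []})"

lemma expected_time_leI:
  assumes "\<And>N. time_upto W N (P, s) \<le> V"
  shows "expected_time W P s \<le> V"
  unfolding expected_time_def using assms
  by (intro suminf_le_const) (auto simp: time_upto_def)

lemma time_upto_le_expected_time: "time_upto W N (P, s) \<le> expected_time W P s"
  unfolding expected_time_def time_upto_def by (intro sum_le_suminf) auto

lemma time_upto_le: "time_upto W N c \<le> of_nat N"
proof -
  have "time_upto W N c \<le> (\<Sum>i<N. 1)"
    unfolding time_upto_def by (intro sum_mono measure_pmf.emeasure_le_1)
  then show ?thesis by simp
qed

text \<open>The first \<open>a\<close> steps are charged in full although the machine may halt
  earlier; hence only an inequality.\<close>

lemma time_upto_add: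
  "time_upto W (a + b) c \<le> of_nat a + (\<integral>\<^sup>+ c'. time_upto W b c' \<partial>measure_pmf (steps W a c))"
proof -
  have *: "{..<a + b} = {..<a} \<union> (\<lambda>i. a + i) ` {..<b}"
  proof (intro set_eqI iffI)
    fix x assume "x \<in> {..<a + b}"
    then show "x \<in> {..<a} \<union> (\<lambda>i. a + i) ` {..<b}"
      by (cases "x < a") (auto intro!: image_eqI[of _ _ "x - a"])
  qed auto
  have "time_upto W (a + b) c = time_upto W a c +
      (\<Sum>i<b. emeasure (measure_pmf (steps W (a + i) c)) {c. fst c \<noteq> []})"
    unfolding time_upto_def * by (subst sum.union_disjoint) (auto simp: sum.reindex)
  also have "(\<Sum>i<b. emeasure (measure_pmf (steps W (a + i) c)) {c. fst c \<noteq> []}) =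
      (\<integral>\<^sup>+ c'. time_upto W b c' \<partial>measure_pmf (steps W a c))"
    unfolding time_upto_def by (subst nn_integral_sum) (auto simp: steps_add emeasure_bind_pmf)
  finally show ?thesis using time_upto_le[of W a c] by (simp add: add_right_mono)
qed

lemma expected_time_steps_return:
  assumes "steps W n (P, s) = return_pmf (P', s')"
  shows "expected_time W P s \<le> of_nat n + expected_time W P' s'"
proof (rule expected_time_leI)
  fix N
  have "time_upto W N (P, s) \<le> time_upto W (n + N) (P, s)"
    unfolding time_upto_def by (intro sum_mono2) auto
  also have "\<dots> \<le> of_nat n + time_upto W N (P', s')"
    using time_upto_add[of W n N "(P, s)"] by (simp add: assms)
  also have "\<dots> \<le> of_nat n + expected_time W P' s'"
    by (intro add_left_mono time_upto_le_expected_time)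
  finally show "time_upto W N (P, s) \<le> of_nat n + expected_time W P' s'" .
qed

lemma expected_time_Nil [simp]: "expected_time W [] s = 0"
  unfolding expected_time_def by (simp add: steps_halted)

lemma run_config_halted [simp]: "run_config W ([], s) = return_spmf s"
  by (subst run_config.simps) simp

text \<open>Halted configurations are fixed points of \<open>step\<close>, so executing
  \<open>n\<close> steps in advance does not change the final result, even if the machine halts
  among them.\<close>

lemma run_config_steps: "run_config W c = bind_spmf (spmf_of_pmf (steps W n c)) (run_config W)"
proof (induction n arbitrary: c)
  case (Suc n)
  show ?case
  proof (cases "fst c = []")
    case True
    then show ?thesis by (simp add: steps_halted del: steps.simps)
  next
    case False
    then have "run_config W c = bind_spmf (spmf_of_pmf (step W c)) (run_config W)"
      by (subst run_config.simps) simp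
    also have "\<dots> = bind_spmf (spmf_of_pmf (step W c))
        (\<lambda>c'. bind_spmf (spmf_of_pmf (steps W n c')) (run_config W))"
      by (intro bind_spmf_cong refl Suc.IH)
    also have "\<dots> = bind_spmf (spmf_of_pmf (steps W (Suc n) c)) (run_config W)"
      by (simp only: bind_spmf_of_pmf steps_Suc_left bind_assoc_pmf)
    finally show ?thesis .
  qed
qed simp

lemma run_steps_return:
  assumes "steps W n (P, s) = return_pmf (P', s')"
  shows "run W P s = run W P' s'"
  unfolding run_def by (subst run_config_steps[of _ _ n]) (simp add: assms)

text \<open>\<open>step\<close> acts on the list of all remaining commands, so \<open>P\<close> is
  never executed in isolation. Quantifying over the continuation \<open>K\<close> is what makes the
  notion compose.\<close>

definition runs :: "nat \<Rightarrow> program \<Rightarrow> machine \<Rightarrow> nat \<Rightarrow> machine \<Rightarrow> bool" where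
  "runs W P s n s' \<longleftrightarrow> (\<forall>K. steps W n (P @ K, s) = return_pmf (K, s'))"

lemma runs_steps: "runs W P s n s' \<Longrightarrow> steps W n (P @ K, s) = return_pmf (K, s')"
  by (simp add: runs_def)

lemma runs_Nil: "runs W [] s 0 s"
  by (simp add: runs_def)

lemma runs_append: "runs W P s n s' \<Longrightarrow> runs W P' s' n' s'' \<Longrightarrow> runs W (P @ P') s (n + n') s''"
  by (simp add: runs_def steps_add bind_return_pmf)

lemma runs_SetReg: "runs W [SetReg r e] s 1 (s\<lparr>reg := (reg s)(r := eval W s e)\<rparr>)"
  by (simp add: runs_def bind_return_pmf)

lemma runs_SetTable:
  "runs W [SetTable es e] s 1 (s\<lparr>table := (table s)(map (eval W s) es := eval W s e)\<rparr>)"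
  by (simp add: runs_def bind_return_pmf)

lemma runs_If:
  "runs W (if eval W s e \<noteq> 0 then P else P') s n s' \<Longrightarrow> runs W [If e P P'] s (Suc n) s'"
  unfolding runs_def by (simp add: steps_Suc_left bind_return_pmf del: steps.simps)

lemma runs_While_False: "eval W s e = 0 \<Longrightarrow> runs W [While e P] s 1 s"
  by (simp add: runs_def bind_return_pmf)

lemma runs_While_True:
  assumes "eval W s e \<noteq> 0" "runs W P s n s'" "runs W [While e P] s' n' s''"
  shows "runs W [While e P] s (Suc (n + n')) s''"
  unfolding runs_def
proof
  fix K
  have "steps W (Suc (n + n')) ([While e P] @ K, s) =
      steps W (n + n') (P @ ([While e P] @ K), s)"
    using assms(1) by (simp add: steps_Suc_left bind_return_pmf del: steps.simps)
  also have "\<dots> = return_pmf (K, s'')"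
    using assms(2,3) unfolding runs_def steps_add by (simp add: bind_return_pmf)
  finally show "steps W (Suc (n + n')) ([While e P] @ K, s) = return_pmf (K, s'')" .
qed

text \<open>A total correctness triple for deterministic executions with a time bound: the
  postcondition describes the final state, whose exact form and exact step count are
  forgotten.\<close>

definition execs :: "nat \<Rightarrow> program \<Rightarrow> machine \<Rightarrow> nat \<Rightarrow> (machine \<Rightarrow> bool) \<Rightarrow> bool" where
  "execs W P s N Post \<longleftrightarrow> (\<exists>n\<le>N. \<exists>s'. runs W P s n s' \<and> Post s')"

lemma execs_append:
  assumes "execs W P s N Mid" "\<And>s'. Mid s' \<Longrightarrow> execs W P' s' N' Post"
  shows "execs W (P @ P') s (N + N') Post"
proof -
  obtain n s1 where 1: "n \<le> N" "runs W P s n s1" "Mid s1"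
    using assms(1) unfolding execs_def by blast
  obtain n' s2 where 2: "n' \<le> N'" "runs W P' s1 n' s2" "Post s2"
    using assms(2)[OF 1(3)] unfolding execs_def by blast
  show ?thesis
    unfolding execs_def using 1 2 runs_append[OF 1(2) 2(2)] add_mono by blast
qed

lemma execs_mono:
  assumes "execs W P s N Post" "N \<le> N'" "\<And>s'. Post s' \<Longrightarrow> Post' s'"
  shows "execs W P s N' Post'"
  using assms unfolding execs_def by (meson le_trans)

lemma execs_Nil: "Post s \<Longrightarrow> execs W [] s 0 Post"
  unfolding execs_def using runs_Nil by blast

lemma execs_SetReg:
  "Post (s\<lparr>reg := (reg s)(r := eval W s e)\<rparr>) \<Longrightarrow> execs W [SetReg r e] s 1 Post"
  unfolding execs_def using runs_SetReg by blast

lemma execs_SetTable: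
  "Post (s\<lparr>table := (table s)(map (eval W s) es := eval W s e)\<rparr>) \<Longrightarrow> execs W [SetTable es e] s 1 Post"
  unfolding execs_def using runs_SetTable by blast

lemma execs_If:
  assumes "eval W s e \<noteq> 0 \<Longrightarrow> execs W P s N Post" "eval W s e = 0 \<Longrightarrow> execs W P' s N Post"
  shows "execs W [If e P P'] s (Suc N) Post"
proof -
  have "execs W (if eval W s e \<noteq> 0 then P else P') s N Post" using assms by simp
  then show ?thesis unfolding execs_def using runs_If[of W s e P P'] by (meson Suc_le_mono)
qed

lemma execs_concat:
  assumes "I 0 s"
    and "\<And>j s. j < n \<Longrightarrow> I j s \<Longrightarrow> execs W (f j) s N (I (Suc j))"
  shows "execs W (concat (map f [0..<n])) s (n * N) (I n)"
  using assms(2)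
proof (induction n)
  case (Suc n)
  have "execs W (concat (map f [0..<n]) @ f n) s (n * N + N) (I (Suc n))"
    by (rule execs_append[OF Suc.IH]) (use Suc.prems in auto)
  then show ?case by (simp add: add.commute)
qed (simp add: execs_Nil assms(1))

text \<open>The invariant is tied to the round: \<open>I j\<close> holds before round
  \<open>j\<close>, so the number \<open>n\<close> of rounds is fixed beforehand. A round costs its
  body and one test, and one more test ends the loop.\<close>

lemma execs_While:
  assumes "I 0 s"
    and step: "\<And>j s. j < n \<Longrightarrow> I j s \<Longrightarrow> eval W s e \<noteq> 0 \<and> execs W P s N (I (Suc j))"
    and stop: "\<And>s. I n s \<Longrightarrow> eval W s e = 0"
  shows "execs W [While e P] s (n * Suc N + 1) (I n)"
proof -
  \<comment> \<open>Induction on the number \<open>i\<close> of rounds still to come.\<close>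
  have "I (n - i) s \<Longrightarrow> i \<le> n \<Longrightarrow> execs W [While e P] s (i * Suc N + 1) (I n)" for i s
  proof (induction i arbitrary: s)
    case 0
    then show ?case unfolding execs_def using runs_While_False[OF stop[of s]] by auto
  next
    case (Suc i)
    then have e: "eval W s e \<noteq> 0" and x: "execs W P s N (I (n - i))"
      using step[of "n - Suc i" s] by (auto simp: Suc_diff_Suc)
    from x obtain a s' where a: "a \<le> N" "runs W P s a s'" "I (n - i) s'"
      unfolding execs_def by blast
    then obtain b s'' where b: "b \<le> i * Suc N + 1" "runs W [While e P] s' b s''" "I n s''"
      using Suc unfolding execs_def by (meson Suc_leD)
    show ?case unfolding execs_def
      using runs_While_True[OF e a(2) b(2)] a(1) b(1,3) by (intro exI[of _ "Suc (a + b)"]) auto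
  qed
  from this[of n s] assms(1) show ?thesis by simp
qed

lemma execs_run:
  assumes "execs W P s N Post"
  shows "\<exists>s'. run W P s = return_spmf s' \<and> Post s'" "expected_time W P s \<le> of_nat N"
proof -
  obtain n s' where n: "n \<le> N" "runs W P s n s'" "Post s'" using assms unfolding execs_def by blast
  then have st: "steps W n (P, s) = return_pmf ([], s')" using runs_steps[of W P s n s' "[]"] by simp
  show "\<exists>s'. run W P s = return_spmf s' \<and> Post s'"
    using run_steps_return[OF st] n(3) by (auto simp: run_def)
  show "expected_time W P s \<le> of_nat N"
    using order_trans[OF expected_time_steps_return[OF st]] of_nat_mono[OF n(1)] by simp
qed

section \<open>Loop-free programs\<close>

text \<open>Symbolic execution by simplification. The last equation is a dummy value for memory
  writes, random draws and loops, which \<open>loop_free\<close> rules out; so a loop-free program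
  never alters the memory that holds the input.\<close>

fun result :: "nat \<Rightarrow> program \<Rightarrow> machine \<Rightarrow> machine" where
  "result W [] s = s"
| "result W (SetReg r e # K) s = result W K (s\<lparr>reg := (reg s)(r := eval W s e)\<rparr>)"
| "result W (SetTable es e # K) s =
     result W K (s\<lparr>table := (table s)(map (eval W s) es := eval W s e)\<rparr>)"
| "result W (If e P P' # K) s = result W K (if eval W s e \<noteq> 0 then result W P s else result W P' s)"
| "result W (_ # K) s = s"

fun loop_free :: "program \<Rightarrow> bool" where
  "loop_free [] = True"
| "loop_free (SetReg r e # K) = loop_free K"
| "loop_free (SetTable es e # K) = loop_free K"
| "loop_free (If e P P' # K) = (loop_free P \<and> loop_free P' \<and> loop_free K)"
| "loop_free (_ # K) = False"

fun cost :: "program \<Rightarrow> nat" where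
  "cost [] = 0"
| "cost (If e P P' # K) = Suc (max (cost P) (cost P') + cost K)"
| "cost (_ # K) = Suc (cost K)"

lemma result_append: "loop_free P \<Longrightarrow> result W (P @ P') s = result W P' (result W P s)"
  by (induction W P s rule: result.induct) auto

lemma loop_free_append [simp]: "loop_free (P @ P') \<longleftrightarrow> loop_free P \<and> loop_free P'"
  by (induction P rule: loop_free.induct) auto

lemma loop_free_concat: "loop_free (concat Ps) \<longleftrightarrow> (\<forall>P\<in>set Ps. loop_free P)"
  by (induction Ps) auto

lemma execs_result: "loop_free P \<Longrightarrow> execs W P s (cost P) (\<lambda>s'. s' = result W P s)"
proof (induction W P s rule: result.induct)
  case (2 W r e K s)
  then have "execs W ([SetReg r e] @ K) s (1 + cost K) (\<lambda>s'. s' = result W (SetReg r e # K) s)"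
    by (intro execs_append[OF execs_SetReg[where Post = "\<lambda>x. x = s\<lparr>reg := (reg s)(r := eval W s e)\<rparr>"]]) auto
  then show ?case by simp
next
  case (3 W es e K s)
  then have "execs W ([SetTable es e] @ K) s (1 + cost K) (\<lambda>s'. s' = result W (SetTable es e # K) s)"
    by (intro execs_append[OF execs_SetTable[where Post =
      "\<lambda>x. x = s\<lparr>table := (table s)(map (eval W s) es := eval W s e)\<rparr>"]]) auto
  then show ?case by simp
next
  case (4 W e P P' K s)
  have "execs W ([If e P P'] @ K) s (Suc (max (cost P) (cost P')) + cost K)
      (\<lambda>s'. s' = result W (If e P P' # K) s)"
  proof (rule execs_append)
    show "execs W [If e P P'] s (Suc (max (cost P) (cost P')))
        (\<lambda>x. x = (if eval W s e \<noteq> 0 then result W P s else result W P' s))"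
      using 4 by (intro execs_If) (auto elim!: execs_mono)
  qed (use 4 in auto)
  then show ?case by simp
qed (auto intro: execs_Nil)

lemma execs_resultI: "loop_free P \<Longrightarrow> Post (result W P s) \<Longrightarrow> cost P \<le> N \<Longrightarrow> execs W P s N Post"
  by (rule execs_mono[OF execs_result]) auto


section \<open>Indexing a relation by one level of its prefix tree\<close>

definition kids :: "nat \<Rightarrow> nat list set \<Rightarrow> nat list \<Rightarrow> nat set" where
  "kids j U \<kappa> = {a. \<exists>y\<in>U. take (Suc j) y = \<kappa> @ [a]}"

text \<open>V is the projection of the relation and U the part of it that has been entered. The tables are
  0: membership flags (2 once entered), 1: final number of tuples below a child, 2: number entered
  so far, 3: start of the interval of a child within the interval of its parent, 4: total length of
  the intervals opened below a node, 5: the child to which a point of the interval of a node belongs.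
  A contains the children whose interval has been opened.\<close>

definition index_inv ::
  "nat \<Rightarrow> nat list set \<Rightarrow> nat list set \<Rightarrow> (nat list \<Rightarrow> nat set) \<Rightarrow> (nat \<Rightarrow> nat list \<Rightarrow> nat) \<Rightarrow> bool" where
  "index_inv j V U A tb \<longleftrightarrow>
     (\<forall>x. tb 0 x = of_bool (x \<in> V) + of_bool (x \<in> U)) \<and>
     (\<forall>x. tb 1 x = card {y\<in>V. take (Suc j) y = x}) \<and>
     (\<forall>x. tb 2 x = card {y\<in>U. take (Suc j) y = x}) \<and>
     (\<forall>\<kappa>. finite (A \<kappa>) \<and> tb 4 \<kappa> = (\<Sum>a\<in>A \<kappa>. tb 1 (\<kappa> @ [a]))) \<and>
     (\<forall>\<kappa>. \<forall>a\<in>A \<kappa>. tb 3 (\<kappa> @ [a]) + tb 1 (\<kappa> @ [a]) \<le> tb 4 \<kappa>) \<and>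
     (\<forall>\<kappa>. \<forall>a\<in>A \<kappa>. \<forall>b\<in>A \<kappa>. a \<noteq> b \<longrightarrow>
        tb 3 (\<kappa> @ [a]) + tb 1 (\<kappa> @ [a]) \<le> tb 3 (\<kappa> @ [b]) \<or>
        tb 3 (\<kappa> @ [b]) + tb 1 (\<kappa> @ [b]) \<le> tb 3 (\<kappa> @ [a])) \<and>
     (\<forall>\<kappa>. \<forall>a\<in>A \<kappa>. \<forall>x<tb 2 (\<kappa> @ [a]). tb 5 (\<kappa> @ [tb 3 (\<kappa> @ [a]) + x]) = a)"

definition upd :: "(nat \<Rightarrow> nat list \<Rightarrow> nat) \<Rightarrow> nat \<Rightarrow> nat list \<Rightarrow> nat \<Rightarrow> nat \<Rightarrow> nat list \<Rightarrow> nat" where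
  "upd tb i x v = (\<lambda>i' x'. if i' = i \<and> x' = x then v else tb i' x')"

lemma index_inv_open:
  assumes inv: "index_inv j V U A tb" and a: "a \<notin> A \<kappa>" and z: "tb 2 (\<kappa> @ [a]) = 0"
  shows "index_inv j V U (A(\<kappa> := insert a (A \<kappa>)))
    (upd (upd tb 3 (\<kappa> @ [a]) (tb 4 \<kappa>)) 4 \<kappa> (tb 4 \<kappa> + tb 1 (\<kappa> @ [a])))"
proof -
  note d = inv[unfolded index_inv_def]
  define A' where "A' = A(\<kappa> := insert a (A \<kappa>))"
  define tb' where "tb' = (upd (upd tb 3 (\<kappa> @ [a]) (tb 4 \<kappa>)) 4 \<kappa> (tb 4 \<kappa> + tb 1 (\<kappa> @ [a])))"
  have same: "tb' 0 = tb 0" "tb' 1 = tb 1" "tb' 2 = tb 2" "tb' 5 = tb 5"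
    by (auto simp: tb'_def upd_def)
  have 3: "tb' 3 x = (if x = \<kappa> @ [a] then tb 4 \<kappa> else tb 3 x)" for x
    by (simp add: tb'_def upd_def)
  have 4: "tb' 4 x = (if x = \<kappa> then tb 4 \<kappa> + tb 1 (\<kappa> @ [a]) else tb 4 x)" for x
    by (simp add: tb'_def upd_def)
  have A': "b \<in> A' \<kappa>' \<longleftrightarrow> b \<in> A \<kappa>' \<or> \<kappa>' = \<kappa> \<and> b = a" for b \<kappa>'
    by (auto simp: A'_def)
  have le: "tb 3 (\<kappa>' @ [b]) + tb 1 (\<kappa>' @ [b]) \<le> tb 4 \<kappa>'" if "b \<in> A \<kappa>'" for \<kappa>' b
    using d that by blast
  have old: "\<kappa>' @ [b] \<noteq> \<kappa> @ [a]" if "b \<in> A \<kappa>'" for \<kappa>' b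
    using that a by auto
  have c4: "finite (A' \<kappa>') \<and> tb' 4 \<kappa>' = (\<Sum>a\<in>A' \<kappa>'. tb 1 (\<kappa>' @ [a]))" for \<kappa>'
    using d a by (simp add: A'_def 4)
  have c3: "tb' 3 (\<kappa>' @ [b]) + tb 1 (\<kappa>' @ [b]) \<le> tb' 4 \<kappa>'" if "b \<in> A' \<kappa>'" for \<kappa>' b
    using that le[of b \<kappa>'] old[of b \<kappa>'] by (auto simp: A' 3 4)
  have c6: "tb' 3 (\<kappa>' @ [b]) + tb 1 (\<kappa>' @ [b]) \<le> tb' 3 (\<kappa>' @ [b']) \<or>
        tb' 3 (\<kappa>' @ [b']) + tb 1 (\<kappa>' @ [b']) \<le> tb' 3 (\<kappa>' @ [b])"
    if "b \<in> A' \<kappa>'" "b' \<in> A' \<kappa>'" "b \<noteq> b'" for \<kappa>' b b'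
  proof (cases "b \<in> A \<kappa>' \<and> b' \<in> A \<kappa>'")
    case True
    then have "tb 3 (\<kappa>' @ [b]) + tb 1 (\<kappa>' @ [b]) \<le> tb 3 (\<kappa>' @ [b']) \<or>
        tb 3 (\<kappa>' @ [b']) + tb 1 (\<kappa>' @ [b']) \<le> tb 3 (\<kappa>' @ [b])"
      using d that(3) by blast
    then show ?thesis using True old[of b \<kappa>'] old[of b' \<kappa>'] unfolding 3 by presburger
  next
    case False
    then show ?thesis using that le[of b \<kappa>'] le[of b' \<kappa>'] by (auto simp: A' 3)
  qed
  have c5: "tb 5 (\<kappa>' @ [tb' 3 (\<kappa>' @ [b]) + x]) = b"
    if "b \<in> A' \<kappa>'" "x < tb 2 (\<kappa>' @ [b])" for \<kappa>' b x
  proof -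
    have "b \<in> A \<kappa>'" using that z by (auto simp: A')
    then show ?thesis using d that(2) old[of b \<kappa>'] unfolding 3 by presburger
  qed
  have "index_inv j V U A' tb'"
    unfolding index_inv_def same
    using conjunct1[OF d] conjunct1[OF conjunct2[OF d]] conjunct1[OF conjunct2[OF conjunct2[OF d]]]
      c4 c3 c6 c5 by (intro conjI) blast+
  then show ?thesis by (simp only: tb'_def A'_def)
qed

text \<open>The length reserved for a child is the final number of tuples below it. As
  \<open>y\<close> is still missing, fewer than that many have been entered, so the next free point
  lies in the interval of the child and outside those of its siblings.\<close>

lemma index_inv_fill:
  fixes y :: "nat list" and j :: nat
  defines "\<kappa> \<equiv> take j y" and "a \<equiv> y ! j"
  assumes inv: "index_inv j V U A tb" and y: "y \<in> V" "y \<notin> U" "j < length y"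
    and V: "finite V" "U \<subseteq> V" and a: "a \<in> A \<kappa>"
  shows "index_inv j V (insert y U) A
    (upd (upd (upd tb 0 y 2) 5 (\<kappa> @ [tb 3 (\<kappa> @ [a]) + tb 2 (\<kappa> @ [a])]) a)
       2 (\<kappa> @ [a]) (tb 2 (\<kappa> @ [a]) + 1))"
proof -
  note d = inv[unfolded index_inv_def]
  have t: "take (Suc j) y = \<kappa> @ [a]"
    using y by (simp add: \<kappa>_def a_def take_Suc_conv_app_nth)
  have fin: "finite U" using V finite_subset by blast
  have sub: "tb 2 x \<le> tb 1 x" for x
    using d V by (auto intro!: card_mono)
  have "card {z\<in>insert y U. take (Suc j) z = \<kappa> @ [a]} \<le> card {z\<in>V. take (Suc j) z = \<kappa> @ [a]}"
    using V y by (intro card_mono) auto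
  moreover have eq: "{z\<in>insert y U. take (Suc j) z = \<kappa> @ [a]} =
      insert y {z\<in>U. take (Suc j) z = \<kappa> @ [a]}" using t by auto
  ultimately have lt: "tb 2 (\<kappa> @ [a]) < tb 1 (\<kappa> @ [a])"
    using d y(2) fin by simp
  have c: "card {z\<in>insert y U. take (Suc j) z = x} =
      (if x = \<kappa> @ [a] then tb 2 x + 1 else tb 2 x)" for x
  proof (cases "x = \<kappa> @ [a]")
    case True
    then show ?thesis using d eq y(2) fin by simp
  next
    case False
    then have "{z\<in>insert y U. take (Suc j) z = x} = {z\<in>U. take (Suc j) z = x}"
      using t by auto
    then show ?thesis using d False by simp
  qed
  \<comment> \<open>The point written now is none of those that table 5 already describes: siblings
    have disjoint intervals, and within one child the points are used in increasing order.\<close>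
  have e: "(\<kappa>' @ [tb 3 (\<kappa>' @ [b]) + x] \<noteq> \<kappa> @ [tb 3 (\<kappa> @ [a]) + tb 2 (\<kappa> @ [a])])"
    if "b \<in> A \<kappa>'" "x < tb 2 (\<kappa>' @ [b])" for \<kappa>' b x
  proof (cases "\<kappa>' = \<kappa>")
    case True
    show ?thesis
    proof (cases "b = a")
      case False
      then have "tb 3 (\<kappa> @ [a]) + tb 1 (\<kappa> @ [a]) \<le> tb 3 (\<kappa> @ [b]) \<or>
        tb 3 (\<kappa> @ [b]) + tb 1 (\<kappa> @ [b]) \<le> tb 3 (\<kappa> @ [a])"
        using d a that(1) unfolding True by blast
      moreover have "x < tb 1 (\<kappa> @ [b])"
        using that(2) sub[of "\<kappa> @ [b]"] unfolding True by linarith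
      ultimately have "tb 3 (\<kappa> @ [b]) + x \<noteq> tb 3 (\<kappa> @ [a]) + tb 2 (\<kappa> @ [a])"
        using lt by linarith
      then show ?thesis unfolding True by simp
    next
      case b: True
      show ?thesis using that(2) unfolding True b by simp
    qed
  qed simp
  define tb' where "tb' = (upd (upd (upd tb 0 y 2) 5 (\<kappa> @ [tb 3 (\<kappa> @ [a]) + tb 2 (\<kappa> @ [a])]) a)
       2 (\<kappa> @ [a]) (tb 2 (\<kappa> @ [a]) + 1))"
  have same: "tb' 1 = tb 1" "tb' 3 = tb 3" "tb' 4 = tb 4"
    by (auto simp: tb'_def upd_def)
  have 0: "tb' 0 x = of_bool (x \<in> V) + of_bool (x \<in> insert y U)" for x
    using d y(1) by (simp add: tb'_def upd_def)
  have 2: "tb' 2 x = card {z\<in>insert y U. take (Suc j) z = x}" for x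
    unfolding c by (simp add: tb'_def upd_def)
  have 5: "tb' 5 (\<kappa>' @ [tb 3 (\<kappa>' @ [b]) + x]) = b"
    if "b \<in> A \<kappa>'" "x < tb' 2 (\<kappa>' @ [b])" for \<kappa>' b x
  proof (cases "\<kappa>' = \<kappa> \<and> b = a \<and> x = tb 2 (\<kappa> @ [a])")
    case False
    then have x: "x < tb 2 (\<kappa>' @ [b])"
      using that(2) by (auto simp: tb'_def upd_def split: if_splits)
    have "tb 5 (\<kappa>' @ [tb 3 (\<kappa>' @ [b]) + x]) = b" using d that(1) x by blast
    then show ?thesis using e[OF that(1) x] by (auto simp add: tb'_def upd_def)
  qed (simp add: tb'_def upd_def)
  have "index_inv j V (insert y U) A tb'"
    unfolding index_inv_def same
  proof (intro conjI, goal_cases)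
    case 1 then show ?case using 0 by blast
  next
    case 3 then show ?case using 2 by blast
  next
    case 7 then show ?case using 5 by blast
  next
    case 2 then show ?case using d by (elim conjE)
  next
    case 4 then show ?case using d by (elim conjE)
  next
    case 5 then show ?case using d by (elim conjE)
  next
    case 6 then show ?case using d by (elim conjE)
  qed
  then show ?thesis by (simp only: tb'_def)
qed

definition index_spec :: "nat \<Rightarrow> nat list set \<Rightarrow> (nat \<Rightarrow> nat list \<Rightarrow> nat) \<Rightarrow> bool" where
  "index_spec j V tb \<longleftrightarrow>
     (\<forall>x. tb 0 x = (if x \<in> V then 2 else 0)) \<and>
     (\<forall>x. tb 1 x = card {y\<in>V. take (Suc j) y = x}) \<and>
     (\<forall>\<kappa>. tb 4 \<kappa> = card {y\<in>V. take j y = \<kappa>}) \<and>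
     (\<forall>\<kappa> a. tb 1 (\<kappa> @ [a]) > 0 \<longrightarrow> tb 3 (\<kappa> @ [a]) + tb 1 (\<kappa> @ [a]) \<le> tb 4 \<kappa> \<and>
        (\<forall>x. tb 3 (\<kappa> @ [a]) \<le> x \<and> x < tb 3 (\<kappa> @ [a]) + tb 1 (\<kappa> @ [a]) \<longrightarrow> tb 5 (\<kappa> @ [x]) = a))"

text \<open>Once all of \<open>V\<close> has been entered, table 2 agrees with table 1, so every
  point of every interval has been filled. The children of a node partition the tuples below it,
  which turns the sum for table 4 into a count.\<close>

lemma index_spec_of_inv:
  assumes inv: "index_inv j V V (kids j V) tb" and V: "finite V" "\<And>y. y \<in> V \<Longrightarrow> j < length y"
  shows "index_spec j V tb"
proof -
  note d = inv[unfolded index_inv_def]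
  have 4: "tb 4 \<kappa> = card {y\<in>V. take j y = \<kappa>}" for \<kappa>
  proof -
    have "tb 4 \<kappa> = (\<Sum>a\<in>kids j V \<kappa>. card {y\<in>V. take (Suc j) y = \<kappa> @ [a]})"
      using d by auto
    also have "\<dots> = card (\<Union>a\<in>kids j V \<kappa>. {y\<in>V. take (Suc j) y = \<kappa> @ [a]})"
      using V d by (intro card_UN_disjoint[symmetric]) auto
    also have "(\<Union>a\<in>kids j V \<kappa>. {y\<in>V. take (Suc j) y = \<kappa> @ [a]}) = {y\<in>V. take j y = \<kappa>}"
      using V by (auto simp: kids_def take_Suc_conv_app_nth)
    finally show ?thesis .
  qed
  have "a \<in> kids j V \<kappa>" if "tb 1 (\<kappa> @ [a]) > 0" for \<kappa> a
    using that d V by (auto simp: kids_def card_gt_0_iff)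
  moreover have "tb 5 (\<kappa> @ [x]) = a" if "a \<in> kids j V \<kappa>" "tb 3 (\<kappa> @ [a]) \<le> x"
    "x < tb 3 (\<kappa> @ [a]) + tb 1 (\<kappa> @ [a])" for \<kappa> a x
  proof -
    have "x - tb 3 (\<kappa> @ [a]) < tb 2 (\<kappa> @ [a])" using d that by auto
    then have "tb 5 (\<kappa> @ [tb 3 (\<kappa> @ [a]) + (x - tb 3 (\<kappa> @ [a]))]) = a"
      using d that(1) by blast
    then show ?thesis using that by simp
  qed
  ultimately show ?thesis
    unfolding index_spec_def using d 4 by auto
qed

text \<open>A child is open exactly if some tuple below it has been entered, that is, if table 2 is
  nonzero there. This lets the program recognise a new child without storing the set of opened
  children.\<close>

lemma index_inv_kids_step:
  fixes y :: "nat list" and j :: nat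
  defines "\<kappa> \<equiv> take j y" and "ka \<equiv> take (Suc j) y" and "a \<equiv> y ! j"
  defines "openit \<equiv> \<lambda>tb. if tb 2 ka = 0
      then upd (upd tb 3 ka (tb 4 \<kappa>)) 4 \<kappa> (tb 4 \<kappa> + tb 1 ka) else tb"
  assumes inv: "index_inv j V U (kids j U) tb" and y: "y \<in> V" "y \<notin> U" "j < length y"
    and V: "finite V" "U \<subseteq> V"
  shows "index_inv j V (insert y U) (kids j (insert y U))
    (upd (upd (upd (openit tb) 0 y 2) 5 (\<kappa> @ [openit tb 3 ka + tb 2 ka]) a) 2 ka (tb 2 ka + 1))"
proof -
  have t: "ka = \<kappa> @ [a]"
    using y by (simp add: \<kappa>_def a_def ka_def take_Suc_conv_app_nth)
  have A: "kids j (insert y U) = (kids j U)(\<kappa> := insert a (kids j U \<kappa>))"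
    using t by (auto simp: kids_def fun_eq_iff ka_def)
  have z: "tb 2 ka = 0 \<longleftrightarrow> a \<notin> kids j U \<kappa>"
    using inv V finite_subset[OF V(2,1)] by (auto simp: index_inv_def kids_def t)
  have 1: "index_inv j V U (kids j (insert y U)) (openit tb)"
  proof (cases "tb 2 ka = 0")
    case True
    then show ?thesis using index_inv_open[OF inv, of a \<kappa>] z A t by (simp add: openit_def)
  next
    case False
    then have "kids j (insert y U) = kids j U" using z A by (simp add: insert_absorb)
    then show ?thesis using inv False by (simp add: openit_def)
  qed
  have "openit tb 2 ka = tb 2 ka" by (simp add: openit_def upd_def)
  then show ?thesis
    using index_inv_fill[OF 1 y V, folded \<kappa>_def a_def] A t by simp
qed

text \<open>Register numbers, table tags and bounds are numerals and sums such as k + 1; without this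
  declaration the simplifier would rewrite only some of their occurrences to successor form.\<close>

declare One_nat_def [simp del]

lemma word_small [simp]: "n < 2 ^ W \<Longrightarrow> word W n = n"
  by (simp add: word_def)

section \<open>The program that builds one index\<close>

lemma index_inv_total_le:
  assumes inv: "index_inv j V U A tb" and V: "finite V"
  shows "tb 4 \<kappa> \<le> card V"
proof -
  note d = inv[unfolded index_inv_def]
  have "tb 4 \<kappa> = (\<Sum>a\<in>A \<kappa>. card {y\<in>V. take (Suc j) y = \<kappa> @ [a]})"
    using d by auto
  also have "\<dots> = card (\<Union>a\<in>A \<kappa>. {y\<in>V. take (Suc j) y = \<kappa> @ [a]})"
    using V d by (intro card_UN_disjoint[symmetric]) auto
  also have "\<dots> \<le> card V" using V by (intro card_mono) auto
  finally show ?thesis .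
qed

text \<open>The machine has a single hash table, so the tag \<open>i\<close> and the number
  \<open>g\<close> of the index separate the tables. Such keys have length at least 2; the shorter
  ones remain free for the powers of two and the bound \<open>B\<close>.\<close>

definition tkey :: "nat \<Rightarrow> nat \<Rightarrow> expr list \<Rightarrow> expr list" where
  "tkey i g es = Num i # Num g # es"

text \<open>First pass. Distinct tuples may have equal projections, and the membership flag ensures
  that each projection is counted once.\<close>

definition count_body :: "nat \<Rightarrow> nat \<Rightarrow> expr list \<Rightarrow> program" where
  "count_body g j es =
     [If (Op Eq (Table (tkey 0 g es)) (Num 0))
        [SetTable (tkey 0 g es) (Num 1),
         SetTable (tkey 1 g (take (Suc j) es)) (Op Add (Table (tkey 1 g (take (Suc j) es))) (Num 1))]
        [],
      SetReg 0 (Op Add (Reg 0) (Num 1))]"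

text \<open>Second pass, which needs the final counts of the first one because an interval is
  reserved in full length when it is opened. Raising the flag from 1 to 2 again filters out repeated
  projections.\<close>

definition fill_body :: "nat \<Rightarrow> nat \<Rightarrow> expr list \<Rightarrow> program" where
  "fill_body g j es =
    (let K = take j es; Ka = take (Suc j) es in
     [If (Op Eq (Table (tkey 0 g es)) (Num 1))
        [If (Op Eq (Table (tkey 2 g Ka)) (Num 0))
           [SetTable (tkey 3 g Ka) (Table (tkey 4 g K)),
            SetTable (tkey 4 g K) (Op Add (Table (tkey 4 g K)) (Table (tkey 1 g Ka)))]
           [],
         SetTable (tkey 0 g es) (Num 2),
         SetTable (tkey 5 g (K @ [Op Add (Table (tkey 3 g Ka)) (Table (tkey 2 g Ka))])) (es ! j),
         SetTable (tkey 2 g Ka) (Op Add (Table (tkey 2 g Ka)) (Num 1))]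
        [],
      SetReg 0 (Op Add (Reg 0) (Num 1))])"

definition index_prog :: "nat \<Rightarrow> nat \<Rightarrow> expr list \<Rightarrow> expr \<Rightarrow> program" where
  "index_prog g j es cnt =
     ([SetReg 0 (Num 0)] @ [While (Op Less (Reg 0) cnt) (count_body g j es)]) @
     ([SetReg 0 (Num 0)] @ [While (Op Less (Reg 0) cnt) (fill_body g j es)])"

definition tabs :: "nat \<Rightarrow> (nat list \<Rightarrow> nat) \<Rightarrow> nat \<Rightarrow> nat list \<Rightarrow> nat" where
  "tabs g T i x = T (i # g # x)"

lemma tabs_upd [simp]: "tabs g (T(i # g # x := v)) = upd (tabs g T) i x v"
  by (auto simp: tabs_def upd_def fun_eq_iff)

text \<open>Abstracts from the layout of the memory: all that matters about the expressions
  \<open>es\<close> is that they evaluate to row \<tau> while register 0 holds \<tau>. Words of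
  three bits suffice for the tags.\<close>

locale index_build =
  fixes W :: nat and M :: "nat \<Rightarrow> nat" and n g j :: nat and es :: "expr list" and cnt :: expr
    and v :: "nat \<Rightarrow> nat list"
  assumes W3: "3 \<le> W" and g: "g < 2 ^ W" and n: "n < 2 ^ W" and j: "j < length es"
    and rows: "\<And>s \<tau>. mem s = M \<Longrightarrow> reg s 0 = \<tau> \<Longrightarrow> \<tau> < n \<Longrightarrow> map (eval W s) es = v \<tau>"
    and cntE: "\<And>s. mem s = M \<Longrightarrow> eval W s cnt = n"
begin

lemma W8: "8 \<le> (2::nat) ^ W"
  using power_increasing[OF W3, of "2::nat"] by simp

definition V where "V = v ` {..<n}"
definition U where "U \<tau> = v ` {..<\<tau>}"

definition frame :: "(nat list \<Rightarrow> nat) \<Rightarrow> (nat list \<Rightarrow> nat) \<Rightarrow> bool" where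
  "frame T0 T \<longleftrightarrow> (\<forall>key. (\<forall>i<6. \<forall>x. key \<noteq> i # g # x) \<longrightarrow> T key = T0 key)"

definition count_inv :: "(nat list \<Rightarrow> nat) \<Rightarrow> nat \<Rightarrow> machine \<Rightarrow> bool" where
  "count_inv T0 \<tau> s \<longleftrightarrow> mem s = M \<and> reg s 0 = \<tau> \<and> frame T0 (table s) \<and>
     (\<forall>x. tabs g (table s) 0 x = of_bool (x \<in> U \<tau>)) \<and>
     (\<forall>x. tabs g (table s) 1 x = card {y\<in>U \<tau>. take (Suc j) y = x}) \<and>
     (\<forall>i\<in>{2,3,4,5}. \<forall>x. tabs g (table s) i x = 0)"

definition fill_inv :: "(nat list \<Rightarrow> nat) \<Rightarrow> nat \<Rightarrow> machine \<Rightarrow> bool" where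
  "fill_inv T0 \<tau> s \<longleftrightarrow> mem s = M \<and> reg s 0 = \<tau> \<and> frame T0 (table s) \<and>
     index_inv j V (U \<tau>) (kids j (U \<tau>)) (tabs g (table s))"

lemma fin: "finite V" "finite (U \<tau>)" by (auto simp: V_def U_def)
lemma cardV: "card V \<le> n" unfolding V_def using card_image_le[of "{..<n}" v] by simp
lemma U_Suc: "U (Suc \<tau>) = insert (v \<tau>) (U \<tau>)" by (auto simp: U_def lessThan_Suc)
lemma U_V: "\<tau> \<le> n \<Longrightarrow> U \<tau> \<subseteq> V" by (auto simp: U_def V_def)
lemma card_U: "card (U \<tau>) \<le> \<tau>" unfolding U_def using card_image_le[of "{..<\<tau>}" v] by simp

lemma rows_take: "mem s = M \<Longrightarrow> reg s 0 = \<tau> \<Longrightarrow> \<tau> < n \<Longrightarrow> map (eval W s) (take i es) = take i (v \<tau>)"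
  by (simp add: rows flip: take_map)
lemma rows_nth: "mem s = M \<Longrightarrow> reg s 0 = \<tau> \<Longrightarrow> \<tau> < n \<Longrightarrow> eval W s (es ! j) = v \<tau> ! j"
  using rows[of s \<tau>] j by (metis nth_map)
lemma len_v: "\<tau> < n \<Longrightarrow> length (v \<tau>) = length es"
  using rows[of "\<lparr>reg = \<lambda>_. \<tau>, mem = M, table = \<lambda>_. 0\<rparr>" \<tau>] by (metis length_map machine.select_convs)

lemma frame_upd: "i < 6 \<Longrightarrow> frame T0 T \<Longrightarrow> frame T0 (T(i # g # x := y))"
  by (auto simp: frame_def)

lemma key: "i < 8 \<Longrightarrow> map (eval W s) (tkey i g xs) = i # g # map (eval W s) xs"
  using W8 g by (simp add: tkey_def)

lemma tbl: "table s (i # g # x) = tabs g (table s) i x" by (simp add: tabs_def)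

lemma count_inv_step:
  assumes \<tau>: "\<tau> < n" and I: "count_inv T0 \<tau> s"
  shows "count_inv T0 (Suc \<tau>) (result W (count_body g j es) s)"
proof -
  have s: "mem s = M" "reg s 0 = \<tau>" "frame T0 (table s)" using I by (auto simp: count_inv_def)
  define T where "T = tabs g (table s)"
  have T0: "T 0 x = of_bool (x \<in> U \<tau>)" and T1: "T 1 x = card {y\<in>U \<tau>. take (Suc j) y = x}"
    and T2: "i \<in> {2,3,4,5} \<Longrightarrow> T i x = 0" for i x
    using I by (auto simp: count_inv_def T_def)
  have lt: "T 1 x + 1 < 2 ^ W" for x
  proof -
    have "T 1 x \<le> card (U \<tau>)" unfolding T1 using fin by (intro card_mono) auto
    then show ?thesis using card_U[of \<tau>] \<tau> n by linarith
  qed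
  have st: "word W (\<tau> + 1) = Suc \<tau>" using \<tau> n by simp
  note ev = s \<tau> key rows rows_take tbl st lt T_def[symmetric]
  show ?thesis
  proof (cases "v \<tau> \<in> U \<tau>")
    case True
    then have "result W (count_body g j es) s = s\<lparr>reg := (reg s)(0 := Suc \<tau>)\<rparr>"
      using W8 by (simp add: count_body_def ev T0)
    then show ?thesis using I True by (simp add: count_inv_def U_Suc insert_absorb)
  next
    case False
    then have "result W (count_body g j es) s = s\<lparr>table := (table s)(0 # g # v \<tau> := 1,
        1 # g # take (Suc j) (v \<tau>) := T 1 (take (Suc j) (v \<tau>)) + 1), reg := (reg s)(0 := Suc \<tau>)\<rparr>"
      using W8 lt[of "take (Suc j) (v \<tau>)"] by (simp add: count_body_def ev T0)
    moreover have "card {y\<in>insert (v \<tau>) (U \<tau>). take (Suc j) y = x} =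
        (if x = take (Suc j) (v \<tau>) then T 1 x + 1 else T 1 x)" for x
    proof -
      have "{y\<in>insert (v \<tau>) (U \<tau>). take (Suc j) y = x} =
        (if x = take (Suc j) (v \<tau>) then insert (v \<tau>) {y\<in>U \<tau>. take (Suc j) y = x}
         else {y\<in>U \<tau>. take (Suc j) y = x})" by auto
      then show ?thesis using False fin by (simp add: T1)
    qed
    ultimately show ?thesis
      unfolding count_inv_def using s T0 T2 by (simp add: U_Suc frame_upd T_def[symmetric] upd_def)
  qed
qed

lemma fill_inv_step:
  assumes \<tau>: "\<tau> < n" and I: "fill_inv T0 \<tau> s"
  shows "fill_inv T0 (Suc \<tau>) (result W (fill_body g j es) s)"
proof -
  have s: "mem s = M" "reg s 0 = \<tau>" "frame T0 (table s)" using I by (auto simp: fill_inv_def)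
  define T where "T = tabs g (table s)"
  have inv: "index_inv j V (U \<tau>) (kids j (U \<tau>)) T" using I by (simp add: fill_inv_def T_def)
  have T0: "T 0 x = of_bool (x \<in> V) + of_bool (x \<in> U \<tau>)" for x
    using inv by (simp add: index_inv_def)
  have st: "word W (\<tau> + 1) = Suc \<tau>" using \<tau> n by simp
  have vV: "v \<tau> \<in> V" using \<tau> by (auto simp: V_def)
  have jl: "j < length (v \<tau>)" using j len_v[OF \<tau>] by simp
  note ev = s \<tau> key rows rows_take rows_nth tbl st T_def[symmetric]
  show ?thesis
  proof (cases "v \<tau> \<in> U \<tau>")
    case True
    then have "result W (fill_body g j es) s = s\<lparr>reg := (reg s)(0 := Suc \<tau>)\<rparr>"
      using W8 vV by (simp add: fill_body_def Let_def ev T0)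
    then show ?thesis using I True by (simp add: fill_inv_def U_Suc insert_absorb)
  next
    case False
    define y where "y = v \<tau>"
    define \<kappa> ka where "\<kappa> = take j y" and "ka = take (Suc j) y"
    define T' where "T' = (if T 2 ka = 0
      then upd (upd T 3 ka (T 4 \<kappa>)) 4 \<kappa> (T 4 \<kappa> + T 1 ka) else T)"
    define T'' where "T'' = upd (upd (upd T' 0 y 2) 5 (\<kappa> @ [T' 3 ka + T 2 ka]) (y ! j)) 2 ka (T 2 ka + 1)"
    have inv': "index_inv j V (U (Suc \<tau>)) (kids j (U (Suc \<tau>))) T''"
      unfolding U_Suc T''_def T'_def \<kappa>_def ka_def y_def
      by (rule index_inv_kids_step[OF inv vV False jl fin(1) U_V[OF less_imp_le[OF \<tau>]]])
    have ka: "ka = \<kappa> @ [y ! j]" using jl by (simp add: ka_def \<kappa>_def take_Suc_conv_app_nth y_def)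
    \<comment> \<open>Overflow is excluded by the invariant after the step: only there does the
      child of \<open>y\<close> count as opened, so that its interval is bounded by the total
      length, and this by the number of rows.\<close>
    have small: "T'' 4 \<kappa> < 2 ^ W" "T'' 1 ka < 2 ^ W" "T'' 3 ka + T'' 1 ka < 2 ^ W" "T'' 2 ka \<le> T'' 1 ka"
    proof -
      show 4: "T'' 4 \<kappa> < 2 ^ W"
        using index_inv_total_le[OF inv' fin(1), of \<kappa>] cardV n by linarith
      have "y ! j \<in> kids j (U (Suc \<tau>)) \<kappa>" using ka by (auto simp: kids_def U_Suc ka_def y_def)
      then have "T'' 3 ka + T'' 1 ka \<le> T'' 4 \<kappa>" using inv' by (auto simp: index_inv_def ka)
      then show "T'' 3 ka + T'' 1 ka < 2 ^ W" "T'' 1 ka < 2 ^ W" using 4 by auto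
      show "T'' 2 ka \<le> T'' 1 ka" using inv' fin U_V[of "Suc \<tau>"] \<tau>
        by (auto simp: index_inv_def intro!: card_mono)
    qed
    have b1: "T 2 ka + 1 < 2 ^ W" "T' 3 ka + T 2 ka < 2 ^ W"
      using small by (auto simp: T''_def T'_def upd_def split: if_splits)
    have b2: "T 4 \<kappa> + T 1 ka < 2 ^ W" if "T 2 ka = 0"
      using small(1) that by (auto simp: T''_def T'_def upd_def split: if_splits)
    let ?s' = "result W (fill_body g j es) s"
    note ev' = ev[folded y_def] \<kappa>_def[symmetric] ka_def[symmetric]
    have "tabs g (table ?s') = T'' \<and> mem ?s' = M \<and> reg ?s' 0 = Suc \<tau> \<and> frame T0 (table ?s')"
    proof (cases "T 2 ka = 0")
      case True
      then show ?thesis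
        using W8 False vV b1 b2[OF True]
        by (simp add: fill_body_def Let_def ev' T0 T'_def T''_def frame_upd y_def[symmetric] upd_def)
    next
      case nz: False
      then show ?thesis
        using W8 False vV b1
        by (simp add: fill_body_def Let_def ev' T0 T'_def T''_def frame_upd y_def[symmetric] upd_def)
    qed
    then show ?thesis using inv' by (simp add: fill_inv_def)
  qed
qed

lemma cost_body: "cost (count_body g j es) = 4" "cost (fill_body g j es) = 8"
  "loop_free (count_body g j es)" "loop_free (fill_body g j es)"
  by (simp_all add: count_body_def fill_body_def Let_def)

text \<open>The bodies cost at most 4 and 8 steps and each round adds one test, so the two passes
  take at most \<open>5 * n + 2\<close> and \<open>9 * n + 2\<close> steps.\<close>

lemma index_build:
  assumes s: "mem s = M" "\<And>i x. i < 6 \<Longrightarrow> table s (i # g # x) = 0"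
  shows "execs W (index_prog g j es cnt) s (14 * n + 4)
     (\<lambda>s'. mem s' = M \<and> frame (table s) (table s') \<and> index_spec j V (tabs g (table s')))"
proof -
  have le: "eval W s (Op Less (Reg 0) cnt) = of_bool (\<tau> < n)" if "mem s = M" "reg s 0 = \<tau>" for s \<tau>
    using W8 that by (simp add: cntE)
  have 1: "execs W ([SetReg 0 (Num 0)] @ [While (Op Less (Reg 0) cnt) (count_body g j es)]) s
      (1 + (n * Suc 4 + 1)) (count_inv (table s) n)"
  proof (rule execs_append[OF execs_SetReg[where Post = "count_inv (table s) 0"]
      execs_While[where I = "count_inv (table s)"]])
    show "count_inv (table s) 0 (s\<lparr>reg := (reg s)(0 := eval W s (Num 0))\<rparr>)"
      using s by (simp add: count_inv_def frame_def U_def tabs_def)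
  next
    fix \<tau> s' assume "\<tau> < n" "count_inv (table s) \<tau> s'"
    then show "eval W s' (Op Less (Reg 0) cnt) \<noteq> 0 \<and>
        execs W (count_body g j es) s' 4 (count_inv (table s) (Suc \<tau>))"
      using le[of s' \<tau>] count_inv_step[of \<tau> "table s" s']
      by (auto simp: count_inv_def[of _ _ s'] cost_body intro!: execs_resultI)
  next
    fix s' assume "count_inv (table s) n s'"
    then show "eval W s' (Op Less (Reg 0) cnt) = 0" using le[of s' n] by (auto simp: count_inv_def)
  qed
  have 2: "execs W ([SetReg 0 (Num 0)] @ [While (Op Less (Reg 0) cnt) (fill_body g j es)]) s1
      (1 + (n * Suc 8 + 1)) (fill_inv (table s) n)" if "count_inv (table s) n s1" for s1
  proof (rule execs_append[OF execs_SetReg[where Post = "fill_inv (table s) 0"]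
      execs_While[where I = "fill_inv (table s)"]])
    show "fill_inv (table s) 0 (s1\<lparr>reg := (reg s1)(0 := eval W s1 (Num 0))\<rparr>)"
      using that by (simp add: fill_inv_def count_inv_def index_inv_def kids_def U_def V_def)
  next
    fix \<tau> s' assume "\<tau> < n" "fill_inv (table s) \<tau> s'"
    then show "eval W s' (Op Less (Reg 0) cnt) \<noteq> 0 \<and>
        execs W (fill_body g j es) s' 8 (fill_inv (table s) (Suc \<tau>))"
      using le[of s' \<tau>] fill_inv_step[of \<tau> "table s" s']
      by (auto simp: fill_inv_def[of _ _ s'] cost_body intro!: execs_resultI)
  next
    fix s' assume "fill_inv (table s) n s'"
    then show "eval W s' (Op Less (Reg 0) cnt) = 0" using le[of s' n] by (auto simp: fill_inv_def)
  qed
  have UV: "U n = V" by (simp add: U_def V_def)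
  have 3: "execs W (index_prog g j es cnt) s ((1 + (n * Suc 4 + 1)) + (1 + (n * Suc 8 + 1)))
      (fill_inv (table s) n)"
    unfolding index_prog_def by (rule execs_append[OF 1]) (rule 2)
  show ?thesis
  proof (rule execs_mono[OF 3])
    fix s' :: machine assume "fill_inv (table s) n s'"
    moreover have "j < length y" if "y \<in> V" for y using that len_v j by (auto simp: V_def)
    ultimately show "mem s' = M \<and> frame (table s) (table s') \<and> index_spec j V (tabs g (table s'))"
      using index_spec_of_inv[OF _ fin(1)] by (simp add: fill_inv_def UV)
  qed auto
qed

end

section \<open>Rejection sampling with a scan for emptiness\<close>

lemma time_upto_mono: "N \<le> N' \<Longrightarrow> time_upto W N c \<le> time_upto W N' c"
  unfolding time_upto_def by (intro sum_mono2) auto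

lemma time_upto_return:
  assumes "steps W n c = return_pmf c'"
  shows "time_upto W (n + N) c \<le> of_nat n + time_upto W N c'"
  using time_upto_add[of W n N c] by (simp add: assms)

lemma spmf_eqI_le:
  assumes "\<And>x. pmf q x \<le> spmf p x"
  shows "p = spmf_of_pmf q"
proof (rule ccontr)
  assume "p \<noteq> spmf_of_pmf q"
  then obtain x where x: "pmf p x < pmf (spmf_of_pmf q) x"
    using pmf_neq_exists_less by blast
  show False
  proof (cases x)
    case None
    then show ?thesis using x by (simp add: pmf_spmf_of_pmf_None)
  next
    case (Some y)
    then show ?thesis using x assms[of y] by (simp add: spmf_spmf_of_pmf)
  qed
qed

text \<open>Each element of J has exactly one seed below nB, which trial decodes. The loop of sample
  interleaves random seeds with a scan in which the counter cr stays at the first successful seed: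
  so cr reaches nB only if J is empty, and otherwise the number of rounds is geometric.\<close>

locale sampler =
  fixes W k zr cr :: nat and trial :: program and nB :: nat and nBE :: expr
    and J :: "nat list set" and enc :: "nat list \<Rightarrow> nat" and Inv :: "machine \<Rightarrow> bool"
  assumes distinct: "zr \<noteq> 0" "cr \<noteq> 0" "cr \<noteq> zr" and W: "1 \<le> W" and nB: "nB < 2 ^ W"
    and fin: "finite J" and inj: "inj_on enc J" and enc_less: "\<And>t. t \<in> J \<Longrightarrow> enc t < nB"
    and Inv_reg: "\<And>s R. Inv s \<Longrightarrow> Inv (s\<lparr>reg := R\<rparr>)"
    and nBE: "\<And>s. Inv s \<Longrightarrow> eval W s nBE = nB"
    and loop_free: "loop_free trial"
    and trial: "\<And>s. Inv s \<Longrightarrow> reg s zr < nB \<Longrightarrow>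
      Inv (result W trial s) \<and> reg (result W trial s) cr = reg s cr \<and>
      (if reg s zr \<in> enc ` J
       then reg (result W trial s) 0 = 1 \<and>
         (\<exists>t\<in>J. enc t = reg s zr \<and> map (\<lambda>i. reg (result W trial s) (Suc i)) [0..<k] = t)
       else reg (result W trial s) 0 = 0)"
begin

definition vals :: "machine \<Rightarrow> nat list" where
  "vals s = map (\<lambda>i. reg s (Suc i)) [0..<k]"

text \<open>The second component records that the machine remains usable. One equation for the law
  of \<open>out\<close> then gives both the law of the outcome and the preservation of the
  invariant.\<close>

definition out :: "machine \<Rightarrow> nat list option \<times> bool" where
  "out s = (if reg s 0 = 0 then None else Some (vals s), Inv s)"

definition guess :: program where
  "guess = Rand zr (Op Sub nBE (Num 1)) # trial"

text \<open>The scan must not deliver a tuple itself, as this would favour tuples with small seeds.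
  Its result only moves the counter, and the random guess that follows overwrites register
  0.\<close>

definition loop :: command where
  "loop = While (Op Mul (Op Eq (Reg 0) (Num 0)) (Op Less (Reg cr) nBE))
     (([SetReg zr (Reg cr)] @ trial @
       [SetReg cr (Op Add (Reg cr) (Op Eq (Reg 0) (Num 0)))]) @ guess)"

definition sample :: program where
  "sample = [SetReg 0 (Num 0), SetReg cr (Num 0), loop]"

definition hd_state :: "machine \<Rightarrow> bool" where
  "hd_state s \<longleftrightarrow> Inv s \<and> reg s 0 = 0 \<and> reg s cr \<le> nB \<and> (\<forall>z<reg s cr. z \<notin> enc ` J)"

definition done_state :: "machine \<Rightarrow> bool" where
  "done_state s \<longleftrightarrow> Inv s \<and> reg s 0 = 1 \<and> vals s \<in> J"

definition next_state :: "machine \<Rightarrow> nat \<Rightarrow> machine" where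
  "next_state s z = result W trial
     (let s1 = result W ([SetReg zr (Reg cr)] @ trial @
       [SetReg cr (Op Add (Reg cr) (Op Eq (Reg 0) (Num 0)))]) s
      in s1\<lparr>reg := (reg s1)(zr := z)\<rparr>)"

text \<open>One round consists of two trials, the loop test, two assignments and the random
  draw.\<close>

definition K :: nat where "K = 2 * cost trial + 4"

lemma W2: "2 \<le> (2::nat) ^ W"
  using power_increasing[OF W, of "2::nat"] by simp

lemma eval_cond: "Inv s \<Longrightarrow>
    eval W s (Op Mul (Op Eq (Reg 0) (Num 0)) (Op Less (Reg cr) nBE)) =
    of_bool (reg s 0 = 0 \<and> reg s cr < nB)"
  using W2 by (simp add: nBE)

lemma next_state:
  assumes s: "hd_state s" "reg s cr < nB" and z: "z < nB"
  shows "if z \<in> enc ` J then done_state (next_state s z) \<and> enc (vals (next_state s z)) = z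
    else hd_state (next_state s z) \<and>
      (J = {} \<longrightarrow> reg (next_state s z) cr = reg s cr + 1)"
proof -
  define s0 where "s0 = s\<lparr>reg := (reg s)(zr := reg s cr)\<rparr>"
  define s1 where "s1 = result W trial s0"
  define b where "b = (if reg s cr \<in> enc ` J then 0 else 1::nat)"
  define s2 where "s2 = s1\<lparr>reg := (reg s1)(cr := reg s cr + b)\<rparr>"
  have s0: "Inv s0" "reg s0 zr < nB" "reg s0 zr = reg s cr" "reg s0 cr = reg s cr"
    using s distinct by (auto simp: s0_def Inv_reg hd_state_def)
  have s1: "Inv s1" "reg s1 cr = reg s cr" "reg s1 0 = 1 - b"
    using trial[OF s0(1,2)] s0 by (auto simp: s1_def b_def split: if_splits)
  have "result W ([SetReg zr (Reg cr)] @ trial @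
       [SetReg cr (Op Add (Reg cr) (Op Eq (Reg 0) (Num 0)))]) s = s2"
    using W2 s(2) nB s1 by (simp add: result_append loop_free s0_def[symmetric] s1_def[symmetric] s2_def b_def)
  then have n: "next_state s z = result W trial (s2\<lparr>reg := (reg s2)(zr := z)\<rparr>)"
    by (simp add: next_state_def Let_def)
  define s3 where "s3 = s2\<lparr>reg := (reg s2)(zr := z)\<rparr>"
  have s3: "Inv s3" "reg s3 zr = z" "reg s3 cr = reg s cr + b"
    using s1 distinct by (auto simp: s3_def s2_def Inv_reg)
  have bd: "reg s cr + b \<le> nB" "\<forall>z<reg s cr + b. z \<notin> enc ` J"
    using s by (auto simp: b_def hd_state_def less_Suc_eq simp flip: Suc_eq_plus1)
  have "J = {} \<Longrightarrow> b = 1" by (simp add: b_def)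
  then show ?thesis
    using trial[OF s3(1)] s3 z bd unfolding n s3_def[symmetric] hd_state_def done_state_def vals_def
    by (auto split: if_splits)
qed

text \<open>A round is split at its only random step: everything before the draw is deterministic,
  and after it the state is a function of the number \<open>z\<close> that was drawn.\<close>

lemma steps_iteration:
  assumes s: "hd_state s" "reg s cr < nB"
  shows "\<exists>a s1. 1 \<le> a \<and> a \<le> cost trial + 3 \<and>
      steps W a ([loop], s) = return_pmf (guess @ [loop], s1) \<and>
      step W (guess @ [loop], s1) =
        map_pmf (\<lambda>z. (trial @ [loop], s1\<lparr>reg := (reg s1)(zr := z)\<rparr>)) (pmf_of_set {..<nB}) \<and>
      (\<forall>z. \<exists>b\<le>cost trial. steps W b (trial @ [loop], s1\<lparr>reg := (reg s1)(zr := z)\<rparr>) =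
        return_pmf ([loop], next_state s z))"
proof -
  let ?P = "[SetReg zr (Reg cr)] @ trial @
       [SetReg cr (Op Add (Reg cr) (Op Eq (Reg 0) (Num 0)))]"
  define s1 where "s1 = result W ?P s"
  have lf: "loop_free ?P" using loop_free by simp
  obtain a where a: "a \<le> cost ?P" "runs W ?P s a s1"
    using execs_result[OF lf, of W s] unfolding execs_def s1_def by blast
  have "cost (P @ P') = cost P + cost P'" for P P' by (induction P rule: cost.induct) auto
  then have c: "cost ?P = cost trial + 2" by simp
  have e: "eval W s (Op Mul (Op Eq (Reg 0) (Num 0)) (Op Less (Reg cr) nBE)) \<noteq> 0"
    using s eval_cond[of s] by (simp del: eval.simps add: hd_state_def)
  have "steps W (Suc a) ([loop], s) = steps W a (?P @ (guess @ [loop]), s)"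
    unfolding steps_Suc_left using e by (simp add: loop_def bind_return_pmf)
  then have st: "steps W (Suc a) ([loop], s) = return_pmf (guess @ [loop], s1)"
    using runs_steps[OF a(2)] by simp
  have count_inv: "Inv s1"
  proof -
    define s0 where "s0 = s\<lparr>reg := (reg s)(zr := reg s cr)\<rparr>"
    have "Inv s0" "reg s0 zr < nB" using s distinct by (auto simp: s0_def Inv_reg hd_state_def)
    then have "Inv (result W trial s0)" using trial by blast
    then show ?thesis
      by (simp add: s1_def result_append loop_free s0_def[symmetric] Inv_reg)
  qed
  have "{0..nB - 1} = {..<nB}" using s by auto
  moreover have "eval W s1 (Op Sub nBE (Num 1)) = nB - 1"
    using W2 nB nBE[OF count_inv] by simp
  ultimately have sr: "step W (guess @ [loop], s1) =
        map_pmf (\<lambda>z. (trial @ [loop], s1\<lparr>reg := (reg s1)(zr := z)\<rparr>)) (pmf_of_set {..<nB})"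
    by (simp add: guess_def)
  have "\<exists>b\<le>cost trial. steps W b (trial @ [loop], s1\<lparr>reg := (reg s1)(zr := z)\<rparr>) =
        return_pmf ([loop], next_state s z)" for z
    using execs_result[OF loop_free, of W "s1\<lparr>reg := (reg s1)(zr := z)\<rparr>"] runs_steps
    unfolding execs_def next_state_def s1_def[symmetric] Let_def by metis
  then show ?thesis using st sr a(1) c by (intro exI[of _ "Suc a"] exI[of _ s1]) auto
qed

lemma run_iteration:
  assumes s: "hd_state s" "reg s cr < nB"
  shows "run_config W ([loop], s) =
    bind_pmf (pmf_of_set {..<nB}) (\<lambda>z. run_config W ([loop], next_state s z))"
proof -
  from steps_iteration[OF s] obtain a s1 where
    1: "steps W a ([loop], s) = return_pmf (guess @ [loop], s1)" and
    2: "step W (guess @ [loop], s1) =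
        map_pmf (\<lambda>z. (trial @ [loop], s1\<lparr>reg := (reg s1)(zr := z)\<rparr>)) (pmf_of_set {..<nB})" and
    3: "\<And>z. \<exists>b\<le>cost trial. steps W b (trial @ [loop], s1\<lparr>reg := (reg s1)(zr := z)\<rparr>) =
        return_pmf ([loop], next_state s z)"
    by blast
  have *: "run_config W (trial @ [loop], s1\<lparr>reg := (reg s1)(zr := z)\<rparr>) =
      run_config W ([loop], next_state s z)" for z
  proof -
    obtain b where "steps W b (trial @ [loop], s1\<lparr>reg := (reg s1)(zr := z)\<rparr>) =
        return_pmf ([loop], next_state s z)" using 3 by blast
    from run_steps_return[OF this] show ?thesis by (simp add: run_def)
  qed
  have "run_config W ([loop], s) = run_config W (guess @ [loop], s1)"
    using run_steps_return[OF 1] by (simp add: run_def)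
  also have "\<dots> = bind_pmf (pmf_of_set {..<nB}) (\<lambda>z. run_config W (trial @ [loop], s1\<lparr>reg := (reg s1)(zr := z)\<rparr>))"
    by (subst run_config_steps[of _ _ "Suc 0"]) (simp add: bind_return_pmf 2 bind_map_pmf)
  finally show ?thesis by (simp only: *)
qed

lemma time_iteration:
  assumes s: "hd_state s" "reg s cr < nB"
  shows "time_upto W (Suc N) ([loop], s) \<le>
    of_nat K + (\<integral>\<^sup>+ z. time_upto W N ([loop], next_state s z) \<partial>pmf_of_set {..<nB})"
proof -
  from steps_iteration[OF s] obtain a s1 where a: "1 \<le> a" "a \<le> cost trial + 3" and
    1: "steps W a ([loop], s) = return_pmf (guess @ [loop], s1)" and
    2: "step W (guess @ [loop], s1) =
        map_pmf (\<lambda>z. (trial @ [loop], s1\<lparr>reg := (reg s1)(zr := z)\<rparr>)) (pmf_of_set {..<nB})" and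
    3: "\<And>z. \<exists>b\<le>cost trial. steps W b (trial @ [loop], s1\<lparr>reg := (reg s1)(zr := z)\<rparr>) =
        return_pmf ([loop], next_state s z)"
    by blast
  have *: "time_upto W N (trial @ [loop], s1\<lparr>reg := (reg s1)(zr := z)\<rparr>) \<le>
      of_nat (cost trial) + time_upto W N ([loop], next_state s z)" for z
  proof -
    obtain b where b: "b \<le> cost trial" "steps W b (trial @ [loop], s1\<lparr>reg := (reg s1)(zr := z)\<rparr>) =
        return_pmf ([loop], next_state s z)" using 3 by blast
    have "time_upto W N (trial @ [loop], s1\<lparr>reg := (reg s1)(zr := z)\<rparr>) \<le>
        time_upto W (b + N) (trial @ [loop], s1\<lparr>reg := (reg s1)(zr := z)\<rparr>)"
      by (intro time_upto_mono) simp
    also have "\<dots> \<le> of_nat b + time_upto W N ([loop], next_state s z)"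
      by (rule time_upto_return[OF b(2)])
    also have "\<dots> \<le> of_nat (cost trial) + time_upto W N ([loop], next_state s z)"
      using b(1) by (intro add_right_mono of_nat_mono)
    finally show ?thesis .
  qed
  have "time_upto W (Suc N) ([loop], s) \<le> time_upto W (a + N) ([loop], s)"
    using a by (intro time_upto_mono) simp
  also have "\<dots> \<le> of_nat a + time_upto W N (guess @ [loop], s1)"
    by (rule time_upto_return[OF 1])
  also have "time_upto W N (guess @ [loop], s1) \<le> time_upto W (1 + N) (guess @ [loop], s1)"
    by (intro time_upto_mono) simp
  also have "\<dots> \<le> of_nat 1 + (\<integral>\<^sup>+ c'. time_upto W N c' \<partial>measure_pmf (steps W 1 (guess @ [loop], s1)))"
    by (rule time_upto_add)
  also have "steps W 1 (guess @ [loop], s1) = step W (guess @ [loop], s1)"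
    by (simp add: One_nat_def bind_return_pmf)
  also have "(\<integral>\<^sup>+ c'. time_upto W N c' \<partial>measure_pmf (step W (guess @ [loop], s1))) =
      (\<integral>\<^sup>+ z. time_upto W N (trial @ [loop], s1\<lparr>reg := (reg s1)(zr := z)\<rparr>) \<partial>pmf_of_set {..<nB})"
    unfolding 2 by simp
  also have "\<dots> \<le> (\<integral>\<^sup>+ z. of_nat (cost trial) + time_upto W N ([loop], next_state s z) \<partial>pmf_of_set {..<nB})"
    by (intro nn_integral_mono *)
  also have "\<dots> = of_nat (cost trial) +
      (\<integral>\<^sup>+ z. time_upto W N ([loop], next_state s z) \<partial>pmf_of_set {..<nB})"
    by (subst nn_integral_add) auto
  finally have "time_upto W (Suc N) ([loop], s) \<le> of_nat a + (of_nat 1 + (of_nat (cost trial) +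
      (\<integral>\<^sup>+ z. time_upto W N ([loop], next_state s z) \<partial>pmf_of_set {..<nB})))"
    by (simp add: add_left_mono)
  also have "\<dots> = of_nat (a + 1 + cost trial) +
      (\<integral>\<^sup>+ z. time_upto W N ([loop], next_state s z) \<partial>pmf_of_set {..<nB})"
    by (simp add: add.assoc)
  also have "\<dots> \<le> of_nat K + (\<integral>\<^sup>+ z. time_upto W N ([loop], next_state s z) \<partial>pmf_of_set {..<nB})"
    using a by (intro add_right_mono of_nat_mono) (simp add: K_def)
  finally show ?thesis .
qed

lemma exit_loop:
  assumes "Inv s" "reg s 0 \<noteq> 0 \<or> reg s cr = nB"
  shows "run_config W ([loop], s) = return_spmf s" "time_upto W N ([loop], s) \<le> 1"
proof -
  have e: "eval W s (Op Mul (Op Eq (Reg 0) (Num 0)) (Op Less (Reg cr) nBE)) = 0"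
    using assms eval_cond[of s] by (auto simp del: eval.simps)
  then have 1: "steps W 1 ([loop], s) = return_pmf ([], s)"
    by (simp add: One_nat_def bind_return_pmf loop_def)
  show "run_config W ([loop], s) = return_spmf s"
    using run_steps_return[OF 1] by (simp add: run_def)
  have "time_upto W N ([loop], s) \<le> time_upto W (1 + N) ([loop], s)"
    by (intro time_upto_mono) simp
  also have "\<dots> \<le> of_nat 1 + time_upto W N ([], s)" by (rule time_upto_return[OF 1])
  also have "time_upto W N ([], s) = 0" by (simp add: time_upto_def steps_halted)
  finally show "time_upto W N ([loop], s) \<le> 1" by simp
qed

lemma card_le: "card J \<le> nB"
proof -
  have "card (enc ` J) \<le> card {..<nB}" using enc_less by (intro card_mono) auto
  then show ?thesis using inj by (simp add: card_image)
qed

lemma cnt_less: "hd_state s \<Longrightarrow> J \<noteq> {} \<Longrightarrow> reg s cr < nB"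
  using enc_less by (fastforce simp: hd_state_def)

text \<open>A round succeeds with probability \<open>card J / nB\<close>. The quantity
  \<open>c = K * nB / card J\<close> solves \<open>c = K + (1 - card J / nB) * c\<close>, which
  makes the induction on the truncation close; the extra 1 is the final loop test.\<close>

lemma time_nonempty:
  assumes J: "J \<noteq> {}"
  shows "hd_state s \<Longrightarrow> time_upto W N ([loop], s) \<le> ennreal (1 + real K * real nB / real (card J))"
proof (induction N arbitrary: s)
  case 0
  then show ?case by (simp add: time_upto_def)
next
  case (Suc N)
  define c where "c = real K * real nB / real (card J)"
  have cJ: "card J > 0" using J fin by (simp add: card_gt_0_iff)
  then have nB0: "nB > 0" using card_le by simp
  have c0: "c \<ge> 0" by (simp add: c_def)
  note lt = cnt_less[OF Suc.prems J]
  have *: "time_upto W N ([loop], next_state s z) \<le> ennreal (1 + c * of_bool (z \<notin> enc ` J))"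
    if "z < nB" for z
  proof (cases "z \<in> enc ` J")
    case True
    then have "done_state (next_state s z)" using next_state[OF Suc.prems lt that] by simp
    then show ?thesis using exit_loop(2)[of "next_state s z" N] True by (simp add: done_state_def)
  next
    case False
    then show ?thesis using next_state[OF Suc.prems lt that] Suc.IH by (simp add: c_def)
  qed
  have sum: "(\<Sum>z<nB. 1 + c * of_bool (z \<notin> enc ` J)) = real nB + c * (real nB - real (card J))"
  proof -
    have "card ({..<nB} - enc ` J) = nB - card J"
      using enc_less fin inj by (subst card_Diff_subset) (auto simp: card_image)
    moreover have "{..<nB} \<inter> {z. z \<notin> enc ` J} = {..<nB} - enc ` J" by auto
    ultimately show ?thesis
      using card_le by (simp add: sum.distrib sum_distrib_left[symmetric] of_bool_def sum.If_cases of_nat_diff)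
  qed
  have "(\<integral>\<^sup>+ z. time_upto W N ([loop], next_state s z) \<partial>pmf_of_set {..<nB}) \<le>
      (\<integral>\<^sup>+ z. ennreal (1 + c * of_bool (z \<notin> enc ` J)) \<partial>pmf_of_set {..<nB})"
    using * nB0 by (intro nn_integral_mono_AE) (auto simp: AE_measure_pmf_iff lessThan_empty_iff)
  also have "\<dots> = ennreal ((real nB + c * (real nB - real (card J))) / real nB)"
    using nB0 c0 sum
    by (subst nn_integral_eq_integral)
      (auto simp: integral_pmf_of_set lessThan_empty_iff intro!: integrable_measure_pmf_finite)
  also have "(real nB + c * (real nB - real (card J))) / real nB = 1 + c - real K"
    using nB0 cJ by (simp add: c_def field_simps)
  finally have "(\<integral>\<^sup>+ z. time_upto W N ([loop], next_state s z) \<partial>pmf_of_set {..<nB}) \<le>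
      ennreal (1 + c - real K)" .
  then have "time_upto W (Suc N) ([loop], s) \<le> of_nat K + ennreal (1 + c - real K)"
    using time_iteration[OF Suc.prems lt, of N] by (meson add_left_mono order_trans)
  also have "of_nat K + ennreal (1 + c - real K) = ennreal (1 + c)"
  proof -
    have "real K * real (card J) \<le> real K * real nB" using card_le by (intro mult_left_mono) auto
    then have "real K \<le> c" using cJ by (simp add: c_def field_simps)
    then show ?thesis by (simp add: ennreal_of_nat_eq_real_of_nat flip: ennreal_plus)
  qed
  finally show ?case by (simp add: c_def)
qed

text \<open>On an empty join every scanned seed fails, so each round moves the counter by one; the
  bound counts the rounds that remain.\<close>

lemma time_empty:
  assumes J: "J = {}"
  shows "hd_state s \<Longrightarrow> time_upto W N ([loop], s) \<le> of_nat (1 + K * (nB - reg s cr))"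
proof (induction N arbitrary: s)
  case 0
  then show ?case by (simp add: time_upto_def)
next
  case (Suc N)
  show ?case
  proof (cases "reg s cr = nB")
    case True
    then show ?thesis using exit_loop(2)[of s "Suc N"] Suc.prems by (simp add: hd_state_def)
  next
    case False
    then have lt: "reg s cr < nB" using Suc.prems by (simp add: hd_state_def)
    have "(\<integral>\<^sup>+ z. time_upto W N ([loop], next_state s z) \<partial>pmf_of_set {..<nB}) \<le>
      (\<integral>\<^sup>+ z. of_nat (1 + K * (nB - (reg s cr + 1))) \<partial>pmf_of_set {..<nB})"
    proof (intro nn_integral_mono_AE)
      have "time_upto W N ([loop], next_state s z) \<le> of_nat (1 + K * (nB - (reg s cr + 1)))"
        if "z < nB" for z
        using next_state[OF Suc.prems lt that] Suc.IH[of "next_state s z"] J by simp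
      then show "AE z in pmf_of_set {..<nB}. time_upto W N ([loop], next_state s z) \<le>
          of_nat (1 + K * (nB - (reg s cr + 1)))"
        using lt by (auto simp: AE_measure_pmf_iff lessThan_empty_iff)
    qed
    also have "\<dots> = of_nat (1 + K * (nB - (reg s cr + 1)))" by simp
    finally have "time_upto W (Suc N) ([loop], s) \<le> of_nat K + of_nat (1 + K * (nB - (reg s cr + 1)))"
      using time_iteration[OF Suc.prems lt, of N] by (meson add_left_mono order_trans)
    also have "\<dots> = of_nat (1 + K * (nB - reg s cr))"
    proof -
      have "nB - reg s cr = Suc (nB - (reg s cr + 1))" using lt by simp
      then show ?thesis by (simp flip: of_nat_add)
    qed
    finally show ?thesis .
  qed
qed

text \<open>No geometric series is summed. Let \<open>x\<close> be the infimum, over all states at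
  the loop head, of the probability of ending with \<open>t\<close>. One round gives
  \<open>x >= (1 + (nB - card J) * x) / nB\<close>, hence \<open>x >= 1 / card J\<close>. These
  lower bounds add up to 1 over the join, so they are equalities.\<close>

lemma law_nonempty:
  assumes J: "J \<noteq> {}" and s: "hd_state s"
  shows "map_spmf out (run_config W ([loop], s)) =
    spmf_of_pmf (map_pmf (\<lambda>t. (Some t, True)) (pmf_of_set J))"
proof -
  define \<phi> where "\<phi> s = map_spmf out (run_config W ([loop], s))" for s
  have cJ: "card J > 0" using J fin by (simp add: card_gt_0_iff)
  then have nB0: "nB > 0" using card_le by simp
  have low: "1 / real (card J) \<le> spmf (\<phi> s) (Some t, True)" if t: "t \<in> J" and s: "hd_state s" for s t
  proof -
    define x where "x = (INF s\<in>Collect hd_state. spmf (\<phi> s) (Some t, True))"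
    have bdd: "bdd_below ((\<lambda>s. spmf (\<phi> s) (Some t, True)) ` Collect hd_state)"
      by (rule bdd_belowI[of _ 0]) auto
    have "(1 + (real nB - real (card J)) * x) / real nB \<le> spmf (\<phi> s) (Some t, True)"
      if s: "hd_state s" for s
    proof -
      note lt = cnt_less[OF s J]
      \<comment> \<open>The seed of \<open>t\<close> yields \<open>t\<close>, the seed of another
        tuple is estimated by 0, and after a failed guess the loop starts over with probability at
        least \<open>x\<close>.\<close>
      have z: "of_bool (z = enc t) + x * of_bool (z \<notin> enc ` J) \<le> spmf (\<phi> (next_state s z)) (Some t, True)"
        if "z < nB" for z
      proof (cases "z \<in> enc ` J")
        case True
        have d: "done_state (next_state s z)" "enc (vals (next_state s z)) = z"
          using next_state[OF s lt that] True by auto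
        have "\<phi> (next_state s z) = return_spmf (Some (vals (next_state s z)), True)"
          using d(1) exit_loop(1)[of "next_state s z"] by (simp add: \<phi>_def done_state_def out_def)
        moreover have "z = enc t \<Longrightarrow> vals (next_state s z) = t"
          using d inj t by (auto simp: done_state_def inj_on_def)
        ultimately show ?thesis using True by (auto simp: of_bool_def)
      next
        case False
        then have "hd_state (next_state s z)" using next_state[OF s lt that] by simp
        then have "x \<le> spmf (\<phi> (next_state s z)) (Some t, True)"
          unfolding x_def by (intro cINF_lower[OF bdd]) simp
        then show ?thesis using False t by auto
      qed
      have "\<phi> s = bind_pmf (pmf_of_set {..<nB}) (\<lambda>z. \<phi> (next_state s z))"
        unfolding \<phi>_def run_iteration[OF s lt] by (simp add: map_bind_pmf)
      then have "spmf (\<phi> s) (Some t, True) =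
          (\<Sum>z<nB. spmf (\<phi> (next_state s z)) (Some t, True)) / real nB"
        using nB0 by (simp add: pmf_bind integral_pmf_of_set lessThan_empty_iff)
      moreover have "(\<Sum>z<nB. of_bool (z = enc t) + x * of_bool (z \<notin> enc ` J)) =
          1 + (real nB - real (card J)) * x"
      proof -
        have "card ({..<nB} - enc ` J) = nB - card J"
          using enc_less fin inj by (subst card_Diff_subset) (auto simp: card_image)
        moreover have "{..<nB} \<inter> {z. z \<notin> enc ` J} = {..<nB} - enc ` J" by auto
        moreover have "{..<nB} \<inter> {z. z = enc t} = {enc t}" using enc_less[OF t] by auto
        ultimately show ?thesis
          using card_le enc_less[OF t] by (simp add: sum.distrib sum_distrib_left[symmetric] of_bool_def sum.If_cases of_nat_diff)
      qed
      ultimately show ?thesis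
        using sum_mono[of "{..<nB}" "\<lambda>z. of_bool (z = enc t) + x * of_bool (z \<notin> enc ` J)"
          "\<lambda>z. spmf (\<phi> (next_state s z)) (Some t, True)"] z nB0
        by (simp add: divide_right_mono)
    qed
    then have "(1 + (real nB - real (card J)) * x) / real nB \<le> x"
      unfolding x_def using s by (intro cINF_greatest) auto
    then have "1 / real (card J) \<le> x" using nB0 cJ by (simp add: field_simps)
    also have "x \<le> spmf (\<phi> s) (Some t, True)"
      unfolding x_def using s by (intro cINF_lower[OF bdd]) simp
    finally show ?thesis .
  qed
  show ?thesis
  proof (rule spmf_eqI_le)
    fix o' :: "nat list option \<times> bool"
    have inj': "inj (\<lambda>t::nat list. (Some t, True))" by (auto simp: inj_on_def)
    show "pmf (map_pmf (\<lambda>t. (Some t, True)) (pmf_of_set J)) o' \<le>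
        spmf (map_spmf out (run_config W ([loop], s))) o'"
    proof (cases "\<exists>t\<in>J. o' = (Some t, True)")
      case True
      then obtain t where t: "t \<in> J" "o' = (Some t, True)" by blast
      then show ?thesis
        using low[OF t(1) s] pmf_map_inj'[OF inj', of "pmf_of_set J" t] J fin by (simp add: \<phi>_def)
    next
      case False
      then have "pmf (map_pmf (\<lambda>t. (Some t, True)) (pmf_of_set J)) o' = 0"
        using J fin by (auto simp: pmf_eq_0_set_pmf)
      then show ?thesis by simp
    qed
  qed
qed

lemma law_empty:
  assumes J: "J = {}"
  shows "hd_state s \<Longrightarrow> map_spmf out (run_config W ([loop], s)) = return_spmf (None, True)"
proof (induction "nB - reg s cr" arbitrary: s)
  case 0
  then have "reg s cr = nB" by (simp add: hd_state_def)
  then show ?case using exit_loop(1)[of s] 0 by (simp add: hd_state_def out_def)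
next
  case (Suc d)
  then have lt: "reg s cr < nB" by simp
  have "map_spmf out (run_config W ([loop], next_state s z)) = return_spmf (None, True)"
    if "z < nB" for z
    using next_state[OF Suc.prems lt that] J Suc.hyps by simp
  then have "map_spmf out (run_config W ([loop], s)) =
      bind_pmf (pmf_of_set {..<nB}) (\<lambda>z. return_spmf (None, True))"
    unfolding run_iteration[OF Suc.prems lt] map_bind_pmf using lt
    by (intro bind_pmf_cong) (auto simp: lessThan_empty_iff)
  then show ?case by simp
qed

lemma steps_start: "steps W 2 (sample, s) =
    return_pmf ([loop], s\<lparr>reg := (reg s)(0 := 0, cr := 0)\<rparr>)"
  by (simp add: sample_def numeral_2_eq_2 bind_return_pmf)

lemma start: "Inv s \<Longrightarrow> hd_state (s\<lparr>reg := (reg s)(0 := 0, cr := 0)\<rparr>)"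
  using distinct by (simp add: hd_state_def Inv_reg)

text \<open>The 3 stands for the two initial assignments and the last loop test. The maximum with 1
  covers the empty join, where the scan takes \<open>nB\<close> rounds.\<close>

lemma expected_time_sample:
  assumes "Inv s"
  shows "expected_time W sample s \<le> ennreal (3 + real K * real nB / max 1 (real (card J)))"
proof -
  have "expected_time W [loop] s' \<le> ennreal (1 + real K * real nB / max 1 (real (card J)))"
    if "hd_state s'" "reg s' cr = 0" for s'
  proof (rule expected_time_leI)
    fix N
    show "time_upto W N ([loop], s') \<le> ennreal (1 + real K * real nB / max 1 (real (card J)))"
    proof (cases "J = {}")
      case True
      then show ?thesis using time_empty[OF True that(1), of N] that(2)
        unfolding ennreal_of_nat_eq_real_of_nat by simp
    next
      case False
      then have "card J \<ge> 1" using fin by (simp add: Suc_leI card_gt_0_iff One_nat_def)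
      then have "max 1 (real (card J)) = real (card J)" by simp
      then show ?thesis using time_nonempty[OF False that(1), of N] by simp
    qed
  qed
  from this[OF start[OF assms]]
  have "expected_time W sample s \<le> of_nat 2 + ennreal (1 + real K * real nB / max 1 (real (card J)))"
    using expected_time_steps_return[OF steps_start, of s] by (simp) (meson add_left_mono order_trans)
  also have "\<dots> = ennreal (3 + real K * real nB / max 1 (real (card J)))"
  proof -
    define c where "c = real K * real nB / max 1 (real (card J))"
    have "c \<ge> 0" by (simp add: c_def)
    then have "ennreal 2 + ennreal (1 + c) = ennreal (2 + (1 + c))"
      by (intro ennreal_plus[symmetric]) auto
    then show ?thesis by (simp add: c_def[symmetric])
  qed
  finally show ?thesis .
qed

lemma law_sample:
  assumes "Inv s"
  shows "map_spmf out (run W sample s) =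
    (if J = {} then return_spmf (None, True)
     else spmf_of_pmf (map_pmf (\<lambda>t. (Some t, True)) (pmf_of_set J)))"
  using run_steps_return[OF steps_start, of s] law_empty[OF _ start[OF assms]]
    law_nonempty[OF _ start[OF assms]]
  by (simp add: run_def)

end

section \<open>The programs for a query of fixed shape\<close>

definition le_expr :: "expr \<Rightarrow> expr \<Rightarrow> expr" where
  "le_expr a b = Op Eq (Op Less b a) (Num 0)"

fun conj_expr :: "expr list \<Rightarrow> expr" where
  "conj_expr [] = Num 1"
| "conj_expr (e # es) = Op Mul e (conj_expr es)"

fun prod_expr :: "expr list \<Rightarrow> expr" where
  "prod_expr [] = Num 1"
| "prod_expr (e # es) = Op Mul e (prod_expr es)"

lemma pow2_ge: "1 \<le> W \<Longrightarrow> 2 \<le> (2::nat) ^ W"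
  using power_increasing[of 1 W "2::nat"] by simp

lemma eval_le_expr: "1 \<le> W \<Longrightarrow> eval W s (le_expr a b) = of_bool (eval W s a \<le> eval W s b)"
  using pow2_ge[of W] by (auto simp: le_expr_def)

lemma eval_Less: "1 \<le> W \<Longrightarrow> eval W s (Op Less a b) = of_bool (eval W s a < eval W s b)"
  by simp

lemma eval_conj_expr_map:
  assumes "1 \<le> W" "\<And>x. x \<in> set xs \<Longrightarrow> eval W s (f x) = of_bool (P x)"
  shows "eval W s (conj_expr (map f xs)) = of_bool (\<forall>x\<in>set xs. P x)"
  using assms(2) by (induction xs) (use pow2_ge[OF assms(1)] in auto)

lemma eval_prod_expr:
  assumes "\<And>x. x \<in> set xs \<Longrightarrow> eval W s (f x) = h x \<and> h x \<le> Z" "Z ^ length xs < 2 ^ W" "1 \<le> Z"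
  shows "eval W s (prod_expr (map f xs)) = prod_list (map h xs) \<and> prod_list (map h xs) \<le> Z ^ length xs"
  using assms(1,2)
proof (induction xs)
  case (Cons x xs)
  have "Z ^ length xs \<le> Z ^ length (x # xs)" using assms(3) by simp
  then have "Z ^ length xs < 2 ^ W" using Cons.prems(2) by linarith
  then have IH: "eval W s (prod_expr (map f xs)) = prod_list (map h xs)"
    "prod_list (map h xs) \<le> Z ^ length xs"
    using Cons by auto
  have "h x * prod_list (map h xs) \<le> Z * Z ^ length xs"
    using Cons.prems(1)[of x] IH(2) by (intro mult_mono) auto
  then show ?case using IH Cons.prems by simp
qed (use assms in auto)

text \<open>Lets a single counter below \<open>L ^ k\<close> run through all assignments of
  exponents to the attributes.\<close>

lemma digits_exist:
  fixes L :: nat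
  assumes "\<And>p. p < k \<Longrightarrow> g p < L" "1 \<le> L"
  shows "\<exists>n<L ^ k. \<forall>p<k. n div L ^ p mod L = g p"
  using assms(1)
proof (induction k)
  case (Suc k)
  then obtain n where n: "n < L ^ k" "\<And>p. p < k \<Longrightarrow> n div L ^ p mod L = g p" by auto
  have "g k + 1 \<le> L" using Suc.prems[of k] by simp
  then have "(g k + 1) * L ^ k \<le> L * L ^ k" by (rule mult_right_mono) simp
  then have lt: "n + g k * L ^ k < L ^ Suc k" using n(1) by (simp add: algebra_simps)
  have "(n + g k * L ^ k) div L ^ p mod L = g p" if "p < Suc k" for p
  proof (cases "p = k")
    case True
    then show ?thesis using n(1) assms(2) Suc.prems[of k] by simp
  next
    case False
    define d where "d = k - Suc p"
    have k: "k = p + Suc d" using that False by (simp add: d_def)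
    have "n + g k * L ^ k = n + L ^ p * (L * (g k * L ^ d))"
      by (subst (2) k) (simp add: power_add)
    then have "(n + g k * L ^ k) div L ^ p = (n + L ^ p * (L * (g k * L ^ d))) div L ^ p"
      by (simp only:)
    also have "\<dots> = n div L ^ p + L * (g k * L ^ d)"
      using assms(2) by simp
    finally have "(n + g k * L ^ k) div L ^ p = n div L ^ p + L * (g k * L ^ d)" .
    then show ?thesis using n(2)[of p] False that by simp
  qed
  then show ?case using lt by blast
qed simp

text \<open>Makes the search linear in the input size, since \<open>2 ^ (L - 1)\<close> will be at
  most \<open>IN\<close>. It comes from \<open>L <= k * 2 ^ (L div k)\<close> by taking k-th
  powers.\<close>

lemma power_le_exp: "1 \<le> L \<Longrightarrow> L ^ k \<le> (2 * k ^ k) * 2 ^ (L - 1)" for k L :: nat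
proof (cases "k = 0")
  case False
  assume L: "1 \<le> L"
  have "L < k * (L div k + 1)"
    using False dividend_less_times_div[of k L] by (simp add: distrib_left)
  also have "L div k + 1 \<le> 2 ^ (L div k)" using less_exp[of "L div k"] by linarith
  finally have "L \<le> k * 2 ^ (L div k)" by simp
  then have "L ^ k \<le> (k * 2 ^ (L div k)) ^ k" by (intro power_mono) auto
  also have "\<dots> = k ^ k * 2 ^ (L div k * k)" by (simp add: power_mult_distrib power_mult)
  also have "\<dots> \<le> k ^ k * 2 ^ L" by (intro mult_left_mono power_increasing) auto
  also have "\<dots> = (2 * k ^ k) * 2 ^ (L - 1)" using L by (cases L) auto
  finally show ?thesis .
next
  case True
  have "(1::nat) \<le> 2 ^ (L - 1)" by simp
  then have "(1::nat) \<le> 2 * 2 ^ (L - 1)" by linarith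
  then show ?thesis using True by simp
qed

text \<open>Everything that a program may know about its input in advance: the attributes are the positions
  below k, sg lists them in topological order, X c and Y c are the sets of the constraint number c, and
  S assigns the schemas to the m relations. The indices g below nG enumerate the triples of a relation
  rel g, a subset YY g of its schema and a level lev g whose attribute lies in this subset; cl lists
  all ways to choose one index per level.\<close>

locale shape =
  fixes k m nc nG :: nat and sg :: "nat list" and X Y S :: "nat \<Rightarrow> nat set"
    and rel :: "nat \<Rightarrow> nat" and YY :: "nat \<Rightarrow> nat set" and lev :: "nat \<Rightarrow> nat" and cl :: "nat list list"
  assumes sg: "distinct sg" "set sg = {..<k}"
    and S: "\<And>\<rho>. \<rho> < m \<Longrightarrow> S \<rho> \<subseteq> {..<k} \<and> S \<rho> \<noteq> {}"
    and XY: "\<And>c. c < nc \<Longrightarrow> X c \<subseteq> Y c \<and> Y c \<subseteq> {..<k}"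
    and topo: "\<And>c a b. c < nc \<Longrightarrow> a < k \<Longrightarrow> b < k \<Longrightarrow> sg ! a \<in> X c \<Longrightarrow> sg ! b \<in> Y c - X c \<Longrightarrow> a < b"
    and G: "\<And>g. g < nG \<Longrightarrow> rel g < m \<and> YY g \<subseteq> S (rel g) \<and> lev g < k \<and> sg ! lev g \<in> YY g"
    and G_complete: "\<And>\<rho> Z i. \<rho> < m \<Longrightarrow> Z \<subseteq> S \<rho> \<Longrightarrow> i < k \<Longrightarrow> sg ! i \<in> Z \<Longrightarrow>
      \<exists>g<nG. rel g = \<rho> \<and> YY g = Z \<and> lev g = i"
    and cl: "set cl = {c. length c = k \<and> (\<forall>i<k. c ! i < nG \<and> lev (c ! i) = i)}"
begin

text \<open>The word length in multiples of w, chosen generously. The first summand covers products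
  of up to \<open>2 * k + 1\<close> cardinalities with powers of two; the others cover the numbers
  of indices and choices and the addresses of constraints and relations.\<close>

definition C0 :: nat where
  "C0 = 10 * (k + 2) + nG + length cl + nc * (2 * k + 1) + m * (k + 1)"

text \<open>Listed in topological order and not in increasing order: a smaller \<open>i\<close> then
  gives a prefix, so that prefixes of keys are the nodes of the prefix tree.\<close>

definition ps :: "nat set \<Rightarrow> nat \<Rightarrow> nat list" where
  "ps Z i = filter (\<lambda>p. p \<in> Z) (take i sg)"

text \<open>The depth at which the attribute of the index occurs in the tree of its projection;
  \<open>lev\<close> in contrast counts all attributes of the query.\<close>

definition pos :: "nat \<Rightarrow> nat" where
  "pos g = length (ps (YY g) (lev g))"

lemma len_sg: "length sg = k"
  using sg distinct_card[OF sg(1)] by simp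

lemma ps_mono: "i \<le> i' \<Longrightarrow> \<exists>zs. ps Z i' = ps Z i @ zs"
  by (metis le_add_diff_inverse filter_append ps_def take_add)

lemma take_ps: "i \<le> i' \<Longrightarrow> take (length (ps Z i)) (ps Z i') = ps Z i"
  using ps_mono[of i i' Z] by auto

lemma ps_Suc: "i < k \<Longrightarrow> ps Z (Suc i) = (if sg ! i \<in> Z then ps Z i @ [sg ! i] else ps Z i)"
  by (simp add: ps_def take_Suc_conv_app_nth len_sg)

lemma ps_YY_Suc: "g < nG \<Longrightarrow> ps (YY g) (Suc (lev g)) = ps (YY g) (lev g) @ [sg ! lev g]"
  using G by (simp add: ps_Suc)

lemma pos_less: "g < nG \<Longrightarrow> pos g < length (ps (YY g) k)"
  using ps_YY_Suc[of g] ps_mono[of "Suc (lev g)" k "YY g"] G[of g] by (auto simp: pos_def)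

lemma set_ps_k: "Z \<subseteq> {..<k} \<Longrightarrow> set (ps Z k) = Z"
  using len_sg sg by (auto simp: ps_def)

text \<open>Relations have variable length, so the start of each one is computed from the lengths of
  those before it. The first one follows the number of constraints and the constraints; each
  occupies \<open>k\<close> flags, its length and \<open>k\<close> words per tuple.\<close>

fun baseE :: "nat \<Rightarrow> expr" where
  "baseE 0 = Num (1 + nc * (2 * k + 1))"
| "baseE (Suc \<rho>) = Op Add (baseE \<rho>)
     (Op Add (Num (k + 1)) (Op Mul (Mem (Op Add (baseE \<rho>) (Num k))) (Num k)))"

definition lenE :: "nat \<Rightarrow> expr" where
  "lenE \<rho> = Mem (Op Add (baseE \<rho>) (Num k))"

definition rowE :: "nat \<Rightarrow> nat set \<Rightarrow> expr list" where
  "rowE \<rho> Z = map (\<lambda>p. Mem (Op Add (Op Add (baseE \<rho>) (Num (k + 1 + p))) (Op Mul (Reg 0) (Num k)))) (ps Z k)"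

fun sizeE :: "nat \<Rightarrow> expr" where
  "sizeE 0 = Num 0"
| "sizeE (Suc \<rho>) = Op Add (sizeE \<rho>) (lenE \<rho>)"

fun powE :: "nat \<Rightarrow> expr" where
  "powE 0 = Num 1"
| "powE (Suc p) = Op Mul (powE p) (Reg 1)"

definition xE :: "nat \<Rightarrow> expr" where
  "xE p = Table [Op Mod (Op Div (Reg 3) (powE p)) (Reg 1)]"

definition boundE :: "nat \<Rightarrow> expr" where
  "boundE c = Mem (Num (1 + c * (2 * k + 1) + 2 * k))"

text \<open>The degree constraints on a modular function in multiplicative form, which avoids the
  computation of logarithms.\<close>

definition feasE :: expr where
  "feasE = conj_expr (map (\<lambda>c. le_expr (prod_expr (map xE (sorted_list_of_set (Y c - X c)))) (boundE c)) [0..<nc])"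

definition powers_body :: program where
  "powers_body = [SetTable [Reg 1] (Reg 2), SetReg 1 (Op Add (Reg 1) (Num 1)),
     SetReg 2 (Op Add (Reg 2) (Reg 2))]"

definition search_body :: program where
  "search_body = [If (Op Mul feasE (Op Less (Reg 4) (prod_expr (map xE [0..<k]))))
       [SetReg 4 (prod_expr (map xE [0..<k]))] [],
     SetReg 3 (Op Add (Reg 3) (Num 1))]"

text \<open>The registers 1 to 4 hold the number L of powers of two up to the input size, the current power,
  a number whose L-adic digits are the exponents under test, and the best product so far.\<close>

definition bound_prog :: program where
  "bound_prog = [SetReg 1 (Num 0), SetReg 2 (Num 1)] @
     [While (le_expr (Reg 2) (sizeE m)) powers_body] @
     [SetReg 3 (Num 0), SetReg 4 (Num 0)] @
     [While (Op Less (Reg 3) (powE k)) search_body] @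
     [SetTable [] (Op Mul (Num (2 ^ k)) (Reg 4))]"

definition index_all :: program where
  "index_all = concat (map (\<lambda>g. index_prog g (pos g) (rowE (rel g) (YY g)) (lenE (rel g))) [0..<nG])"

definition build :: program where
  "build = bound_prog @ index_all"

end

section \<open>Evaluation of the expressions on an input in memory\<close>

locale inst = shape +
  fixes w W :: nat and len :: "nat \<Rightarrow> nat" and val :: "nat \<Rightarrow> nat \<Rightarrow> nat \<Rightarrow> nat"
    and NN :: "nat \<Rightarrow> nat" and M base :: "nat \<Rightarrow> nat"
  assumes w: "1 \<le> w" and CW: "C0 * w \<le> W"
    and base_0: "base 0 = 1 + nc * (2 * k + 1)"
    and base_Suc: "\<And>\<rho>. \<rho> < m \<Longrightarrow> base (Suc \<rho>) = base \<rho> + (k + 1) + len \<rho> * k"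
    and M_len: "\<And>\<rho>. \<rho> < m \<Longrightarrow> M (base \<rho> + k) = len \<rho>"
    and M_val: "\<And>\<rho> \<tau> p. \<rho> < m \<Longrightarrow> \<tau> < len \<rho> \<Longrightarrow> p < k \<Longrightarrow> M (base \<rho> + k + 1 + \<tau> * k + p) = val \<rho> \<tau> p"
    and M_NN: "\<And>c. c < nc \<Longrightarrow> M (1 + c * (2 * k + 1) + 2 * k) = NN c"
    and IN_less: "(\<Sum>\<rho><m. len \<rho>) < 2 ^ w" and IN_pos: "1 \<le> (\<Sum>\<rho><m. len \<rho>)"
    and NN: "\<And>c. c < nc \<Longrightarrow> 1 \<le> NN c"
begin

definition IN where "IN = (\<Sum>\<rho><m. len \<rho>)"

text \<open>Most overflow checks reduce to this inequality. As w is at least 1, a constant number of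
  bits can be paid for in units of w as well.\<close>

lemma word_bound: "a + b \<le> C0 \<Longrightarrow> 2 ^ b * (2 ^ w) ^ a \<le> (2::nat) ^ W"
proof -
  assume ab: "a + b \<le> C0"
  have "b + w * a \<le> (a + b) * w" using w by (simp add: algebra_simps)
  also have "\<dots> \<le> C0 * w" using ab by (rule mult_right_mono) simp
  also have "\<dots> \<le> W" by (rule CW)
  finally have "(2::nat) ^ (b + w * a) \<le> 2 ^ W" by (intro power_increasing) auto
  then show ?thesis by (simp add: power_add power_mult)
qed

lemma W1: "1 \<le> W" and W3: "3 \<le> W"
proof -
  have "3 * 1 \<le> C0 * w" by (rule mult_mono) (use w in \<open>auto simp: C0_def\<close>)
  then show "1 \<le> W" "3 \<le> W" using CW by auto
qed

lemma small: "n \<le> C0 \<Longrightarrow> n < 2 ^ W"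
  using le_less_trans[of n W, OF _ less_exp] word_bound[of 0 n] by simp

lemma base_le: "\<rho> \<le> m \<Longrightarrow> base \<rho> \<le> 1 + nc * (2 * k + 1) + \<rho> * (k + 1) + (\<Sum>\<rho>'<\<rho>. len \<rho>') * k"
proof (induction \<rho>)
  case (Suc \<rho>)
  then show ?case using base_Suc[of \<rho>] by (simp add: algebra_simps)
qed (simp add: base_0)

lemma address: assumes "\<rho> < m" shows "base \<rho> + (k + 1) + len \<rho> * k < 2 ^ W"
proof -
  have "base (Suc \<rho>) \<le> 1 + nc * (2 * k + 1) + Suc \<rho> * (k + 1) + (\<Sum>\<rho>'<Suc \<rho>. len \<rho>') * k"
    using base_le[of "Suc \<rho>"] assms by simp
  also have "\<dots> \<le> 1 + nc * (2 * k + 1) + m * (k + 1) + IN * k"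
    using assms unfolding IN_def
    by (intro add_mono mult_right_mono sum_mono2) auto
  also have "\<dots> < (1 + nc * (2 * k + 1) + m * (k + 1) + k) * 2 ^ w"
  proof -
    define s0 where "s0 = 1 + nc * (2 * k + 1) + m * (k + 1)"
    have a: "IN * k \<le> k * 2 ^ w"
      unfolding mult.commute[of _ k] using IN_less by (intro mult_left_mono) (auto simp: IN_def)
    have "(2::nat) ^ 1 \<le> 2 ^ w" using w by (intro power_increasing) auto
    then have "s0 * 1 < s0 * 2 ^ w"
      by (intro mult_strict_left_mono) (auto simp: s0_def)
    then show ?thesis unfolding s0_def[symmetric] add_mult_distrib using a by linarith
  qed
  also have "\<dots> \<le> 2 ^ (1 + nc * (2 * k + 1) + m * (k + 1) + k) * (2 ^ w) ^ 1"
    using less_exp[of "1 + nc * (2 * k + 1) + m * (k + 1) + k"] by (simp add: less_imp_le)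
  also have "\<dots> \<le> 2 ^ W" by (rule word_bound) (simp add: C0_def)
  finally show ?thesis using base_Suc[OF assms] by simp
qed

lemma eval_baseE: "mem s = M \<Longrightarrow> \<rho> \<le> m \<Longrightarrow> 0 < m \<Longrightarrow> eval W s (baseE \<rho>) = base \<rho>"
proof (induction \<rho>)
  case 0
  have "base 0 < 2 ^ W" using address[of 0] 0 by simp
  then show ?case by (simp add: base_0)
next
  case (Suc \<rho>)
  then have IH: "eval W s (baseE \<rho>) = base \<rho>" and r: "\<rho> < m" by auto
  note a = address[OF r]
  have "k < 2 ^ W" "k + 1 < 2 ^ W" using a by auto
  moreover have "len \<rho> * k < 2 ^ W" "base \<rho> + k < 2 ^ W" using a by auto
  moreover have "k + 1 + len \<rho> * k < 2 ^ W" using a by auto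
  ultimately show ?case using IH a Suc.prems(1) by (simp add: M_len[OF r] base_Suc[OF r] add.assoc)
qed

lemma eval_lenE: "mem s = M \<Longrightarrow> \<rho> < m \<Longrightarrow> eval W s (lenE \<rho>) = len \<rho>"
  using address[of \<rho>] by (simp add: lenE_def eval_baseE M_len)

lemma eval_rowE:
  assumes "mem s = M" "\<rho> < m" "reg s 0 = \<tau>" "\<tau> < len \<rho>" "Z \<subseteq> {..<k}"
  shows "map (eval W s) (rowE \<rho> Z) = map (val \<rho> \<tau>) (ps Z k)"
proof -
  have "eval W s (Mem (Op Add (Op Add (baseE \<rho>) (Num (k + 1 + p))) (Op Mul (Reg 0) (Num k)))) = val \<rho> \<tau> p"
    if "p \<in> set (ps Z k)" for p
  proof -
    have p: "p < k" using that assms(5) by (auto simp: set_ps_k)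
    have "(\<tau> + 1) * k \<le> len \<rho> * k" using assms(4) by (intro mult_right_mono) auto
    then have le: "base \<rho> + (k + 1 + p) + \<tau> * k < 2 ^ W"
      using address[OF assms(2)] p by (simp add: algebra_simps)
    then have "k + 1 + p < 2 ^ W" "\<tau> * k < 2 ^ W" "base \<rho> + (k + 1 + p) < 2 ^ W" "k < 2 ^ W" by auto
    then have "eval W s (Op Add (Op Add (baseE \<rho>) (Num (k + 1 + p))) (Op Mul (Reg 0) (Num k))) =
        base \<rho> + (k + 1 + p) + \<tau> * k"
      using le assms by (simp add: eval_baseE)
    moreover have "base \<rho> + (k + 1 + p) + \<tau> * k = base \<rho> + k + 1 + \<tau> * k + p" by simp
    ultimately show ?thesis using M_val[OF assms(2,4) p] assms(1) by simp
  qed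
  then show ?thesis by (simp add: rowE_def)
qed

lemma eval_sizeE: "mem s = M \<Longrightarrow> \<rho> \<le> m \<Longrightarrow> eval W s (sizeE \<rho>) = (\<Sum>\<rho>'<\<rho>. len \<rho>')"
proof (induction \<rho>)
  case (Suc \<rho>)
  have "(\<Sum>\<rho>'<Suc \<rho>. len \<rho>') \<le> IN"
    using Suc.prems unfolding IN_def by (intro sum_mono2) auto
  also have "\<dots> < 2 ^ w" using IN_less by (simp add: IN_def)
  also have "(2::nat) ^ w \<le> 2 ^ W" using word_bound[of 1 0] by (simp add: C0_def)
  finally show ?case using Suc by (simp add: eval_lenE)
qed simp

definition L :: nat where "L = (LEAST l. IN < 2 ^ l)"

lemma L: "IN < 2 ^ L" "l < L \<Longrightarrow> 2 ^ l \<le> IN" "L \<le> w" "1 \<le> L" "2 ^ (L - 1) \<le> IN"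
proof -
  show 1: "IN < 2 ^ L" unfolding L_def by (rule LeastI[of _ w]) (use IN_less in \<open>simp add: IN_def\<close>)
  show 2: "l < L \<Longrightarrow> 2 ^ l \<le> IN" for l unfolding L_def using not_less_Least by fastforce
  show "L \<le> w" unfolding L_def by (rule Least_le) (use IN_less in \<open>simp add: IN_def\<close>)
  show "1 \<le> L" using 1 IN_pos by (cases L) (auto simp: IN_def One_nat_def)
  then show "2 ^ (L - 1) \<le> IN" using 2 by simp
qed

definition dig :: "nat \<Rightarrow> nat \<Rightarrow> nat" where "dig n p = n div L ^ p mod L"

definition feas :: "(nat \<Rightarrow> nat) \<Rightarrow> bool" where
  "feas f \<longleftrightarrow> (\<forall>c<nc. (\<Prod>p\<in>Y c - X c. 2 ^ f p) \<le> NN c)"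

definition powers_inv :: "nat \<Rightarrow> machine \<Rightarrow> bool" where
  "powers_inv i s \<longleftrightarrow> mem s = M \<and> reg s 1 = i \<and> reg s 2 = 2 ^ i \<and> (\<forall>l<i. table s [l] = 2 ^ l) \<and>
     (\<forall>key. 2 \<le> length key \<longrightarrow> table s key = 0)"

definition search_inv :: "nat \<Rightarrow> machine \<Rightarrow> bool" where
  "search_inv n s \<longleftrightarrow> mem s = M \<and> reg s 1 = L \<and> reg s 3 = n \<and> (\<forall>l<L. table s [l] = 2 ^ l) \<and>
     (\<forall>key. 2 \<le> length key \<longrightarrow> table s key = 0) \<and>
     (\<forall>n'<n. feas (dig n') \<longrightarrow> (\<Prod>p<k. 2 ^ dig n' p) \<le> reg s 4) \<and>
     (reg s 4 = 0 \<or> (\<exists>n'<n. feas (dig n') \<and> (\<Prod>p<k. 2 ^ dig n' p) = reg s 4))"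

lemma powers_inv_step:
  assumes "i < L" "powers_inv i s"
  shows "powers_inv (Suc i) (result W powers_body s)"
proof -
  have "2 ^ i + 2 ^ i \<le> IN + IN" using L(2)[OF assms(1)] by simp
  also have "\<dots> < 2 ^ 1 * (2 ^ w) ^ 1" using IN_less by (simp add: IN_def)
  also have "\<dots> \<le> 2 ^ W" by (rule word_bound) (simp add: C0_def)
  finally have 1: "2 ^ i + 2 ^ i < (2::nat) ^ W" .
  have "i + 1 \<le> 2 ^ i" using less_exp[of i] by linarith
  then have "i + 1 < 2 ^ W" using 1 by linarith
  then show ?thesis
    using assms(2) 1 pow2_ge[OF W1] by (auto simp: powers_body_def powers_inv_def less_Suc_eq)
qed

lemma eval_powE: "reg s 1 = L \<Longrightarrow> p \<le> k \<Longrightarrow> eval W s (powE p) = L ^ p"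
proof (induction p)
  case 0 then show ?case using pow2_ge[OF W1] by simp
next
  case (Suc p)
  have "L \<le> 2 ^ w" using L(3) less_exp[of w] by linarith
  then have "L ^ Suc p \<le> (2 ^ w) ^ Suc p" by (intro power_mono) auto
  also have "\<dots> \<le> (2 ^ w) ^ k" using Suc.prems by (intro power_increasing) auto
  also have "\<dots> < 2 ^ 1 * (2 ^ w) ^ k" by simp
  also have "\<dots> \<le> 2 ^ W" by (rule word_bound) (simp add: C0_def)
  finally show ?case using Suc by (simp add: mult.commute)
qed

lemma eval_xE:
  assumes "reg s 1 = L" "p < k" "reg s 3 = n" "n < L ^ k" "\<forall>l<L. table s [l] = 2 ^ l"
  shows "eval W s (xE p) = 2 ^ dig n p" "2 ^ dig n p \<le> (2::nat) ^ w"
proof -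
  have d: "dig n p < L" using L(4) by (simp add: dig_def)
  have n: "n < 2 ^ W"
  proof -
    have "L \<le> 2 ^ w" using L(3) less_exp[of w] by linarith
    then have "L ^ k \<le> (2 ^ w) ^ k" by (intro power_mono) auto
    then have "n < (2 ^ w) ^ k" using assms(4) by linarith
    also have "\<dots> \<le> 2 ^ W" using word_bound[of k 0] by (simp add: C0_def)
    finally show ?thesis .
  qed
  have "n div L ^ p < 2 ^ W" using n by (meson div_le_dividend le_less_trans)
  moreover have "n div L ^ p mod L < 2 ^ W" using calculation by (meson mod_less_eq_dividend le_less_trans)
  ultimately show "eval W s (xE p) = 2 ^ dig n p"
    using assms d by (simp add: xE_def eval_powE dig_def)
  show "2 ^ dig n p \<le> (2::nat) ^ w" using d L(3) by (intro power_increasing) auto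
qed

lemma eval_prod_x:
  assumes "reg s 1 = L" "reg s 3 = n" "n < L ^ k" "\<forall>l<L. table s [l] = 2 ^ l" "A \<subseteq> {..<k}" "set xs = A" "distinct xs"
  shows "eval W s (prod_expr (map xE xs)) = (\<Prod>p\<in>A. 2 ^ dig n p)"
proof -
  have le: "length xs \<le> k" using assms(5-7) card_mono[of "{..<k}" A] distinct_card[of xs] by simp
  have "(2 ^ w) ^ length xs \<le> ((2::nat) ^ w) ^ k" using le by (intro power_increasing) auto
  also have "\<dots> < 2 ^ 1 * (2 ^ w) ^ k" by simp
  also have "\<dots> \<le> 2 ^ W" by (rule word_bound) (simp add: C0_def)
  finally have "((2::nat) ^ w) ^ length xs < 2 ^ W" .
  then have "eval W s (prod_expr (map xE xs)) = prod_list (map (\<lambda>p. 2 ^ dig n p) xs)"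
    using eval_xE[OF assms(1) _ assms(2-4)] assms(5,6)
    by (intro eval_prod_expr[of xs W s xE _ "2 ^ w", THEN conjunct1]) auto
  then show ?thesis
    using prod.distinct_set_conv_list[OF assms(7), of "\<lambda>p. 2 ^ dig n p :: nat"] assms(6) by simp
qed

lemma search_inv_step:
  assumes "n < L ^ k" "search_inv n s"
  shows "search_inv (Suc n) (result W search_body s)"
proof -
  have s: "mem s = M" "reg s 1 = L" "reg s 3 = n" "\<forall>l<L. table s [l] = 2 ^ l"
    using assms(2) by (auto simp: search_inv_def)
  have "eval W s (le_expr (prod_expr (map xE (sorted_list_of_set (Y c - X c)))) (boundE c)) =
      of_bool ((\<Prod>p\<in>Y c - X c. 2 ^ dig n p) \<le> NN c)" if c: "c < nc" for c
  proof -
    have "finite (Y c - X c)" using XY[OF c] finite_subset by blast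
    then have 1: "eval W s (prod_expr (map xE (sorted_list_of_set (Y c - X c)))) = (\<Prod>p\<in>Y c - X c. 2 ^ dig n p)"
      using XY[OF c] by (intro eval_prod_x[OF s(2,3) assms(1) s(4)]) auto
    obtain d where "nc = Suc (c + d)" using c less_imp_Suc_add by blast
    then have "1 + c * (2 * k + 1) + 2 * k < 2 ^ W"
      by (intro small, unfold C0_def) (simp add: algebra_simps)
    then have "eval W s (boundE c) = NN c" using s(1) by (simp add: boundE_def M_NN[OF c])
    then show ?thesis using 1 eval_le_expr[OF W1] by simp
  qed
  then have f: "eval W s feasE = of_bool (feas (dig n))"
    unfolding feasE_def feas_def by (subst eval_conj_expr_map[OF W1]) auto
  have p: "eval W s (prod_expr (map xE [0..<k])) = (\<Prod>p<k. 2 ^ dig n p)"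
    by (intro eval_prod_x[OF s(2,3) assms(1) s(4)]) auto
  have c: "eval W s (Op Mul feasE (Op Less (Reg 4) (prod_expr (map xE [0..<k])))) =
      of_bool (feas (dig n) \<and> reg s 4 < (\<Prod>p<k. 2 ^ dig n p))"
    using f p W1 by simp
  have "n + 1 < 2 ^ W"
  proof -
    have "L \<le> 2 ^ w" using L(3) less_exp[of w] by linarith
    then have "L ^ k \<le> (2 ^ w) ^ k" by (intro power_mono) auto
    then have "n + 1 \<le> (2 ^ w) ^ k" using assms(1) by linarith
    also have "\<dots> < 2 ^ 1 * (2 ^ w) ^ k" by simp
    also have "\<dots> \<le> 2 ^ W" by (rule word_bound) (simp add: C0_def)
    finally show ?thesis .
  qed
  then have d: "result W search_body s = s\<lparr>reg := (reg s)(4 := (if feas (dig n) \<and> reg s 4 < (\<Prod>p<k. 2 ^ dig n p)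
      then (\<Prod>p<k. 2 ^ dig n p) else reg s 4), 3 := Suc n)\<rparr>"
    using pow2_ge[OF W1] c s(3) p by (simp add: search_body_def del: eval.simps(5)) (simp add: Suc_eq_plus1)
  show ?thesis using assms(2) unfolding d search_inv_def
    by (auto simp: less_Suc_eq intro: order_trans less_imp_le)
qed

end

section \<open>Search for the bound and construction of all indices\<close>

context inst
begin

text \<open>The first conjunct prevents overflow, the second will give
  \<open>B <= 2 ^ k * polymat\<close>, and the third makes the intervals of some choice long enough.
  Powers above \<open>IN\<close> can be left out because the ratios to be rounded there are at most
  degrees of relations.\<close>

definition bound_ok :: "nat \<Rightarrow> bool" where
  "bound_ok B \<longleftrightarrow> B \<le> 2 ^ k * (2 ^ w) ^ k \<and> (\<exists>f. feas f \<and> B = 2 ^ k * (\<Prod>p<k. 2 ^ f p)) \<and>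
     (\<forall>f. feas f \<and> (\<forall>p<k. 2 ^ f p \<le> IN) \<longrightarrow> 2 ^ k * (\<Prod>p<k. 2 ^ f p) \<le> B)"

definition VV :: "nat \<Rightarrow> nat list set" where
  "VV g = (\<lambda>\<tau>. map (val (rel g) \<tau>) (ps (YY g) k)) ` {..<len (rel g)}"

definition ready :: "(nat list \<Rightarrow> nat) \<Rightarrow> bool" where
  "ready T \<longleftrightarrow> bound_ok (T []) \<and> (\<forall>g<nG. index_spec (pos g) (VV g) (tabs g T))"

lemma IN_bound: "IN < 2 ^ w" using IN_less by (simp add: IN_def)

lemma feas_cong: "(\<And>p. p < k \<Longrightarrow> f p = f' p) \<Longrightarrow> feas f = feas f'"
proof -
  assume a: "\<And>p. p < k \<Longrightarrow> f p = f' p"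
  have "(\<Prod>p\<in>Y c - X c. 2 ^ f p :: nat) = (\<Prod>p\<in>Y c - X c. 2 ^ f' p)" if "c < nc" for c
    using a XY[OF that] by (intro prod.cong) auto
  then show ?thesis by (auto simp: feas_def)
qed

lemma search_inv_final:
  assumes "search_inv (L ^ k) s"
  shows "bound_ok (2 ^ k * reg s 4)" "reg s 4 \<le> (2 ^ w) ^ k"
proof -
  have low: "(\<Prod>p<k. 2 ^ f p) \<le> reg s 4" if f: "feas f" "\<forall>p<k. 2 ^ f p \<le> IN" for f
  proof -
    have "f p < L" if "p < k" for p
    proof (rule ccontr)
      assume "\<not> f p < L"
      then have "(2::nat) ^ L \<le> 2 ^ f p" by (intro power_increasing) auto
      then show False using f(2) that L(1) by (meson le_trans not_less)
    qed
    from digits_exist[of k f L, OF this L(4)] obtain n where n: "n < L ^ k" "\<forall>p<k. dig n p = f p"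
      unfolding dig_def by blast
    then have "feas (dig n)" using f(1) feas_cong[of "dig n" f] by simp
    then show ?thesis using assms n by (auto simp: search_inv_def)
  qed
  \<comment> \<open>Since all bounds are at least 1, the zero assignment is feasible, so the search
    does not end with its initial value 0.\<close>
  have feas0: "feas (\<lambda>_. 0)" using NN by (simp add: feas_def)
  have "1 \<le> reg s 4" using low[OF feas0] IN_pos by (simp add: IN_def)
  then obtain n where n: "n < L ^ k" "feas (dig n)" "(\<Prod>p<k. 2 ^ dig n p) = reg s 4"
    using assms by (auto simp: search_inv_def)
  have "(\<Prod>p<k. 2 ^ dig n p) \<le> (\<Prod>p<k. 2 ^ w :: nat)"
  proof (intro prod_mono conjI)
    fix p
    have "dig n p < L" using L(4) by (simp add: dig_def)
    then show "2 ^ dig n p \<le> (2::nat) ^ w" using L(3) by (intro power_increasing) auto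
  qed auto
  then show le: "reg s 4 \<le> (2 ^ w) ^ k" using n(3) by simp
  show "bound_ok (2 ^ k * reg s 4)"
    unfolding bound_ok_def using low n le by (metis mult_le_mono2)
qed

lemma costs: "cost powers_body = 3" "cost search_body = 3" "loop_free powers_body" "loop_free search_body"
  by (simp_all add: powers_body_def search_body_def)

lemma bound_prog:
  assumes s: "mem s = M" "table s = (\<lambda>_. 0)"
  shows "execs W bound_prog s (7 + 4 * L + 4 * L ^ k)
    (\<lambda>s'. mem s' = M \<and> bound_ok (table s' []) \<and> (\<forall>key. 2 \<le> length key \<longrightarrow> table s' key = 0))"
proof -
  note [simp] = pow2_ge[OF W1]
  have W2: "2 \<le> (2::nat) ^ W" by simp
  have w1: "word W 1 = 1" using W2 by (intro word_small) linarith
  have 1: "execs W [SetReg 1 (Num 0), SetReg 2 (Num 1)] s 2 (powers_inv 0)"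
    by (rule execs_resultI) (use s w1 in \<open>auto simp: powers_inv_def\<close>)
  have 2: "execs W [While (le_expr (Reg 2) (sizeE m)) powers_body] s (L * Suc 3 + 1) (powers_inv L)"
    if "powers_inv 0 s" for s
  proof (rule execs_While[where I = powers_inv])
    have e: "eval W s (le_expr (Reg 2) (sizeE m)) = of_bool (2 ^ i \<le> IN)" if "powers_inv i s" for i s
      using that eval_sizeE[of s m] unfolding eval_le_expr[OF W1] by (simp add: powers_inv_def IN_def)
    fix i s
    assume "i < L" "powers_inv i s"
    then show "eval W s (le_expr (Reg 2) (sizeE m)) \<noteq> 0 \<and> execs W powers_body s 3 (powers_inv (Suc i))"
      using e[of i s] L(2)[of i] powers_inv_step[of i s] costs by (auto intro!: execs_resultI)
  next
    fix s assume "powers_inv L s"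
    then have "eval W s (le_expr (Reg 2) (sizeE m)) = of_bool (2 ^ L \<le> IN)"
      using eval_le_expr[OF W1] eval_sizeE[of s m] by (simp add: powers_inv_def IN_def)
    then show "eval W s (le_expr (Reg 2) (sizeE m)) = 0" using L(1) by simp
  qed fact
  have 3: "execs W [SetReg 3 (Num 0), SetReg 4 (Num 0)] s 2 (search_inv 0)" if "powers_inv L s" for s
    by (rule execs_resultI) (use that in \<open>auto simp: powers_inv_def search_inv_def\<close>)
  have 4: "execs W [While (Op Less (Reg 3) (powE k)) search_body] s (L ^ k * Suc 3 + 1) (search_inv (L ^ k))"
    if "search_inv 0 s" for s
  proof (rule execs_While[where I = search_inv])
    have e: "eval W s (Op Less (Reg 3) (powE k)) = of_bool (n < L ^ k)" if "search_inv n s" for n s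
      using that eval_powE[of s k] unfolding eval_Less[OF W1] by (simp add: search_inv_def)
    {
      fix n s
      assume "n < L ^ k" "search_inv n s"
      then show "eval W s (Op Less (Reg 3) (powE k)) \<noteq> 0 \<and> execs W search_body s 3 (search_inv (Suc n))"
        using e[of n s] search_inv_step[of n s] costs by (auto intro!: execs_resultI)
    }
    fix s assume "search_inv (L ^ k) s"
    then show "eval W s (Op Less (Reg 3) (powE k)) = 0" using e[of "L ^ k" s] by simp
  qed fact
  have 5: "execs W [SetTable [] (Op Mul (Num (2 ^ k)) (Reg 4))] s 1
    (\<lambda>s'. mem s' = M \<and> bound_ok (table s' []) \<and> (\<forall>key. 2 \<le> length key \<longrightarrow> table s' key = 0))"
    if "search_inv (L ^ k) s" for s
  proof (rule execs_resultI)
    have "2 ^ k * reg s 4 \<le> 2 ^ k * (2 ^ w) ^ k" using search_inv_final(2)[OF that] by simp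
    also have "\<dots> < 2 ^ (k + 1) * (2 ^ w) ^ k" by simp
    also have "\<dots> \<le> 2 ^ W" by (rule word_bound) (simp add: C0_def)
    finally have l: "2 ^ k * reg s 4 < 2 ^ W" .
    have "(2::nat) ^ k < 2 ^ (k + 1) * (2 ^ w) ^ 0" by simp
    also have "\<dots> \<le> 2 ^ W" by (rule word_bound) (simp add: C0_def)
    finally show "mem (result W [SetTable [] (Op Mul (Num (2 ^ k)) (Reg 4))] s) = M \<and>
      bound_ok (table (result W [SetTable [] (Op Mul (Num (2 ^ k)) (Reg 4))] s) []) \<and>
      (\<forall>key. 2 \<le> length key \<longrightarrow> table (result W [SetTable [] (Op Mul (Num (2 ^ k)) (Reg 4))] s) key = 0)"
      using l search_inv_final(1)[OF that] that by (auto simp: search_inv_def)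
  qed (simp_all)
  have "execs W bound_prog s (2 + (L * Suc 3 + 1 + (2 + (L ^ k * Suc 3 + 1 + 1))))
    (\<lambda>s'. mem s' = M \<and> bound_ok (table s' []) \<and> (\<forall>key. 2 \<le> length key \<longrightarrow> table s' key = 0))"
    unfolding bound_prog_def
    by (intro execs_append[OF 1] execs_append[OF 2] execs_append[OF 3] execs_append[OF 4] 5)
  then show ?thesis by (rule execs_mono) auto
qed

lemma index_all:
  assumes s: "mem s = M" "bound_ok (table s [])" "\<And>key. 2 \<le> length key \<Longrightarrow> table s key = 0"
  shows "execs W index_all s (nG * (18 * IN)) (\<lambda>s'. mem s' = M \<and> ready (table s'))"
proof -
  \<comment> \<open>Building an index writes only keys with its own number: earlier indices survive,
    and the tables of later ones are still 0 as their construction requires.\<close>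
  define I where "I g s \<longleftrightarrow> mem s = M \<and> bound_ok (table s []) \<and>
      (\<forall>g'<g. index_spec (pos g') (VV g') (tabs g' (table s))) \<and>
      (\<forall>g'\<ge>g. \<forall>i x. table s (i # g' # x) = 0)" for g and s :: machine
  have "execs W index_all s (nG * (18 * IN)) (I nG)"
    unfolding index_all_def
  proof (rule execs_concat[where I = I])
    show "I 0 s" using s by (simp add: I_def)
  next
    fix g s assume g: "g < nG" and I: "I g s"
    note G' = G[OF g]
    have YYk: "YY g \<subseteq> {..<k}" using G' S[of "rel g"] by auto
    have len: "len (rel g) \<le> IN" unfolding IN_def using G' by (intro member_le_sum) auto
    interpret ib: index_build W M "len (rel g)" g "pos g" "rowE (rel g) (YY g)" "lenE (rel g)"
      "\<lambda>\<tau>. map (val (rel g) \<tau>) (ps (YY g) k)"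
    proof
      show "g < 2 ^ W" using g by (intro small) (simp add: C0_def)
      have "(2::nat) ^ w \<le> 2 ^ W" using word_bound[of 1 0] by (simp add: C0_def)
      then show "len (rel g) < 2 ^ W" using len IN_bound by linarith
      show "pos g < length (rowE (rel g) (YY g))" using pos_less[OF g] by (simp add: rowE_def)
    qed (use G' YYk W3 in \<open>auto simp: eval_rowE eval_lenE\<close>)
    have "execs W (index_prog g (pos g) (rowE (rel g) (YY g)) (lenE (rel g))) s (14 * len (rel g) + 4)
       (\<lambda>s'. mem s' = M \<and> ib.frame (table s) (table s') \<and> index_spec (pos g) ib.V (tabs g (table s')))"
      using I by (intro ib.index_build) (auto simp: I_def)
    then show "execs W (index_prog g (pos g) (rowE (rel g) (YY g)) (lenE (rel g))) s (18 * IN) (I (Suc g))"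
    proof (rule execs_mono)
      show "14 * len (rel g) + 4 \<le> 18 * IN" using len IN_pos by (simp add: IN_def)
    next
      fix s' :: machine assume a: "mem s' = M \<and> ib.frame (table s) (table s') \<and> index_spec (pos g) ib.V (tabs g (table s'))"
      then have fr: "table s' key = table s key" if "\<forall>i<6. \<forall>x. key \<noteq> i # g # x" for key
        using that by (auto simp: ib.frame_def)
      have "tabs g' (table s') = tabs g' (table s)" if "g' \<noteq> g" for g'
        using fr that by (auto simp: tabs_def fun_eq_iff)
      moreover have "ib.V = VV g" by (simp add: ib.V_def VV_def)
      ultimately show "I (Suc g) s'"
        using a I fr unfolding I_def by (auto simp: less_Suc_eq)
    qed
  qed
  then show ?thesis by (rule execs_mono) (auto simp: I_def ready_def)
qed

lemma build:
  assumes s: "mem s = M" "table s = (\<lambda>_. 0)"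
  shows "execs W build s ((15 + 8 * k ^ k + 18 * nG) * IN) (\<lambda>s'. mem s' = M \<and> ready (table s'))"
proof -
  have "execs W build s (7 + 4 * L + 4 * L ^ k + nG * (18 * IN)) (\<lambda>s'. mem s' = M \<and> ready (table s'))"
    unfolding build_def by (rule execs_append[OF bound_prog[OF s] index_all]) auto
  \<comment> \<open>As \<open>IN\<close> is at least 1, the summands are at most
    \<open>7 * IN\<close>, \<open>8 * IN\<close>, \<open>8 * k ^ k * IN\<close> and
    \<open>18 * nG * IN\<close>.\<close>
  moreover have "7 + 4 * L + 4 * L ^ k + nG * (18 * IN) \<le> (15 + 8 * k ^ k + 18 * nG) * IN"
  proof -
    have "L < 2 ^ L" by (rule less_exp)
    also have "\<dots> = 2 * 2 ^ (L - 1)" using L(4) by (cases L) auto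
    finally have 1: "L \<le> 2 * IN" using L(5) by linarith
    have "L ^ k \<le> (2 * k ^ k) * 2 ^ (L - 1)" by (rule power_le_exp[OF L(4)])
    also have "\<dots> \<le> (2 * k ^ k) * IN" using L(5) by (rule mult_left_mono) simp
    finally have 2: "L ^ k \<le> 2 * (k ^ k * IN)" by simp
    have "1 \<le> IN" using IN_pos by (simp add: IN_def)
    then show ?thesis using 1 2 by (simp add: algebra_simps)
  qed
  ultimately show ?thesis by (rule execs_mono)
qed

end

section \<open>The program that decodes a seed\<close>

context shape
begin

text \<open>Register 0 is the success flag, so the value of attribute p lies in register p + 1,
  where \<open>outcome\<close> looks for it. Registers k + 1 and k + 2 hold the seed and the counter
  of the scan.\<close>

definition regE :: "nat list \<Rightarrow> expr list" where
  "regE xs = map (\<lambda>p. Reg (Suc p)) xs"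

definition d0E :: "nat \<Rightarrow> expr" where
  "d0E g = Table (tkey 4 g (regE (ps (YY g) (lev g))))"

definition d1E :: "nat \<Rightarrow> expr" where
  "d1E g = Table (tkey 1 g (regE (ps (YY g) (Suc (lev g)))))"

definition offE :: "nat \<Rightarrow> expr" where
  "offE g = Table (tkey 3 g (regE (ps (YY g) (Suc (lev g)))))"

text \<open>Together with \<open>QE\<close> and \<open>LE\<close> this describes an interval over a
  common denominator. Passing to a child shifts the start by \<open>Q / P * off / d0\<close> and
  scales the length by \<open>d1 / d0\<close>, which gives the three recursions.\<close>

fun PE :: "nat list \<Rightarrow> nat \<Rightarrow> expr" where
  "PE c 0 = Num 1"
| "PE c (Suc i) = Op Mul (PE c i) (d0E (c ! i))"

fun QE :: "nat list \<Rightarrow> nat \<Rightarrow> expr" where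
  "QE c 0 = Num 1"
| "QE c (Suc i) = Op Mul (QE c i) (d1E (c ! i))"

fun LE :: "nat list \<Rightarrow> nat \<Rightarrow> expr" where
  "LE c 0 = Num 0"
| "LE c (Suc i) = Op Add (Op Mul (LE c i) (d0E (c ! i))) (Op Mul (QE c i) (offE (c ! i)))"

definition BE :: expr where "BE = Table []"

text \<open>A seed packs a pair into one number: the numerator of the point is the quotient by
  \<open>length cl\<close>, and the number of the choice is the remainder.\<close>

definition rE :: expr where "rE = Op Div (Reg (k + 1)) (Num (length cl))"

definition seedsE :: expr where "seedsE = Op Mul (Num (length cl)) BE"

text \<open>The point r / B of the unit interval, relative to the interval of the current prefix and scaled
  to the number of tuples below it. The interval of a prefix starts at L / P and has length Q / P.\<close>

definition jE :: "nat list \<Rightarrow> nat \<Rightarrow> expr" where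
  "jE c i = Op Div (Op Mul (Op Sub (Op Mul rE (PE c i)) (Op Mul BE (LE c i))) (d0E (c ! i)))
     (Op Mul BE (QE c i))"

definition stepC :: "nat list \<Rightarrow> nat \<Rightarrow> command" where
  "stepC c i = SetReg (Suc (sg ! i)) (Table (tkey 5 (c ! i) (regE (ps (YY (c ! i)) i) @ [jE c i])))"

text \<open>Any level will do, because table 0 of an index on the whole schema contains the relation
  itself.\<close>

definition full :: "nat \<Rightarrow> nat" where
  "full \<rho> = (SOME g. g < nG \<and> rel g = \<rho> \<and> YY g = S \<rho>)"

definition membE :: expr where
  "membE = conj_expr (map (\<lambda>\<rho>. Op Eq (Table (tkey 0 (full \<rho>) (regE (ps (S \<rho>) k)))) (Num 2)) [0..<m])"

text \<open>The condition \<open>Q / P >= 1 / B\<close> without division.\<close>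

definition goodE :: "nat list \<Rightarrow> expr" where
  "goodE c = le_expr (PE c k) (Op Mul BE (QE c k))"

definition firstE :: "nat \<Rightarrow> expr" where
  "firstE j = conj_expr (map (\<lambda>j'. Op Eq (goodE (cl ! j')) (Num 0)) [0..<j])"

text \<open>Seed (r, j) is accepted for t if t is in the join, choice j is the first one whose interval for
  t has length at least 1 / B, and r / B is the first multiple of 1 / B in this interval. The check
  depends on t and the seed only, hence no step of the decoding has to be checked for failure: on seeds
  of no tuple the registers may hold garbage.\<close>

definition chkE :: "nat \<Rightarrow> expr" where
  "chkE j = Op Mul membE (Op Mul (Op Mul (goodE (cl ! j)) (firstE j))
     (Op Mul (le_expr (Op Mul BE (LE (cl ! j) k)) (Op Mul rE (PE (cl ! j) k)))
       (Op Less (Op Mul rE (PE (cl ! j) k)) (Op Add (Op Mul BE (LE (cl ! j) k)) (PE (cl ! j) k)))))"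

definition code :: "nat \<Rightarrow> program" where
  "code j = map (stepC (cl ! j)) [0..<k] @ [SetReg 0 (chkE j)]"

definition branch :: "nat \<Rightarrow> program" where
  "branch j = [If (Op Eq (Op Mod (Reg (k + 1)) (Num (length cl))) (Num j)) (code j) []]"

definition trial :: program where
  "trial = concat (map branch [0..<length cl])"

lemma full: assumes "\<rho> < m" shows "full \<rho> < nG" "rel (full \<rho>) = \<rho>" "YY (full \<rho>) = S \<rho>"
proof -
  obtain p where p: "p \<in> S \<rho>" "p < k" using S[OF assms] by blast
  then obtain i where "i < k" "sg ! i = p" using sg len_sg by (metis in_set_conv_nth lessThan_iff)
  then have "\<exists>g. g < nG \<and> rel g = \<rho> \<and> YY g = S \<rho>"
    using G_complete[OF assms, of "S \<rho>" i] p by auto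
  from someI_ex[OF this] show "full \<rho> < nG" "rel (full \<rho>) = \<rho>" "YY (full \<rho>) = S \<rho>"
    unfolding full_def by auto
qed

lemma sg_nth: "i < k \<Longrightarrow> sg ! i < k"
  using sg(2) len_sg nth_mem by blast

lemma ps_subset: "set (ps Z i) \<subseteq> set (take i sg)"
  by (auto simp: ps_def)

lemma loop_free_trial: "loop_free trial"
proof -
  have "loop_free (map (stepC c) xs)" for c xs
    by (induction xs) (auto simp: stepC_def)
  then have "loop_free (code j)" for j
    by (simp add: code_def)
  then show ?thesis by (auto simp: trial_def loop_free_concat branch_def)
qed

end

context inst
begin

definition Jn :: "nat list set" where
  "Jn = {t. length t = k \<and> (\<forall>\<rho><m. \<exists>\<tau><len \<rho>. \<forall>p\<in>S \<rho>. t ! p = val \<rho> \<tau> p)}"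

definition prj :: "nat list \<Rightarrow> nat set \<Rightarrow> nat \<Rightarrow> nat list" where
  "prj t Z i = map ((!) t) (ps Z i)"

end

section \<open>Intervals of the tuples of the join\<close>

locale ready = inst +
  fixes T :: "nat list \<Rightarrow> nat"
  assumes ready: "ready T"
begin

definition d0 :: "nat \<Rightarrow> nat list \<Rightarrow> nat" where
  "d0 g t = tabs g T 4 (prj t (YY g) (lev g))"
definition d1 :: "nat \<Rightarrow> nat list \<Rightarrow> nat" where
  "d1 g t = tabs g T 1 (prj t (YY g) (Suc (lev g)))"
definition off :: "nat \<Rightarrow> nat list \<Rightarrow> nat" where
  "off g t = tabs g T 3 (prj t (YY g) (Suc (lev g)))"

fun Pn :: "nat list \<Rightarrow> nat list \<Rightarrow> nat \<Rightarrow> nat" where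
  "Pn c t 0 = 1"
| "Pn c t (Suc i) = Pn c t i * d0 (c ! i) t"

fun Qn :: "nat list \<Rightarrow> nat list \<Rightarrow> nat \<Rightarrow> nat" where
  "Qn c t 0 = 1"
| "Qn c t (Suc i) = Qn c t i * d1 (c ! i) t"

fun Ln :: "nat list \<Rightarrow> nat list \<Rightarrow> nat \<Rightarrow> nat" where
  "Ln c t 0 = 0"
| "Ln c t (Suc i) = Ln c t i * d0 (c ! i) t + Qn c t i * off (c ! i) t"

definition B :: nat where "B = T []"

lemma B: "bound_ok B" using ready by (simp add: ready_def B_def)

lemma B_le: "B \<le> 2 ^ k * (2 ^ w) ^ k" using B by (simp add: bound_ok_def)

lemma B_pos: "1 \<le> B"
proof -
  obtain f where f: "B = 2 ^ k * (\<Prod>p<k. 2 ^ f p)" using B by (auto simp: bound_ok_def)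
  have "0 < (\<Prod>p<k. 2 ^ f p :: nat)" by (intro prod_pos) auto
  then have "B > 0" unfolding f by simp
  then show ?thesis by simp
qed

lemma spec: "g < nG \<Longrightarrow> index_spec (pos g) (VV g) (tabs g T)"
  using ready by (simp add: ready_def)

lemma prj_Suc: "g < nG \<Longrightarrow> prj t (YY g) (Suc (lev g)) = prj t (YY g) (lev g) @ [t ! (sg ! lev g)]"
  by (simp add: prj_def ps_YY_Suc)

lemma take_prj:
  assumes "g < nG"
  shows "take (pos g) (prj t (YY g) k) = prj t (YY g) (lev g)"
    "take (Suc (pos g)) (prj t (YY g) k) = prj t (YY g) (Suc (lev g))"
proof -
  have l: "lev g \<le> k" "Suc (lev g) \<le> k" using G[OF assms] by auto
  show "take (pos g) (prj t (YY g) k) = prj t (YY g) (lev g)"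
    using take_ps[OF l(1), of "YY g"] by (simp add: prj_def pos_def take_map)
  have "Suc (pos g) = length (ps (YY g) (Suc (lev g)))"
    by (simp add: pos_def ps_YY_Suc[OF assms])
  then show "take (Suc (pos g)) (prj t (YY g) k) = prj t (YY g) (Suc (lev g))"
    using take_ps[OF l(2), of "YY g"] by (simp add: prj_def take_map)
qed

lemma prj_in_VV:
  assumes "t \<in> Jn" "g < nG"
  shows "prj t (YY g) k \<in> VV g"
proof -
  have g: "rel g < m" "YY g \<subseteq> S (rel g)" "YY g \<subseteq> {..<k}" using G[OF assms(2)] S[of "rel g"] by auto
  then obtain \<tau> where \<tau>: "\<tau> < len (rel g)" "\<forall>p\<in>S (rel g). t ! p = val (rel g) \<tau> p"
    using assms(1) by (auto simp: Jn_def)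
  then have "prj t (YY g) k = map (val (rel g) \<tau>) (ps (YY g) k)"
    using g set_ps_k[OF g(3)] by (auto simp: prj_def)
  then show ?thesis using \<tau>(1) by (auto simp: VV_def)
qed

lemma fin_VV: "finite (VV g)" by (simp add: VV_def)

lemma card_VV: assumes "g < nG" shows "card (VV g) \<le> IN"
proof -
  have "card (VV g) \<le> len (rel g)"
    unfolding VV_def using card_image_le[of "{..<len (rel g)}"] by simp
  also have "\<dots> \<le> IN" unfolding IN_def using G[OF assms] by (intro member_le_sum) auto
  finally show ?thesis .
qed

text \<open>The projection of \<open>t\<close> is itself among the counted tuples, so every node on
  its path exists in the tree and the specification of the index applies. Nothing of this kind holds
  for tuples outside the join.\<close>

lemma degs:
  assumes t: "t \<in> Jn" and g: "g < nG"
  shows "1 \<le> d1 g t" "d1 g t \<le> d0 g t" "off g t + d1 g t \<le> d0 g t" "d0 g t \<le> 2 ^ w"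
    "off g t \<le> x \<Longrightarrow> x < off g t + d1 g t \<Longrightarrow> tabs g T 5 (prj t (YY g) (lev g) @ [x]) = t ! (sg ! lev g)"
proof -
  note sp = spec[OF g, unfolded index_spec_def]
  have d1: "d1 g t = card {y\<in>VV g. take (Suc (pos g)) y = prj t (YY g) (Suc (lev g))}"
    using sp by (simp add: d1_def)
  have "prj t (YY g) k \<in> {y\<in>VV g. take (Suc (pos g)) y = prj t (YY g) (Suc (lev g))}"
    using prj_in_VV[OF t g] take_prj[OF g] by simp
  then have "0 < d1 g t" unfolding d1 card_gt_0_iff using fin_VV by auto
  then show 1: "1 \<le> d1 g t" by simp
  have "d0 g t = card {y\<in>VV g. take (pos g) y = prj t (YY g) (lev g)}"
    using sp by (simp add: d0_def)
  also have "\<dots> \<le> card (VV g)" using fin_VV by (intro card_mono) auto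
  finally show "d0 g t \<le> 2 ^ w" using card_VV[OF g] IN_bound by linarith
  have pos: "0 < tabs g T 1 (prj t (YY g) (lev g) @ [t ! (sg ! lev g)])"
    using 1 by (simp add: d1_def prj_Suc[OF g])
  then have "tabs g T 3 (prj t (YY g) (lev g) @ [t ! (sg ! lev g)]) +
      tabs g T 1 (prj t (YY g) (lev g) @ [t ! (sg ! lev g)]) \<le> tabs g T 4 (prj t (YY g) (lev g))"
    using sp by blast
  then show "off g t + d1 g t \<le> d0 g t"
    by (simp add: d0_def d1_def off_def prj_Suc[OF g])
  then show "d1 g t \<le> d0 g t" by simp
  show "tabs g T 5 (prj t (YY g) (lev g) @ [x]) = t ! (sg ! lev g)"
    if "off g t \<le> x" "x < off g t + d1 g t"
    using sp pos that unfolding off_def d1_def prj_Suc[OF g] by blast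
qed

lemma nth_cl: "c \<in> set cl \<Longrightarrow> i < k \<Longrightarrow> c ! i < nG \<and> lev (c ! i) = i"
  using cl by auto

text \<open>\<open>off + d1 <= d0\<close> keeps the interval of a child inside that of its parent,
  hence inside the unit interval. In integer form this bounds all three numbers by \<open>P\<close>,
  and so by a power of the word range.\<close>

lemma PQL:
  assumes t: "t \<in> Jn" and c: "c \<in> set cl"
  shows "i \<le> k \<Longrightarrow> 1 \<le> Qn c t i \<and> Ln c t i + Qn c t i \<le> Pn c t i \<and> Pn c t i \<le> (2 ^ w) ^ i"
proof (induction i)
  case (Suc i)
  then have g: "c ! i < nG" using nth_cl[OF c] by simp
  note d = degs[OF t g]
  have IH: "1 \<le> Qn c t i" "Ln c t i + Qn c t i \<le> Pn c t i" "Pn c t i \<le> (2 ^ w) ^ i"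
    using Suc by auto
  have "Ln c t (Suc i) + Qn c t (Suc i) = Ln c t i * d0 (c ! i) t + Qn c t i * (off (c ! i) t + d1 (c ! i) t)"
    by (simp add: algebra_simps)
  also have "\<dots> \<le> Ln c t i * d0 (c ! i) t + Qn c t i * d0 (c ! i) t"
    using d(3) by (intro add_left_mono mult_left_mono) auto
  also have "\<dots> \<le> Pn c t i * d0 (c ! i) t"
    using IH(2) by (simp flip: add_mult_distrib)
  finally have "Ln c t (Suc i) + Qn c t (Suc i) \<le> Pn c t (Suc i)" by simp
  moreover have "Pn c t i * d0 (c ! i) t \<le> (2 ^ w) ^ i * 2 ^ w"
    using IH(3) d(4) by (rule mult_mono) auto
  moreover have "1 * 1 \<le> Qn c t i * d1 (c ! i) t" using IH(1) d(1) by (rule mult_mono) auto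
  ultimately show ?case by (simp add: mult.commute)
qed simp

lemma Pn_pos: "t \<in> Jn \<Longrightarrow> c \<in> set cl \<Longrightarrow> i \<le> k \<Longrightarrow> 0 < Pn c t i"
  using PQL[of t c i] by linarith

text \<open>Each level only shrinks the interval, because the part from \<open>off\<close> to
  \<open>off + d1\<close> lies between 0 and \<open>d0\<close>. The induction descends from the full
  tuple to the prefix.\<close>

lemma interval_mono:
  assumes t: "t \<in> Jn" and c: "c \<in> set cl" and i: "i \<le> k"
  shows "real (Ln c t i) / real (Pn c t i) \<le> real (Ln c t k) / real (Pn c t k)"
    "(real (Ln c t k) + real (Qn c t k)) / real (Pn c t k) \<le>
      (real (Ln c t i) + real (Qn c t i)) / real (Pn c t i)"
proof -
  have "real (Ln c t i) / real (Pn c t i) \<le> real (Ln c t k) / real (Pn c t k) \<and>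
    (real (Ln c t k) + real (Qn c t k)) / real (Pn c t k) \<le>
      (real (Ln c t i) + real (Qn c t i)) / real (Pn c t i)"
    using i
  proof (induction rule: inc_induct)
    case (step i)
    then have g: "c ! i < nG" using nth_cl[OF c] by simp
    note d = degs[OF t g] and q = PQL[OF t c, of i]
    have P: "0 < real (Pn c t i)" "0 < real (d0 (c ! i) t)" using q step d by auto
    have "real (Ln c t i) / real (Pn c t i) \<le> real (Ln c t (Suc i)) / real (Pn c t (Suc i))"
      using P by (simp add: field_simps)
    moreover have "(real (Ln c t (Suc i)) + real (Qn c t (Suc i))) / real (Pn c t (Suc i)) \<le>
      (real (Ln c t i) + real (Qn c t i)) / real (Pn c t i)"
    proof -
      have "real (Qn c t i) * (real (off (c ! i) t) + real (d1 (c ! i) t)) \<le> real (Qn c t i) * real (d0 (c ! i) t)"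
        using d(3) by (intro mult_left_mono) (simp_all flip: of_nat_add)
      then have "(real (Ln c t (Suc i)) + real (Qn c t (Suc i))) / real (Pn c t (Suc i)) \<le>
          ((real (Ln c t i) + real (Qn c t i)) * real (d0 (c ! i) t)) / (real (Pn c t i) * real (d0 (c ! i) t))"
        using P by (simp add: divide_right_mono algebra_simps)
      also have "\<dots> = (real (Ln c t i) + real (Qn c t i)) / real (Pn c t i)"
        using P by simp
      finally show ?thesis .
    qed
    ultimately show ?case using step.IH by linarith
  qed simp
  then show "real (Ln c t i) / real (Pn c t i) \<le> real (Ln c t k) / real (Pn c t k)"
    "(real (Ln c t k) + real (Qn c t k)) / real (Pn c t k) \<le>
      (real (Ln c t i) + real (Qn c t i)) / real (Pn c t i)" by auto
qed

definition good :: "nat list \<Rightarrow> nat list \<Rightarrow> bool" where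
  "good c t \<longleftrightarrow> Pn c t k \<le> B * Qn c t k"

text \<open>Says that \<open>r\<close> is \<open>B * L / P\<close> rounded up, again without
  division.\<close>

definition hits :: "nat \<Rightarrow> nat list \<Rightarrow> nat list \<Rightarrow> bool" where
  "hits r c t \<longleftrightarrow> B * Ln c t k \<le> r * Pn c t k \<and> r * Pn c t k < B * Ln c t k + Pn c t k"

text \<open>The fraction r / B lies in the nested intervals of all prefixes of t, so that each level
  selects the right child.\<close>

lemma child_index:
  assumes t: "t \<in> Jn" and c: "c \<in> set cl" and gd: "good c t" and h: "hits r c t" and i: "i < k"
  shows "off (c ! i) t \<le> (r * Pn c t i - B * Ln c t i) * d0 (c ! i) t div (B * Qn c t i)"
    "(r * Pn c t i - B * Ln c t i) * d0 (c ! i) t div (B * Qn c t i) < off (c ! i) t + d1 (c ! i) t"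
proof -
  let ?P = "Pn c t" and ?Q = "Qn c t" and ?L = "Ln c t"
  have Pk: "0 < real (?P k)" and PS: "0 < real (?P (Suc i))"
    using Pn_pos[OF t c, of k] Pn_pos[OF t c, of "Suc i"] i unfolding of_nat_0_less_iff by simp_all
  have Bp: "0 < real B" using B_pos by simp
  note m = interval_mono[OF t c, of "Suc i"]
  have "real (?L k) / real (?P k) \<le> real r / real B"
  proof -
    have "real (B * ?L k) \<le> real (r * ?P k)" using h unfolding hits_def of_nat_le_iff by simp
    then show ?thesis using Pk Bp by (simp add: field_simps)
  qed
  then have "real (?L (Suc i)) / real (?P (Suc i)) \<le> real r / real B" using m(1) i by simp
  then have "real (B * ?L (Suc i)) \<le> real (r * ?P (Suc i))"
    using PS Bp by (simp add: field_simps)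
  then have lo: "B * ?L (Suc i) \<le> r * ?P (Suc i)" by (simp only: of_nat_le_iff)
  have "real r / real B < (real (?L k) + real (?Q k)) / real (?P k)"
  proof -
    have "r * ?P k < B * (?L k + ?Q k)"
      using h gd unfolding hits_def good_def by (simp add: distrib_left)
    then have "real (r * ?P k) < real (B * (?L k + ?Q k))" by (simp only: of_nat_less_iff)
    then show ?thesis using Pk Bp by (simp add: field_simps)
  qed
  then have "real r / real B < (real (?L (Suc i)) + real (?Q (Suc i))) / real (?P (Suc i))"
    using m(2) i by simp
  then have "real (r * ?P (Suc i)) < real (B * (?L (Suc i) + ?Q (Suc i)))"
    using PS Bp by (simp add: field_simps)
  then have hi: "r * ?P (Suc i) < B * (?L (Suc i) + ?Q (Suc i))" by (simp only: of_nat_less_iff)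
  have BQ: "0 < B * ?Q i" using PQL[OF t c, of i] i B_pos by auto
  define N where "N = (r * ?P i - B * ?L i) * d0 (c ! i) t"
  have N: "N = r * ?P (Suc i) - B * ?L i * d0 (c ! i) t"
    by (simp add: N_def diff_mult_distrib mult.assoc)
  have "B * ?Q i * off (c ! i) t \<le> N"
    using lo by (simp add: N algebra_simps)
  then show "off (c ! i) t \<le> (r * ?P i - B * ?L i) * d0 (c ! i) t div (B * ?Q i)"
    unfolding N_def[symmetric] using BQ by (simp add: less_eq_div_iff_mult_less_eq mult.commute)
  \<comment> \<open>Subtraction of naturals is truncated. Where it would be, \<open>N\<close> is 0
    and the bound is clear, the right-hand side being positive.\<close>
  have "N < B * ?Q i * (off (c ! i) t + d1 (c ! i) t)"
  proof (cases "B * ?L i * d0 (c ! i) t \<le> r * ?P (Suc i)")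
    case True
    have "r * ?P (Suc i) < B * ?L i * d0 (c ! i) t + B * ?Q i * (off (c ! i) t + d1 (c ! i) t)"
      using hi by (simp add: algebra_simps)
    then show ?thesis using True unfolding N by linarith
  next
    case False
    then have "N = 0" by (simp add: N)
    then show ?thesis using BQ degs(1)[OF t, of "c ! i"] nth_cl[OF c i] by simp
  qed
  then show "(r * ?P i - B * ?L i) * d0 (c ! i) t div (B * ?Q i) < off (c ! i) t + d1 (c ! i) t"
    unfolding N_def[symmetric] using BQ by (simp add: div_less_iff_less_mult mult.commute)
qed

definition agree :: "nat list \<Rightarrow> nat \<Rightarrow> machine \<Rightarrow> bool" where
  "agree t i s \<longleftrightarrow> mem s = M \<and> table s = T \<and> (\<forall>p\<in>set (take i sg). reg s (Suc p) = t ! p)"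

lemma agree_mono: "agree t i s \<Longrightarrow> i' \<le> i \<Longrightarrow> agree t i' s"
  using set_take_subset_set_take[of i' i sg] by (auto simp: agree_def)

lemma eval_regE: "agree t i s \<Longrightarrow> map (eval W s) (regE (ps Z i)) = prj t Z i"
  using ps_subset[of Z i] by (auto simp: agree_def regE_def prj_def)

lemma eval_tkey: "g < nG \<Longrightarrow> i < 8 \<Longrightarrow> map (eval W s) (tkey i g xs) = i # g # map (eval W s) xs"
proof -
  assume "g < nG" "i < 8"
  then have "g < 2 ^ W" "i < 2 ^ W" by (auto intro!: small simp: C0_def)
  then show ?thesis by (simp add: tkey_def)
qed

lemma eval_degs:
  assumes "g < nG" "table s = T"
  shows "agree t (lev g) s \<Longrightarrow> eval W s (d0E g) = d0 g t"
    "agree t (Suc (lev g)) s \<Longrightarrow> eval W s (d1E g) = d1 g t"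
    "agree t (Suc (lev g)) s \<Longrightarrow> eval W s (offE g) = off g t"
  using assms
  by (simp_all add: d0E_def d1E_def offE_def d0_def d1_def off_def eval_tkey eval_regE tabs_def)

text \<open>The strict form of \<open>word_bound\<close>: there is at least one relation, so the
  other summands of \<open>C0\<close> provide one more bit.\<close>

lemma big: fixes x :: nat shows "a + b \<le> 10 * (k + 2) \<Longrightarrow> x \<le> 2 ^ b * (2 ^ w) ^ a \<Longrightarrow> x < 2 ^ W"
proof -
  assume a: "a + b \<le> 10 * (k + 2)" and "x \<le> 2 ^ b * (2 ^ w) ^ a"
  then have "(2::nat) ^ b * (2 ^ w) ^ a < 2 ^ W \<Longrightarrow> ?thesis" by linarith
  moreover have "nG + length cl + nc * (2 * k + 1) + m * (k + 1) \<ge> 1"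
  proof -
    have "0 < m" using IN_pos by (cases "m = 0") (auto simp: One_nat_def)
    then show ?thesis by (cases m) auto
  qed
  then have "(2::nat) ^ (b + 1) * (2 ^ w) ^ a \<le> 2 ^ W"
    using a by (intro word_bound) (simp add: C0_def)
  then have "(2::nat) ^ b * (2 ^ w) ^ a < 2 ^ W"
    by (rule less_le_trans[rotated]) simp
  ultimately show ?thesis by simp
qed

lemma eval_PQL:
  assumes t: "t \<in> Jn" and c: "c \<in> set cl"
  shows "i \<le> k \<Longrightarrow> agree t i s \<Longrightarrow>
    eval W s (PE c i) = Pn c t i \<and> eval W s (QE c i) = Qn c t i \<and> eval W s (LE c i) = Ln c t i"
proof (induction i)
  case 0
  then show ?case using pow2_ge[OF W1] by simp
next
  case (Suc i)
  then have i: "i < k" and g: "c ! i < nG" "lev (c ! i) = i" and s: "table s = T"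
    using nth_cl[OF c, of i] by (auto simp: agree_def)
  have IH: "eval W s (PE c i) = Pn c t i" "eval W s (QE c i) = Qn c t i" "eval W s (LE c i) = Ln c t i"
    using Suc agree_mono[of t "Suc i" s i] by auto
  note e = eval_degs[OF g(1) s, of t, unfolded g(2)]
  have ee: "eval W s (d0E (c ! i)) = d0 (c ! i) t" "eval W s (d1E (c ! i)) = d1 (c ! i) t"
    "eval W s (offE (c ! i)) = off (c ! i) t"
    using e Suc.prems(2) agree_mono[of t "Suc i" s i] by auto
  have b: "Ln c t (Suc i) + Qn c t (Suc i) \<le> Pn c t (Suc i)" "Pn c t (Suc i) \<le> (2 ^ w) ^ Suc i"
    using PQL[OF t c, of "Suc i"] Suc.prems(1) by auto
  have "Pn c t (Suc i) < 2 ^ W" using b(2) i by (intro big[of "Suc i" 0]) auto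
  then have "Pn c t (Suc i) < 2 ^ W" "Qn c t (Suc i) < 2 ^ W" "Ln c t (Suc i) < 2 ^ W" using b(1) by auto
  then show ?case using IH ee by simp
qed

lemma eval_BE: "table s = T \<Longrightarrow> eval W s BE = B"
  by (simp add: BE_def B_def)

lemma cl_small: "length cl < 2 ^ W" by (rule small) (simp add: C0_def)

lemma eval_rE: "reg s (k + 1) = z \<Longrightarrow> z div length cl < B \<Longrightarrow> eval W s rE = z div length cl"
proof -
  assume z: "reg s (k + 1) = z" "z div length cl < B"
  have "B < 2 ^ W" using B_le by (intro big[of k k]) auto
  then show ?thesis using z cl_small by (simp add: rE_def)
qed

lemma BP_small: "t \<in> Jn \<Longrightarrow> c \<in> set cl \<Longrightarrow> i \<le> k \<Longrightarrow> r \<le> B \<Longrightarrow>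
    r * Pn c t i \<le> 2 ^ k * (2 ^ w) ^ (2 * k) \<and> r * Ln c t i \<le> 2 ^ k * (2 ^ w) ^ (2 * k) \<and>
    r * Qn c t i \<le> 2 ^ k * (2 ^ w) ^ (2 * k)"
proof -
  assume a: "t \<in> Jn" "c \<in> set cl" "i \<le> k" "r \<le> B"
  have "Pn c t i \<le> (2 ^ w) ^ i" using PQL[OF a(1,2,3)] by simp
  also have "\<dots> \<le> (2 ^ w) ^ k" using a(3) by (intro power_increasing) auto
  finally have p: "Pn c t i \<le> (2 ^ w) ^ k" .
  then have "y \<le> Pn c t i \<Longrightarrow> r * y \<le> (2 ^ k * (2 ^ w) ^ k) * (2 ^ w) ^ k" for y
    using a(4) B_le by (intro mult_mono) auto
  moreover have "(2 ^ k * (2 ^ w) ^ k) * (2 ^ w) ^ k = 2 ^ k * ((2::nat) ^ w) ^ (2 * k)"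
    by (simp only: mult_2 power_add mult.assoc)
  moreover have "Ln c t i \<le> Pn c t i" "Qn c t i \<le> Pn c t i" using PQL[OF a(1,2,3)] by auto
  ultimately show ?thesis by simp
qed

lemma eval_jE:
  assumes t: "t \<in> Jn" and c: "c \<in> set cl" and i: "i < k" and s: "agree t i s"
    and z: "reg s (k + 1) = z" "z div length cl < B"
  shows "eval W s (jE c i) = (z div length cl * Pn c t i - B * Ln c t i) * d0 (c ! i) t div (B * Qn c t i)"
proof -
  define r where "r = z div length cl"
  have g: "c ! i < nG" "lev (c ! i) = i" and sT: "table s = T"
    using nth_cl[OF c, of i] i s by (auto simp: agree_def)
  have e: "eval W s (PE c i) = Pn c t i" "eval W s (QE c i) = Qn c t i" "eval W s (LE c i) = Ln c t i"
    using eval_PQL[OF t c, of i s] i s by auto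
  have d: "eval W s (d0E (c ! i)) = d0 (c ! i) t" using eval_degs(1)[OF g(1) sT, of t] s g(2) by simp
  have r: "eval W s rE = r" "r \<le> B" using eval_rE[OF z] z(2) by (auto simp: r_def)
  have b: "r * Pn c t i \<le> 2 ^ k * (2 ^ w) ^ (2 * k)" "B * Ln c t i \<le> 2 ^ k * (2 ^ w) ^ (2 * k)"
    "B * Qn c t i \<le> 2 ^ k * (2 ^ w) ^ (2 * k)"
    using BP_small[OF t c, of i] i r(2) by auto
  have s1: "r * Pn c t i < 2 ^ W" "B * Ln c t i < 2 ^ W" "B * Qn c t i < 2 ^ W"
    by (rule big[of "2 * k" k], simp, fact b)+
  have "(r * Pn c t i - B * Ln c t i) * d0 (c ! i) t \<le> (2 ^ k * (2 ^ w) ^ (2 * k)) * 2 ^ w"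
    using b(1) degs(4)[OF t g(1)] by (intro mult_mono) auto
  also have "\<dots> = 2 ^ k * (2 ^ w) ^ (2 * k + 1)" by (simp only: power_add power_one_right mult.assoc)
  finally have s2: "(r * Pn c t i - B * Ln c t i) * d0 (c ! i) t < 2 ^ W"
    by (intro big[of "2 * k + 1" k]) auto
  then have "(r * Pn c t i - B * Ln c t i) * d0 (c ! i) t div (B * Qn c t i) < 2 ^ W"
    by (meson div_le_dividend le_less_trans)
  moreover have "r * Pn c t i - B * Ln c t i < 2 ^ W" using s1(1) by simp
  ultimately show ?thesis
    using s1 s2 unfolding r_def[symmetric] by (simp add: jE_def e d r eval_BE[OF sT])
qed

end

lemma (in shape) loop_free_steps: "loop_free (map (stepC c) xs)"
  by (induction xs) (auto simp: stepC_def)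

lemma scratch_regs [simp]: "n + 1 \<notin> Suc ` {..<n}" "n + 2 \<notin> Suc ` {..<n}"
  by auto

lemma (in shape) loop_free_code: "loop_free (code j)"
  by (simp add: code_def loop_free_steps)

section \<open>Seeds of the tuples and correctness of the decoding\<close>

context ready
begin

definition seeds :: nat where "seeds = length cl * B"

lemma seed_split: "z < seeds \<Longrightarrow> z mod length cl < length cl \<and> z div length cl < B"
  by (cases "length cl = 0") (auto simp: seeds_def less_mult_imp_div_less mult.commute)

lemma seeds_small: "seeds < 2 ^ W"
proof -
  have "B > 0" using B_pos by simp
  then have "seeds < 2 ^ length cl * B"
    unfolding seeds_def using less_exp by (intro mult_strict_right_mono)
  also have "\<dots> \<le> 2 ^ length cl * (2 ^ k * (2 ^ w) ^ k)" using B_le by (intro mult_left_mono) auto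
  also have "\<dots> = 2 ^ (length cl + k) * (2 ^ w) ^ k" by (simp only: power_add mult.assoc)
  also have "\<dots> \<le> 2 ^ W" by (rule word_bound) (simp add: C0_def)
  finally show ?thesis .
qed

definition acc :: "nat \<Rightarrow> nat list \<Rightarrow> bool" where
  "acc z t \<longleftrightarrow> t \<in> Jn \<and> z < seeds \<and> good (cl ! (z mod length cl)) t \<and>
     (\<forall>j<z mod length cl. \<not> good (cl ! j) t) \<and> hits (z div length cl) (cl ! (z mod length cl)) t"

text \<open>A half-open interval of length \<open>1 / B\<close> contains only one multiple of
  \<open>1 / B\<close>.\<close>

lemma hits_unique:
  assumes "t \<in> Jn" "c \<in> set cl" "hits r c t" "hits r' c t"
  shows "r = r'"
proof -
  note P = Pn_pos[OF assms(1,2) le_refl]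
  have "r \<le> r'" if "hits r c t" "hits r' c t" for r r'
  proof -
    have "r * Pn c t k < r' * Pn c t k + Pn c t k" using that unfolding hits_def by linarith
    then have "r * Pn c t k < Suc r' * Pn c t k" by simp
    then have "r < Suc r'" using P by (simp only: mult_less_cancel2)
    then show ?thesis by simp
  qed
  then show ?thesis using assms(3,4) le_antisym by blast
qed

text \<open>Round up. For a good choice the resulting point lies inside the interval of
  \<open>t\<close>, which is part of the unit interval; therefore \<open>r\<close> is below
  \<open>B\<close>.\<close>

lemma hits_exist:
  assumes "t \<in> Jn" "c \<in> set cl" "good c t"
  shows "\<exists>r<B. hits r c t"
proof -
  note q = PQL[OF assms(1,2) le_refl] and P = Pn_pos[OF assms(1,2) le_refl]
  define r where "r = (B * Ln c t k + (Pn c t k - 1)) div Pn c t k"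
  have e: "r * Pn c t k + (B * Ln c t k + (Pn c t k - 1)) mod Pn c t k = B * Ln c t k + (Pn c t k - 1)"
    by (simp add: r_def)
  have "(B * Ln c t k + (Pn c t k - 1)) mod Pn c t k < Pn c t k" using P by simp
  then have h: "hits r c t" using e P unfolding hits_def by linarith
  have "B * (Ln c t k + Qn c t k) \<le> B * Pn c t k" using q by (intro mult_left_mono) auto
  then have "B * Ln c t k + B * Qn c t k \<le> B * Pn c t k" by (simp add: distrib_left)
  then have "r * Pn c t k < B * Pn c t k"
    using h assms(3) unfolding hits_def good_def by linarith
  then show ?thesis using h by auto
qed

lemma acc_unique:
  assumes "acc z t" "acc z' t"
  shows "z = z'"
proof -
  have m: "z mod length cl = z' mod length cl"
    using assms by (meson acc_def linorder_neqE_nat)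
  have "cl ! (z mod length cl) \<in> set cl"
    using assms(1) seed_split by (simp add: acc_def)
  then have "z div length cl = z' div length cl"
    using assms m hits_unique[of t "cl ! (z mod length cl)"] by (auto simp: acc_def)
  then show ?thesis using m by (metis div_mult_mod_eq)
qed

lemma acc_exist:
  assumes t: "t \<in> Jn" and ex: "\<exists>c\<in>set cl. good c t"
  shows "\<exists>z. acc z t"
proof -
  define j where "j = (LEAST j. j < length cl \<and> good (cl ! j) t)"
  have "\<exists>j. j < length cl \<and> good (cl ! j) t" using ex by (metis in_set_conv_nth)
  from LeastI_ex[OF this] have j: "j < length cl" "good (cl ! j) t" by (auto simp: j_def)
  have first: "\<not> good (cl ! j') t" if "j' < j" for j'
    using not_less_Least[of j' "\<lambda>j. j < length cl \<and> good (cl ! j) t"] that j(1) by (auto simp: j_def)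
  obtain r where r: "r < B" "hits r (cl ! j) t" using hits_exist[OF t _ j(2)] j(1) by auto
  have "r * length cl + j < seeds"
  proof -
    have "r * length cl + j < Suc r * length cl" using j(1) by simp
    also have "\<dots> \<le> B * length cl" using r(1) by (intro mult_right_mono) auto
    finally show ?thesis by (simp add: seeds_def mult.commute)
  qed
  moreover have "(r * length cl + j) div length cl = r" "(r * length cl + j) mod length cl = j"
    using j(1) by (subst div_mult_self3, auto)
  ultimately have "acc (r * length cl + j) t"
    using t j r first unfolding acc_def by simp
  then show ?thesis by blast
qed

text \<open>Holds for every seed, including those of no tuple: whatever garbage is decoded, seed and
  counter survive, so the check can still refer to the seed.\<close>

lemma steps_frame:
  assumes "mem s = M" "table s = T"
  shows "i \<le> k \<Longrightarrow> \<exists>R. result W (map (stepC c) [0..<i]) s = s\<lparr>reg := R\<rparr> \<and>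
    (\<forall>r. r \<notin> Suc ` {..<k} \<longrightarrow> R r = reg s r)"
proof (induction i)
  case 0
  show ?case by (rule exI[of _ "reg s"]) simp
next
  case (Suc i)
  obtain R where R: "result W (map (stepC c) [0..<i]) s = s\<lparr>reg := R\<rparr>" "\<forall>r. r \<notin> Suc ` {..<k} \<longrightarrow> R r = reg s r"
    using Suc by auto
  have "sg ! i < k" using Suc.prems by (intro sg_nth) simp
  define v where "v = eval W (s\<lparr>reg := R\<rparr>) (Table (tkey 5 (c ! i) (regE (ps (YY (c ! i)) i) @ [jE c i])))"
  have "result W (map (stepC c) [0..<Suc i]) s = result W [stepC c i] (s\<lparr>reg := R\<rparr>)"
    by (simp add: result_append loop_free_steps R(1))
  also have "\<dots> = s\<lparr>reg := R(Suc (sg ! i) := v)\<rparr>"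
    by (simp add: stepC_def v_def)
  finally have "result W (map (stepC c) [0..<Suc i]) s = s\<lparr>reg := R(Suc (sg ! i) := v)\<rparr>" .
  moreover have "\<forall>r. r \<notin> Suc ` {..<k} \<longrightarrow> (R(Suc (sg ! i) := v)) r = reg s r"
    using R(2) \<open>sg ! i < k\<close> by auto
  ultimately show ?case by blast
qed

text \<open>By \<open>child_index\<close> the computed point lies in the interval of that child
  which continues \<open>t\<close>, and there table 5 returns the next value of
  \<open>t\<close>.\<close>

lemma steps_agree:
  assumes t: "t \<in> Jn" and c: "c \<in> set cl" and gd: "good c t" and h: "hits (z div length cl) c t"
    and s: "mem s = M" "table s = T" "reg s (k + 1) = z" "z < seeds"
  shows "i \<le> k \<Longrightarrow> agree t i (result W (map (stepC c) [0..<i]) s)"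
proof (induction i)
  case 0
  then show ?case using s by (simp add: agree_def)
next
  case (Suc i)
  then have i: "i < k" by simp
  define s1 where "s1 = result W (map (stepC c) [0..<i]) s"
  have a: "agree t i s1" using Suc by (simp add: s1_def)
  have z: "reg s1 (k + 1) = z" using steps_frame[OF s(1,2), of i c] i s(3) by (auto simp: s1_def)
  have zB: "z div length cl < B" using seed_split[OF s(4)] by simp
  note g = nth_cl[OF c i]
  define x where "x = (z div length cl * Pn c t i - B * Ln c t i) * d0 (c ! i) t div (B * Qn c t i)"
  have x: "off (c ! i) t \<le> x" "x < off (c ! i) t + d1 (c ! i) t"
    using child_index[OF t c gd h i] by (auto simp: x_def)
  have ej: "eval W s1 (jE c i) = x" unfolding x_def by (rule eval_jE[OF t c i a z zB])
  have "result W (map (stepC c) [0..<Suc i]) s = result W [stepC c i] s1"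
    by (simp add: result_append loop_free_steps s1_def[symmetric])
  also have "\<dots> = s1\<lparr>reg := (reg s1)(Suc (sg ! i) := T (5 # c ! i # prj t (YY (c ! i)) i @ [x]))\<rparr>"
    using g a by (simp add: stepC_def eval_tkey eval_regE[OF a] ej) (simp add: agree_def)
  also have "T (5 # c ! i # prj t (YY (c ! i)) i @ [x]) = t ! (sg ! i)"
    using degs(5)[OF t _ x] g by (simp add: tabs_def)
  finally have d: "result W (map (stepC c) [0..<Suc i]) s = s1\<lparr>reg := (reg s1)(Suc (sg ! i) := t ! (sg ! i))\<rparr>" .
  show ?case
    unfolding d using a i by (auto simp: agree_def take_Suc_conv_app_nth len_sg)
qed

lemma eval_membE:
  assumes s: "agree t k s" and t: "length t = k"
  shows "eval W s membE = of_bool (t \<in> Jn)"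
proof -
  have e: "eval W s (Op Eq (Table (tkey 0 (full \<rho>) (regE (ps (S \<rho>) k)))) (Num 2)) =
      of_bool (\<exists>\<tau><len \<rho>. \<forall>p\<in>S \<rho>. t ! p = val \<rho> \<tau> p)" if r: "\<rho> < m" for \<rho>
  proof -
    note f = full[OF r]
    have "tabs (full \<rho>) T 0 (prj t (S \<rho>) k) = (if prj t (S \<rho>) k \<in> VV (full \<rho>) then 2 else 0)"
      using spec[OF f(1)] by (simp add: index_spec_def)
    moreover have "prj t (S \<rho>) k \<in> VV (full \<rho>) \<longleftrightarrow> (\<exists>\<tau><len \<rho>. \<forall>p\<in>S \<rho>. t ! p = val \<rho> \<tau> p)"
      using S[OF r] set_ps_k[of "S \<rho>"] by (auto simp: VV_def prj_def f)
    moreover have "table s = T" using s by (simp add: agree_def)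
    moreover have "2 < (2::nat) ^ W" using power_increasing[OF W3, of "2::nat"] by simp
    ultimately show ?thesis using f(1) W1
      by (simp add: eval_tkey eval_regE[OF s] tabs_def)
  qed
  show ?thesis unfolding membE_def
    using t by (subst eval_conj_expr_map[OF W1 e]) (auto simp: Jn_def)
qed

lemma eval_goodE:
  assumes t: "t \<in> Jn" and c: "c \<in> set cl" and s: "agree t k s"
  shows "eval W s (goodE c) = of_bool (good c t)"
proof -
  have sT: "table s = T" using s by (simp add: agree_def)
  have "B * Qn c t k < 2 ^ W" using BP_small[OF t c, of k B] by (intro big[of "2 * k" k]) auto
  then show ?thesis
    using eval_PQL[OF t c _ s] W1 by (simp add: goodE_def eval_le_expr good_def eval_BE[OF sT])
qed

lemma eval_chkE:
  assumes s: "agree t k s" and t: "length t = k" and z: "reg s (k + 1) = z" "z < seeds"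
    and j: "j = z mod length cl"
  shows "eval W s (chkE j) = of_bool (acc z t)"
proof (cases "t \<in> Jn")
  \<comment> \<open>Outside the join the degrees may be meaningless, but the factor
    \<open>membE\<close> is 0 and with it the whole product.\<close>
  case False
  then show ?thesis using eval_membE[OF s t] by (simp add: chkE_def acc_def)
next
  case True
  note zs = seed_split[OF z(2)]
  have c: "cl ! j \<in> set cl" using zs j by simp
  have sT: "table s = T" using s by (simp add: agree_def)
  let ?c = "cl ! j" and ?r = "z div length cl"
  have e: "eval W s (PE ?c k) = Pn ?c t k" "eval W s (LE ?c k) = Ln ?c t k"
    using eval_PQL[OF True c _ s] by auto
  have r: "eval W s rE = ?r" using eval_rE[OF z(1)] zs by simp
  have b: "?r * Pn ?c t k \<le> 2 ^ k * (2 ^ w) ^ (2 * k)" "B * Ln ?c t k \<le> 2 ^ k * (2 ^ w) ^ (2 * k)"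
    "1 * Pn ?c t k \<le> 2 ^ k * (2 ^ w) ^ (2 * k)"
    using BP_small[OF True c, of k ?r] BP_small[OF True c, of k B] BP_small[OF True c, of k 1] zs B_pos by auto
  have "B * Ln ?c t k + Pn ?c t k \<le> 2 ^ (k + 1) * (2 ^ w) ^ (2 * k)"
    using b(2,3) by (simp add: power_add)
  then have "B * Ln ?c t k + Pn ?c t k < 2 ^ W" by (intro big[of "2 * k" "k + 1"]) auto
  moreover have "?r * Pn ?c t k < 2 ^ W" using b(1) by (intro big[of "2 * k" k]) auto
  ultimately have h: "eval W s (Op Mul (le_expr (Op Mul BE (LE ?c k)) (Op Mul rE (PE ?c k)))
       (Op Less (Op Mul rE (PE ?c k)) (Op Add (Op Mul BE (LE ?c k)) (PE ?c k)))) =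
     of_bool (hits ?r ?c t)"
    using W1 by (simp add: eval_le_expr e r eval_BE[OF sT] hits_def)
  have g: "eval W s (goodE (cl ! j')) = of_bool (good (cl ! j') t)" if "j' < length cl" for j'
    using that by (intro eval_goodE[OF True _ s]) auto
  have jl: "j < length cl" using zs j by simp
  have "eval W s (Op Eq (goodE (cl ! j')) (Num 0)) = of_bool (\<not> good (cl ! j') t)" if "j' \<in> set [0..<j]" for j'
    using that jl W1 g[of j'] by simp
  then have f: "eval W s (firstE j) = of_bool (\<forall>j'<j. \<not> good (cl ! j') t)"
    unfolding firstE_def by (subst eval_conj_expr_map[OF W1]) auto
  have mul: "eval W s (Op Mul a b) = of_bool (P \<and> Q)"
    if "eval W s a = of_bool P" "eval W s b = of_bool Q" for a b P Q
    using that W1 by simp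
  have "eval W s (chkE j) = of_bool (t \<in> Jn \<and> ((good ?c t \<and> (\<forall>j'<j. \<not> good (cl ! j') t)) \<and> hits ?r ?c t))"
    unfolding chkE_def by (intro mul eval_membE[OF s t] f h g[OF jl])
  then show ?thesis using True z by (simp add: acc_def j)
qed

lemma trial_skip:
  "reg s (k + 1) mod length cl \<notin> set js \<Longrightarrow> \<forall>j\<in>set js. j < length cl \<Longrightarrow> reg s (k + 1) < seeds \<Longrightarrow>
    result W (concat (map branch js)) s = s"
proof (induction js)
  case (Cons j js)
  have "reg s (k + 1) mod length cl < 2 ^ W"
    using cl_small seed_split[OF Cons.prems(3)] by linarith
  moreover have "j < 2 ^ W" using cl_small Cons.prems(2) by auto
  moreover have "0 < (2::nat) ^ W" by simp
  ultimately show ?case using Cons cl_small by (simp add: branch_def)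
qed simp

text \<open>No later branch fires in addition to the selected one, because the code of a branch
  leaves the seed register unchanged.\<close>

lemma result_trial:
  assumes s: "mem s = M" "table s = T" and z: "reg s (k + 1) = z" "z < seeds"
  shows "result W trial s = result W (code (z mod length cl)) s"
proof -
  define j where "j = z mod length cl"
  have j: "j < length cl" using seed_split[OF z(2)] by (simp add: j_def)
  have lf: "loop_free (concat (map branch js))" for js
    by (auto simp: loop_free_concat branch_def loop_free_code)
  have "[0..<length cl] = [0..<j] @ [j..<length cl]"
    using j upt_add_eq_append[of 0 j "length cl - j"] by simp
  also have "[j..<length cl] = [j] @ [Suc j..<length cl]" using j by (simp add: upt_conv_Cons)
  finally have u: "[0..<length cl] = [0..<j] @ [j] @ [Suc j..<length cl]" .
  have "trial = concat (map branch [0..<j]) @ branch j @ concat (map branch [Suc j..<length cl])"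
    unfolding trial_def u by simp
  then have "result W trial s = result W (concat (map branch [Suc j..<length cl]))
      (result W (branch j) (result W (concat (map branch [0..<j])) s))"
    using lf[of "[j]"] by (simp add: result_append lf)
  also have "result W (concat (map branch [0..<j])) s = s"
    using z j by (intro trial_skip) (auto simp: j_def)
  also have "result W (branch j) s = result W (code j) s"
    using j cl_small z W1 pow2_ge[OF W1] by (simp add: branch_def j_def[symmetric])
  also have "result W (concat (map branch [Suc j..<length cl])) (result W (code j) s) = result W (code j) s"
  proof (rule trial_skip)
    obtain R where R: "result W (map (stepC (cl ! j)) [0..<k]) s = s\<lparr>reg := R\<rparr>"
      "\<forall>r. r \<notin> Suc ` {..<k} \<longrightarrow> R r = reg s r"
      using steps_frame[OF s le_refl] by blast
    then have "reg (result W (code j) s) (k + 1) = z"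
      using z by (auto simp: code_def result_append loop_free_steps)
    then show "reg (result W (code j) s) (k + 1) mod length cl \<notin> set [Suc j..<length cl]"
      "reg (result W (code j) s) (k + 1) < seeds" using z by (auto simp: j_def)
  qed auto
  finally show ?thesis by (simp add: j_def)
qed

text \<open>Soundness and completeness of decoding: the flag is correct for whatever tuple ends up
  in the registers, and a seed of \<open>t\<close> reproduces \<open>t\<close>. So the flag is 1
  precisely on seeds of tuples.\<close>

lemma trial_result:
  assumes s: "mem s = M" "table s = T" and z: "reg s (k + 1) = z" "z < seeds"
  shows "\<exists>R. result W trial s = s\<lparr>reg := R\<rparr> \<and> R (k + 2) = reg s (k + 2) \<and>
    R 0 = of_bool (acc z (map (\<lambda>i. R (Suc i)) [0..<k])) \<and>
    (\<forall>t. acc z t \<longrightarrow> map (\<lambda>i. R (Suc i)) [0..<k] = t)"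
proof -
  define j where "j = z mod length cl"
  obtain R where R: "result W (map (stepC (cl ! j)) [0..<k]) s = s\<lparr>reg := R\<rparr>"
      "\<forall>r. r \<notin> Suc ` {..<k} \<longrightarrow> R r = reg s r"
    using steps_frame[OF s le_refl] by blast
  define t where "t = map (\<lambda>i. R (Suc i)) [0..<k]"
  define s1 where "s1 = s\<lparr>reg := R\<rparr>"
  have a: "agree t k s1" using s sg len_sg by (auto simp: agree_def s1_def t_def)
  have z1: "reg s1 (k + 1) = z" using R(2) z by (auto simp: s1_def)
  have chk: "eval W s1 (chkE j) = of_bool (acc z t)"
    by (rule eval_chkE[OF a _ z1 z(2)]) (simp_all add: t_def j_def)
  have "result W trial s = s\<lparr>reg := R(0 := of_bool (acc z t))\<rparr>"
    unfolding result_trial[OF s z] j_def[symmetric] code_def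
    by (simp add: result_append loop_free_steps R(1) chk[unfolded s1_def])
  moreover have "t = t'" if "acc z t'" for t'
  proof -
    have "cl ! j \<in> set cl" using seed_split[OF z(2)] by (simp add: j_def)
    then have "agree t' k (result W (map (stepC (cl ! j)) [0..<k]) s)"
      using that by (intro steps_agree[OF _ _ _ _ s z]) (auto simp: acc_def j_def)
    then have "\<forall>p<k. R (Suc p) = t' ! p" "length t' = k"
      using that sg len_sg R(1) by (auto simp: agree_def acc_def Jn_def)
    then show ?thesis unfolding t_def by (intro nth_equalityI) auto
  qed
  ultimately show ?thesis
    using R(2)[rule_format, OF scratch_regs(2)]
    by (intro exI[of _ "R(0 := of_bool (acc z t))"]) (simp add: t_def[symmetric])
qed

definition enc :: "nat list \<Rightarrow> nat" where "enc t = (THE z. acc z t)"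

lemma sampler:
  assumes ex: "\<And>t. t \<in> Jn \<Longrightarrow> \<exists>c\<in>set cl. good c t"
  shows "sampler W k (k + 1) (k + 2) trial seeds seedsE Jn enc (\<lambda>s. mem s = M \<and> table s = T)"
proof -
  have acc_enc: "acc (enc t) t" if "t \<in> Jn" for t
    unfolding enc_def using acc_exist[OF that ex[OF that]] acc_unique by (metis theI)
  have enc_eq: "enc t = z" if "acc z t" for t z
    using acc_unique[OF acc_enc that] that by (simp add: acc_def)
  \<comment> \<open>Decoding is deterministic: executed on any machine with this seed, it returns
    \<open>t\<close> as well as \<open>t'\<close>.\<close>
  have inj: "inj_on enc Jn"
  proof (rule inj_onI)
    fix t t' assume t: "t \<in> Jn" "t' \<in> Jn" "enc t = enc t'"
    define s where "s = \<lparr>reg = \<lambda>_. enc t, mem = M, table = T\<rparr>"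
    have "enc t < seeds" using acc_enc[OF t(1)] by (simp add: acc_def)
    then obtain R where "\<forall>t'. acc (enc t) t' \<longrightarrow> map (\<lambda>i. R (Suc i)) [0..<k] = t'"
      using trial_result[of s "enc t"] by (auto simp: s_def)
    then show "t = t'" using acc_enc[OF t(1)] acc_enc[OF t(2)] t(3) by metis
  qed
  have less: "enc t < seeds" if "t \<in> Jn" for t using acc_enc[OF that] by (simp add: acc_def)
  have fin: "finite Jn"
    by (rule inj_on_finite[OF inj, of "{..<seeds}"]) (use less in auto)
  show ?thesis
  proof
    fix s :: machine assume s: "mem s = M \<and> table s = T"
    show "eval W s seedsE = seeds"
      using s seeds_small cl_small by (simp add: seedsE_def eval_BE seeds_def)
  next
    fix s :: machine assume s: "mem s = M \<and> table s = T" "reg s (k + 1) < seeds"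
    from trial_result[OF conjunct1[OF s(1)] conjunct2[OF s(1)] refl s(2)]
    obtain R where R: "result W trial s = s\<lparr>reg := R\<rparr>" "R (k + 2) = reg s (k + 2)"
      "R 0 = of_bool (acc (reg s (k + 1)) (map (\<lambda>i. R (Suc i)) [0..<k]))"
      "\<And>t. acc (reg s (k + 1)) t \<Longrightarrow> map (\<lambda>i. R (Suc i)) [0..<k] = t" by blast
    show "(mem (result W trial s) = M \<and> table (result W trial s) = T) \<and>
      reg (result W trial s) (k + 2) = reg s (k + 2) \<and>
      (if reg s (k + 1) \<in> enc ` Jn
       then reg (result W trial s) 0 = 1 \<and>
         (\<exists>t\<in>Jn. enc t = reg s (k + 1) \<and> map (\<lambda>i. reg (result W trial s) (Suc i)) [0..<k] = t)
       else reg (result W trial s) 0 = 0)"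
    proof (cases "reg s (k + 1) \<in> enc ` Jn")
      case True
      then obtain t where t: "t \<in> Jn" "enc t = reg s (k + 1)" by auto
      have a: "acc (reg s (k + 1)) t" using acc_enc[OF t(1)] t(2) by simp
      have "map (\<lambda>i. R (Suc i)) [0..<k] = t" by (rule R(4)[OF a])
      then have "R 0 = 1" using R(3) a by simp
      then show ?thesis using True t s R(1,2) R(4)[OF a] by auto
    next
      case False
      have "\<not> acc (reg s (k + 1)) t" for t
        using False enc_eq[of "reg s (k + 1)" t] by (metis acc_def imageI)
      then show ?thesis using False s R(1,2,3) by simp
    qed
  qed (use W1 seeds_small fin inj less loop_free_trial in auto)
qed

end

section \<open>Existence of a good choice for every tuple\<close>

context ready
begin

text \<open>The number d(i) for every level, also for those whose attribute lies outside
  \<open>Z\<close>, so that the telescoping can pass through all levels.\<close>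

definition cnt :: "nat \<Rightarrow> nat set \<Rightarrow> nat \<Rightarrow> nat list \<Rightarrow> nat" where
  "cnt \<rho> Z i t = card {y \<in> (\<lambda>\<tau>. map (val \<rho> \<tau>) (ps Z k)) ` {..<len \<rho>}.
     take (length (ps Z i)) y = prj t Z i}"

lemma d0_cnt: "g < nG \<Longrightarrow> d0 g t = cnt (rel g) (YY g) (lev g) t"
  using spec[of g] by (simp add: d0_def index_spec_def cnt_def VV_def pos_def)

lemma d1_cnt: "g < nG \<Longrightarrow> d1 g t = cnt (rel g) (YY g) (Suc (lev g)) t"
  using spec[of g] by (simp add: d1_def index_spec_def cnt_def VV_def pos_def ps_YY_Suc)

lemma d0_le: assumes "g < nG" shows "d0 g t \<le> IN"
proof -
  have "d0 g t = card {y\<in>VV g. take (pos g) y = prj t (YY g) (lev g)}"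
    using spec[OF assms] by (simp add: d0_def index_spec_def)
  also have "\<dots> \<le> card (VV g)" using fin_VV by (intro card_mono) auto
  finally show ?thesis using card_VV[OF assms] by linarith
qed

text \<open>Take \<open>f\<close> as the integer part of the binary logarithm of
  \<open>a div b\<close>.\<close>

lemma power_of_two_quotient:
  fixes a b :: nat
  assumes "1 \<le> b" "b \<le> a"
  shows "\<exists>f. 2 ^ f * b \<le> a \<and> a \<le> 2 * 2 ^ f * b"
proof -
  have "1 \<le> a div b" using assms by (simp add: less_eq_div_iff_mult_less_eq)
  then obtain f where f: "2 ^ f \<le> a div b" "a div b < 2 ^ (f + 1)"
    using ex_power_ivl1[of 2 "a div b"] by auto
  have "2 ^ f * b \<le> a div b * b" using f(1) by (rule mult_right_mono) simp
  also have "\<dots> \<le> a" by simp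
  finally have 1: "2 ^ f * b \<le> a" .
  have "a < (a div b + 1) * b" using assms(1) dividend_less_div_times[of b a] by (simp add: add_mult_distrib)
  also have "\<dots> \<le> 2 ^ (f + 1) * b" using f(2) by (intro mult_right_mono) auto
  finally show ?thesis using 1 by (intro exI[of _ f]) (simp add: power_add)
qed

text \<open>The logarithms of the inverse relative degrees of t, each minimized over all projections of
  all relations, form a modular function that satisfies the degree constraints. Rounded down to
  integers they take part in the search for the bound B, which makes up for the rounding by the
  factor 2 ^ k.\<close>

lemma good_exists:
  assumes t: "t \<in> Jn"
    and cover: "\<And>p. p < k \<Longrightarrow> \<exists>\<rho><m. p \<in> S \<rho>"
    and guard: "\<And>c. c < nc \<Longrightarrow> \<exists>\<rho><m. Y c \<subseteq> S \<rho> \<and>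
      card ((\<lambda>\<tau>. map (val \<rho> \<tau>) (ps (Y c) k)) ` {\<tau>. \<tau> < len \<rho> \<and> (\<forall>p\<in>X c. val \<rho> \<tau> p = t ! p)}) \<le> NN c"
  shows "\<exists>c\<in>set cl. good c t"
proof -
  define r where "r g = real (d1 g t) / real (d0 g t)" for g
  \<comment> \<open>The index with the largest ratio on this level, with the comparison of ratios
    cross-multiplied.\<close>
  have "\<exists>g<nG. lev g = i \<and> (\<forall>g'<nG. lev g' = i \<longrightarrow> d1 g' t * d0 g t \<le> d1 g t * d0 g' t)" if i: "i < k" for i
  proof -
    define A where "A = {g. g < nG \<and> lev g = i}"
    obtain \<rho> where \<rho>: "\<rho> < m" "sg ! i \<in> S \<rho>" using cover[OF sg_nth[OF i]] by blast
    obtain g where "g < nG" "lev g = i" using G_complete[OF \<rho>(1) subset_refl i \<rho>(2)] by blast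
    then have A: "finite A" "A \<noteq> {}" by (auto simp: A_def)
    then have "Max (r ` A) \<in> r ` A" by (intro Max_in) auto
    then obtain g where g: "g \<in> A" "r g = Max (r ` A)" by auto
    have "d1 g' t * d0 g t \<le> d1 g t * d0 g' t" if "g' \<in> A" for g'
    proof -
      have "r g' \<le> r g" unfolding g(2) using that A by (intro Max_ge) auto
      moreover have "0 < d0 g t" "0 < d0 g' t"
        using degs(1,2)[OF t, of g] degs(1,2)[OF t, of g'] g(1) that by (auto simp: A_def)
      ultimately have "real (d1 g' t) * real (d0 g t) \<le> real (d1 g t) * real (d0 g' t)"
        by (simp add: r_def field_simps)
      then show ?thesis by (simp flip: of_nat_mult)
    qed
    then show ?thesis using g(1) by (auto simp: A_def)
  qed
  then obtain ch where ch: "\<And>i. i < k \<Longrightarrow> ch i < nG \<and> lev (ch i) = i \<and>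
      (\<forall>g'<nG. lev g' = i \<longrightarrow> d1 g' t * d0 (ch i) t \<le> d1 (ch i) t * d0 g' t)" by metis
  define c where "c = map ch [0..<k]"
  have c: "c \<in> set cl" using ch cl by (auto simp: c_def)
  have nth_c: "c ! i = ch i" if "i < k" for i using that by (simp add: c_def)
  have "\<exists>f. 2 ^ f * d1 (ch i) t \<le> d0 (ch i) t \<and> d0 (ch i) t \<le> 2 * 2 ^ f * d1 (ch i) t" if "i < k" for i
    using ch[OF that] degs[OF t, of "ch i"] by (intro power_of_two_quotient) auto
  then obtain f where f: "\<And>i. i < k \<Longrightarrow> 2 ^ f i * d1 (ch i) t \<le> d0 (ch i) t"
    "\<And>i. i < k \<Longrightarrow> d0 (ch i) t \<le> 2 * 2 ^ f i * d1 (ch i) t" by metis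
  \<comment> \<open>The largest ratio has the smallest inverse, so its rounded inverse bounds the
    quotient \<open>d0 / d1\<close> of every index on the same level from below.\<close>
  have deg_step: "2 ^ f (lev g) * d1 g t \<le> d0 g t" if g: "g < nG" for g
  proof -
    define i where "i = lev g"
    have i: "i < k" using G[OF g] by (simp add: i_def)
    have "(2 ^ f i * d1 g t) * d0 (ch i) t = 2 ^ f i * (d1 g t * d0 (ch i) t)" by simp
    also have "\<dots> \<le> 2 ^ f i * (d1 (ch i) t * d0 g t)"
      using ch[OF i] g by (intro mult_left_mono) (auto simp: i_def)
    also have "\<dots> = (2 ^ f i * d1 (ch i) t) * d0 g t" by simp
    also have "\<dots> \<le> d0 (ch i) t * d0 g t" using f(1)[OF i] by (intro mult_right_mono) auto
    finally have "(2 ^ f i * d1 g t) * d0 (ch i) t \<le> d0 g t * d0 (ch i) t" by (simp add: mult.commute)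
    moreover have "0 < d0 (ch i) t" using degs(1,2)[OF t, of "ch i"] ch[OF i] by auto
    ultimately show ?thesis unfolding i_def by (meson mult_le_cancel2)
  qed
  define ix where "ix p = (THE i. i < k \<and> sg ! i = p)" for p
  have ix: "ix (sg ! i) = i" if "i < k" for i
    unfolding ix_def using that sg(1) len_sg by (auto simp: nth_eq_iff_index_eq intro!: the_equality)
  have bij: "bij_betw ((!) sg) {..<k} {..<k}"
    using bij_betw_nth[OF sg(1)] len_sg sg(2) by auto
  have srj: "\<exists>i<k. sg ! i = p" if "p < k" for p
    using that sg(2) len_sg by (metis in_set_conv_nth lessThan_iff)
  have pf: "(\<Prod>p\<in>(!) sg ` I. 2 ^ f (ix p)) = (\<Prod>i\<in>I. 2 ^ f i :: nat)" if "I \<subseteq> {..<k}" for I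
  proof -
    have "inj_on ((!) sg) I" using bij that by (meson bij_betw_def inj_on_subset)
    then show ?thesis using that by (auto simp: prod.reindex ix intro!: prod.cong)
  qed
  have "feas (\<lambda>p. f (ix p))"
    unfolding feas_def
  proof (intro allI impI)
    fix c assume cn: "c < nc"
    from guard[OF cn] obtain \<rho> where \<rho>: "\<rho> < m" "Y c \<subseteq> S \<rho>"
      "card ((\<lambda>\<tau>. map (val \<rho> \<tau>) (ps (Y c) k)) ` {\<tau>. \<tau> < len \<rho> \<and> (\<forall>p\<in>X c. val \<rho> \<tau> p = t ! p)}) \<le> NN c"
      by blast
    define I where "I = {i. i < k \<and> sg ! i \<in> Y c - X c}"
    have YI: "(!) sg ` I = Y c - X c"
    proof -
      have "p \<in> (!) sg ` I" if "p \<in> Y c - X c" for p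
      proof -
        have "p \<in> (!) sg ` {..<k}" using bij XY[OF cn] that by (auto simp: bij_betw_def)
        then show ?thesis using that by (auto simp: I_def)
      qed
      then show ?thesis by (auto simp: I_def)
    qed
    have Ik: "I \<subseteq> {..<k}" by (auto simp: I_def)
    have "(\<Prod>i\<in>I. 2 ^ f i) \<le> NN c"
    proof (cases "I = {}")
      case True
      then show ?thesis using NN[OF cn] by simp
    next
      case False
      have finI: "finite I" using Ik finite_subset by blast
      define i0 where "i0 = Min I"
      have i0: "i0 \<in> I" "\<And>i. i \<in> I \<Longrightarrow> i0 \<le> i" using finI False by (auto simp: i0_def)
      \<comment> \<open>Telescoping from the last level down to \<open>i0\<close>, the first level
        of an attribute of Y - X. It starts at level \<open>k\<close>, where \<open>t\<close> itself
        makes the count at least 1; levels in \<open>I\<close> contribute a factor by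
        \<open>deg_step\<close>.\<close>
      have "(\<Prod>i\<in>I \<inter> {j..<k}. 2 ^ f i) \<le> cnt \<rho> (Y c) j t" if "j \<le> k" "i0 \<le> j" for j
        using that
      proof (induction rule: inc_induct)
        case base
        have YS: "Y c \<subseteq> {..<k}" using XY[OF cn] by simp
        obtain \<tau> where \<tau>: "\<tau> < len \<rho>" "\<forall>p\<in>S \<rho>. t ! p = val \<rho> \<tau> p" using t \<rho>(1) by (auto simp: Jn_def)
        then have "prj t (Y c) k = map (val \<rho> \<tau>) (ps (Y c) k)"
          using \<rho>(2) set_ps_k[OF YS] by (auto simp: prj_def)
        with \<tau>(1) have "prj t (Y c) k \<in> (\<lambda>\<tau>. map (val \<rho> \<tau>) (ps (Y c) k)) ` {..<len \<rho>}"
          by (intro image_eqI[of _ _ \<tau>]) auto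
        then have "prj t (Y c) k \<in> {y \<in> (\<lambda>\<tau>. map (val \<rho> \<tau>) (ps (Y c) k)) ` {..<len \<rho>}.
            take (length (ps (Y c) k)) y = prj t (Y c) k}"
          by (auto simp: prj_def)
        then have "0 < cnt \<rho> (Y c) k t" unfolding cnt_def card_gt_0_iff by auto
        then show ?case by simp
      next
        case (step j)
        show ?case
        proof (cases "j \<in> I")
          case True
          then have "sg ! j \<in> Y c" by (simp add: I_def)
          from G_complete[OF \<rho>(1,2) step.hyps(2) this]
          obtain g where g: "g < nG" "rel g = \<rho>" "YY g = Y c" "lev g = j" by blast
          have "I \<inter> {j..<k} = insert j (I \<inter> {Suc j..<k})" using True step.hyps by (auto simp: Ik)
          then have "(\<Prod>i\<in>I \<inter> {j..<k}. 2 ^ f i) = 2 ^ f j * (\<Prod>i\<in>I \<inter> {Suc j..<k}. 2 ^ f i)"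
            using finI by simp
          also have "\<dots> \<le> 2 ^ f j * cnt \<rho> (Y c) (Suc j) t"
            using step by (intro mult_left_mono) auto
          also have "\<dots> \<le> cnt \<rho> (Y c) j t"
            using deg_step[OF g(1)] g
            by (simp add: d0_cnt d1_cnt)
          finally show ?thesis .
        next
          case False
          \<comment> \<open>All attributes of X come before \<open>i0\<close> in the topological
            order, so a level from \<open>i0\<close> on that is not in \<open>I\<close> has an
            attribute outside Y and leaves the count unchanged.\<close>
          have "sg ! j \<notin> Y c"
          proof
            assume a: "sg ! j \<in> Y c"
            then have "sg ! j \<in> X c" using False step.hyps by (auto simp: I_def)
            moreover have "sg ! i0 \<in> Y c - X c" "i0 < k" using i0(1) by (auto simp: I_def)
            ultimately have "j < i0" using topo[OF cn step.hyps(2)] by blast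
            then show False using step.prems by simp
          qed
          then have "ps (Y c) (Suc j) = ps (Y c) j" using step.hyps by (simp add: ps_Suc)
          then have "cnt \<rho> (Y c) (Suc j) t = cnt \<rho> (Y c) j t" by (simp add: cnt_def prj_def)
          moreover have "I \<inter> {j..<k} = I \<inter> {Suc j..<k}"
            using False by (auto simp: Suc_le_eq le_less)
          ultimately show ?thesis using step by simp
        qed
      qed
      from this[of i0] have "(\<Prod>i\<in>I \<inter> {i0..<k}. 2 ^ f i) \<le> cnt \<rho> (Y c) i0 t"
        using i0(1) Ik by auto
      moreover have "I \<inter> {i0..<k} = I" using i0 Ik by auto
      \<comment> \<open>Agreement with \<open>t\<close> before level \<open>i0\<close> includes
        agreement on X, so the degree bound of the guard applies.\<close>
      moreover have "cnt \<rho> (Y c) i0 t \<le>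
          card ((\<lambda>\<tau>. map (val \<rho> \<tau>) (ps (Y c) k)) ` {\<tau>. \<tau> < len \<rho> \<and> (\<forall>p\<in>X c. val \<rho> \<tau> p = t ! p)})"
        unfolding cnt_def
      proof (rule card_mono)
        show "{y \<in> (\<lambda>\<tau>. map (val \<rho> \<tau>) (ps (Y c) k)) ` {..<len \<rho>}. take (length (ps (Y c) i0)) y = prj t (Y c) i0}
          \<subseteq> (\<lambda>\<tau>. map (val \<rho> \<tau>) (ps (Y c) k)) ` {\<tau>. \<tau> < len \<rho> \<and> (\<forall>p\<in>X c. val \<rho> \<tau> p = t ! p)}"
        proof
          fix y assume "y \<in> {y \<in> (\<lambda>\<tau>. map (val \<rho> \<tau>) (ps (Y c) k)) ` {..<len \<rho>}.
              take (length (ps (Y c) i0)) y = prj t (Y c) i0}"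
          then obtain \<tau> where \<tau>: "\<tau> < len \<rho>" "y = map (val \<rho> \<tau>) (ps (Y c) k)"
            "take (length (ps (Y c) i0)) y = prj t (Y c) i0" by auto
          have "i0 \<le> k" using i0(1) Ik by auto
          then have eq: "map (val \<rho> \<tau>) (ps (Y c) i0) = map ((!) t) (ps (Y c) i0)"
            using \<tau>(2,3) take_ps[of i0 k "Y c"] by (simp add: take_map prj_def)
          have "val \<rho> \<tau> p = t ! p" if p: "p \<in> X c" for p
          proof -
            obtain a where a: "a < k" "sg ! a = p" using srj[of p] XY[OF cn] p by auto
            have "sg ! i0 \<in> Y c - X c" "i0 < k" using i0(1) by (auto simp: I_def)
            then have "a < i0" using topo[OF cn a(1), of i0] a(2) p by blast
            then have "p \<in> set (ps (Y c) i0)"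
              using a p XY[OF cn] len_sg by (auto simp: ps_def in_set_conv_nth)
            then show ?thesis using eq by auto
          qed
          then show "y \<in> (\<lambda>\<tau>. map (val \<rho> \<tau>) (ps (Y c) k)) ` {\<tau>. \<tau> < len \<rho> \<and> (\<forall>p\<in>X c. val \<rho> \<tau> p = t ! p)}"
            using \<tau> by auto
        qed
      qed auto
      ultimately show ?thesis using \<rho>(3) by simp
    qed
    then show "(\<Prod>p\<in>Y c - X c. 2 ^ f (ix p)) \<le> NN c" using pf[OF Ik] YI by simp
  qed
  \<comment> \<open>The search only tries powers up to \<open>IN\<close>; these exponents are within
    its range because each power is at most a degree \<open>d0\<close>.\<close>
  moreover have "2 ^ f (ix p) \<le> IN" if "p < k" for p
  proof -
    obtain i where i: "i < k" "sg ! i = p" using srj[of p] \<open>p < k\<close> by auto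
    have "2 ^ f i * 1 \<le> 2 ^ f i * d1 (ch i) t"
      using degs(1)[OF t, of "ch i"] ch[OF i(1)] by (intro mult_left_mono) auto
    also have "\<dots> \<le> d0 (ch i) t" by (rule f(1)[OF i(1)])
    also have "\<dots> \<le> IN" using ch[OF i(1)] by (intro d0_le) simp
    finally show ?thesis using i ix by auto
  qed
  ultimately have "2 ^ k * (\<Prod>p<k. 2 ^ f (ix p)) \<le> B" using B by (simp add: bound_ok_def)
  moreover have "(\<Prod>p<k. 2 ^ f (ix p)) = (\<Prod>i<k. 2 ^ f i :: nat)"
    using pf[of "{..<k}"] bij by (simp add: bij_betw_def)
  ultimately have low: "2 ^ k * (\<Prod>i<k. 2 ^ f i) \<le> B" by simp
  \<comment> \<open>Rounding loses at most a factor 2 per level. So \<open>P / Q\<close> is at most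
    \<open>2 ^ k\<close> times the product of the powers of two, and hence at most
    \<open>B\<close>.\<close>
  have "i \<le> k \<Longrightarrow> Pn c t i \<le> 2 ^ i * (\<Prod>j<i. 2 ^ f j) * Qn c t i" for i
  proof (induction i)
    case (Suc i)
    then have "Pn c t i * d0 (ch i) t \<le> (2 ^ i * (\<Prod>j<i. 2 ^ f j) * Qn c t i) * (2 * 2 ^ f i * d1 (ch i) t)"
      using f(2)[of i] by (intro mult_mono) auto
    then show ?case using Suc.prems nth_c[of i] by (simp add: algebra_simps)
  qed simp
  from this[of k] have "Pn c t k \<le> (2 ^ k * (\<Prod>i<k. 2 ^ f i)) * Qn c t k" by simp
  also have "\<dots> \<le> B * Qn c t k" using low by (rule mult_right_mono) simp
  finally show ?thesis using c by (auto simp: good_def)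
qed

end

section \<open>The polymatroid bound\<close>

definition feasible_polymatroids ::
  "attribute set \<Rightarrow> degree_constraint set \<Rightarrow> (attribute set \<Rightarrow> real) set" where
  "feasible_polymatroids S DC =
     {h. polymatroid S h \<and> (\<forall>(X, Y, N)\<in>DC. h Y - h X \<le> log 2 (real N))}"

lemma finite_join_schema: "is_join Q \<Longrightarrow> finite (join_schema Q)"
  by (auto simp: is_join_def is_relation_def join_schema_def)

text \<open>Subadditivity: submodularity with the nonnegative value of the intersection
  dropped.\<close>

lemma polymatroid_Union_le:
  assumes h: "polymatroid S h" and Q: "\<And>R. R \<in> set Q \<Longrightarrow> schema R \<subseteq> S"
  shows "h (\<Union>R\<in>set Q. schema R) \<le> (\<Sum>R\<leftarrow>Q. h (schema R))"
  using Q
proof (induction Q)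
  case Nil
  then show ?case using h by (simp add: polymatroid_def)
next
  case (Cons R Q)
  have sub: "schema R \<subseteq> S" "(\<Union>R\<in>set Q. schema R) \<subseteq> S" using Cons.prems by auto
  have "schema R \<inter> (\<Union>R\<in>set Q. schema R) \<subseteq> S" using sub by auto
  then have "0 \<le> h (schema R \<inter> (\<Union>R\<in>set Q. schema R))" using h unfolding polymatroid_def by blast
  moreover have "h (schema R \<union> (\<Union>R\<in>set Q. schema R)) + h (schema R \<inter> (\<Union>R\<in>set Q. schema R)) \<le>
      h (schema R) + h (\<Union>R\<in>set Q. schema R)"
    using h sub unfolding polymatroid_def by blast
  moreover have "h (\<Union>R\<in>set Q. schema R) \<le> (\<Sum>R\<leftarrow>Q. h (schema R))" using Cons by simp
  ultimately show ?case by simp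
qed

text \<open>The supremum in \<open>polymat\<close> tells something about its members only if it is
  taken over a bounded set. The cardinality constraints bound \<open>h\<close> on every schema, and
  the schemas cover all attributes.\<close>

lemma bdd_above_polymatroids:
  assumes "degree_constraints Q DC"
  shows "bdd_above ((\<lambda>h. h (join_schema Q)) ` feasible_polymatroids (join_schema Q) DC)"
proof -
  define N where "N R = (MIN R'\<in>{R'\<in>set Q. schema R' = schema R}. card (tuples R'))" for R
  have "h (join_schema Q) \<le> (\<Sum>R\<leftarrow>Q. log 2 (real (N R)))"
    if h: "h \<in> feasible_polymatroids (join_schema Q) DC" for h
  proof -
    have p: "polymatroid (join_schema Q) h" using h by (simp add: feasible_polymatroids_def)
    have "h (join_schema Q) \<le> (\<Sum>R\<leftarrow>Q. h (schema R))"
      unfolding join_schema_def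
      by (rule polymatroid_Union_le[OF p[unfolded join_schema_def]]) auto
    also have "\<dots> \<le> (\<Sum>R\<leftarrow>Q. log 2 (real (N R)))"
    proof (rule sum_list_mono)
      fix R assume R: "R \<in> set Q"
      then have "({}, schema R, N R) \<in> DC" using assms by (simp add: degree_constraints_def N_def)
      then have "h (schema R) - h {} \<le> log 2 (real (N R))"
        using h by (auto simp: feasible_polymatroids_def)
      then show "h (schema R) \<le> log 2 (real (N R))" using p by (simp add: polymatroid_def)
    qed
    finally show ?thesis .
  qed
  then show ?thesis by (rule bdd_aboveI2)
qed

text \<open>The exponents are the values on single attributes of a modular function. It is a
  polymatroid with \<open>h Y - h X = h (Y - X)\<close>, so the assumption is its admissibility in
  multiplicative form.\<close>

lemma polymat_ge:
  fixes f :: "attribute \<Rightarrow> nat"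
  assumes Q: "is_join Q" and DC: "degree_constraints Q DC"
    and f: "\<And>X Y N. (X, Y, N) \<in> DC \<Longrightarrow> (\<Prod>A\<in>Y - X. 2 ^ f A) \<le> N"
  shows "(\<Prod>A\<in>join_schema Q. 2 ^ f A) \<le> polymat (join_schema Q) DC"
proof -
  define h where "h Z = (\<Sum>A\<in>Z. real (f A))" for Z
  have fin: "finite (join_schema Q)" by (rule finite_join_schema[OF Q])
  have prod: "2 powr h Z = (\<Prod>A\<in>Z. 2 ^ f A)" if "finite Z" for Z
    using that by (induction Z) (auto simp: h_def powr_add powr_realpow)
  have "polymatroid (join_schema Q) h"
    unfolding polymatroid_def
  proof (intro conjI allI impI)
    show "h {} = 0" by (simp add: h_def)
    show "h Z \<ge> 0" for Z by (simp add: h_def sum_nonneg)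
    fix Z Z' assume "Z \<subseteq> Z' \<and> Z' \<subseteq> join_schema Q"
    then show "h Z \<le> h Z'" unfolding h_def
      using fin by (intro sum_mono2) (auto intro: finite_subset)
  next
    fix Z Z' assume "Z \<subseteq> join_schema Q \<and> Z' \<subseteq> join_schema Q"
    then show "h (Z \<union> Z') + h (Z \<inter> Z') \<le> h Z + h Z'" unfolding h_def
      using fin by (subst sum.union_inter) (auto intro: finite_subset)
  qed
  moreover have "h Y - h X \<le> log 2 (real N)" if c: "(X, Y, N) \<in> DC" for X Y N
  proof -
    have "X \<subset> Y \<and> Y \<subseteq> join_schema Q \<and> N \<ge> 1"
      using DC c unfolding degree_constraints_def by blast
    then have XY: "X \<subseteq> Y" "finite Y" "1 \<le> N" using fin finite_subset by auto
    then have "h Y - h X = h (Y - X)" by (simp add: h_def sum_diff finite_subset)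
    moreover have "2 powr h (Y - X) \<le> real N"
    proof -
      have "real (\<Prod>A\<in>Y - X. 2 ^ f A) \<le> real N" using f[OF c] by (simp only: of_nat_le_iff)
      then show ?thesis using XY by (simp add: prod)
    qed
    then have "h (Y - X) \<le> log 2 (real N)" using XY(3) by (simp add: le_log_iff)
    ultimately show ?thesis by simp
  qed
  ultimately have "h \<in> feasible_polymatroids (join_schema Q) DC"
    by (auto simp: feasible_polymatroids_def)
  then have "h (join_schema Q) \<le> (SUP h\<in>feasible_polymatroids (join_schema Q) DC. h (join_schema Q))"
    by (rule cSUP_upper[OF _ bdd_above_polymatroids[OF DC]])
  then have "2 powr h (join_schema Q) \<le> polymat (join_schema Q) DC"
    unfolding polymat_def feasible_polymatroids_def by simp
  then show ?thesis using prod[OF fin] by simp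
qed

lemma polymat_ge_1: "is_join Q \<Longrightarrow> degree_constraints Q DC \<Longrightarrow> 1 \<le> polymat (join_schema Q) DC"
  using polymat_ge[of Q DC "\<lambda>_. 0"] by (fastforce simp: degree_constraints_def)


section \<open>Topological orders\<close>

text \<open>Some vertex of a finite acyclic graph has no predecessor; it is put first.\<close>

lemma topological_order_exists:
  assumes "finite A" "acyclic r"
  shows "\<exists>xs. distinct xs \<and> set xs = A \<and>
    (\<forall>a<length xs. \<forall>b<length xs. (xs ! a, xs ! b) \<in> r \<longrightarrow> a < b)"
  using assms(1)
proof (induction "card A" arbitrary: A)
  case 0
  then show ?case by (intro exI[of _ "[]"]) auto
next
  case (Suc n)
  have "acyclic (r \<inter> A \<times> A)" using assms(2) by (rule acyclic_subset) auto
  moreover have "finite (r \<inter> A \<times> A)" using Suc.prems by auto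
  ultimately have "wf (r \<inter> A \<times> A)" by (intro finite_acyclic_wf)
  moreover obtain x where "x \<in> A" using Suc.hyps(2) by fastforce
  ultimately obtain z where z: "z \<in> A" "\<And>y. (y, z) \<in> r \<inter> A \<times> A \<Longrightarrow> y \<notin> A"
    using wfE_min[of "r \<inter> A \<times> A" x A] by metis
  have "n = card (A - {z})" using Suc.hyps(2) z(1) Suc.prems by simp
  from Suc.hyps(1)[OF this] Suc.prems obtain xs where
    xs: "distinct xs" "set xs = A - {z}"
      "\<forall>a<length xs. \<forall>b<length xs. (xs ! a, xs ! b) \<in> r \<longrightarrow> a < b" by auto
  have no: "(y, z) \<notin> r" if "y \<in> A" for y using z that by blast
  have "a < b" if "a < length (z # xs)" "b < length (z # xs)" "((z # xs) ! a, (z # xs) ! b) \<in> r" for a b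
  proof (cases b)
    case 0
    have "set (z # xs) = A" using xs(2) z(1) by auto
    then have "(z # xs) ! a \<in> A" using nth_mem[OF that(1)] by (simp only:)
    then show ?thesis using no[of "(z # xs) ! a"] that(3) 0 by simp
  next
    case (Suc b')
    then show ?thesis using that xs(3) by (cases a) auto
  qed
  moreover have "distinct (z # xs)" "set (z # xs) = A" using xs z(1) by auto
  ultimately show ?case by blast
qed

lemma acyclic_inv_image: "acyclic r \<Longrightarrow> acyclic (inv_image r f)"
proof -
  have "(x, y) \<in> (inv_image r f)\<^sup>+ \<Longrightarrow> (f x, f y) \<in> r\<^sup>+" for x y
    by (induction rule: trancl_induct) (auto intro: trancl_into_trancl)
  then show "acyclic r \<Longrightarrow> acyclic (inv_image r f)" by (auto simp: acyclic_def)
qed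


section \<open>Dispatching on the shape of the input\<close>

fun dispatch :: "(expr \<times> program) list \<Rightarrow> program" where
  "dispatch [] = []"
| "dispatch ((e, P) # bs) = [If e P (dispatch bs)]"

text \<open>Several tests may succeed if they lead to the same program, since the list of shapes may
  contain repetitions.\<close>

lemma dispatch_steps:
  assumes "(e, P) \<in> set bs" "eval W s e \<noteq> 0"
    and "\<And>e' P'. (e', P') \<in> set bs \<Longrightarrow> eval W s e' \<noteq> 0 \<Longrightarrow> P' = P"
  shows "\<exists>n\<le>length bs. steps W n (dispatch bs, s) = return_pmf (P, s)"
  using assms
proof (induction bs)
  case (Cons b bs)
  obtain e' P' where b: "b = (e', P')" by force
  show ?case
  proof (cases "eval W s e' = 0")
    case True
    then have "(e, P) \<in> set bs" using Cons.prems(1,2) b by auto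
    then obtain n where n: "n \<le> length bs" "steps W n (dispatch bs, s) = return_pmf (P, s)"
      using Cons by (metis list.set_intros(2))
    then have "steps W (Suc n) (dispatch (b # bs), s) = return_pmf (P, s)"
      unfolding steps_Suc_left using True b by (simp add: bind_return_pmf)
    then show ?thesis using n(1) by (intro exI[of _ "Suc n"]) simp
  next
    case False
    then have "P' = P" using Cons.prems(3) b by auto
    then have "steps W 1 (dispatch (b # bs), s) = return_pmf (P, s)"
      using False b by (simp add: One_nat_def bind_return_pmf)
    then show ?thesis by (intro exI[of _ 1]) simp
  qed
qed simp


section \<open>Sessions\<close>

lemma replicate_pmf_snoc:
  "replicate_pmf (Suc t) p = bind_pmf (replicate_pmf t p) (\<lambda>os. map_pmf (\<lambda>x. os @ [x]) p)"
  using replicate_pmf_distrib[of t 1 p]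
  by (simp add: One_nat_def bind_return_pmf bind_assoc_pmf map_pmf_def)

text \<open>From any state with \<open>Inv\<close>, the next outcome has the law
  \<open>sample_law\<close>, whatever happened before, and \<open>Inv\<close> persists. Hence the
  joint law is a product.\<close>

lemma session_laws:
  assumes build: "run W bd s0 = return_spmf s1" "Inv s1"
    and law: "\<And>s. Inv s \<Longrightarrow> map_spmf (outcome Q) (run W sp s) = spmf_of_pmf (sample_law Q)"
    and Inv: "\<And>s s'. Inv s \<Longrightarrow> s' \<in> set_spmf (run W sp s) \<Longrightarrow> Inv s'"
    and time: "\<And>s. Inv s \<Longrightarrow> expected_time W sp s \<le> V"
  shows "samples_independently W Q bd sp s0" "expected_sample_time W Q bd sp s0 t \<le> V"
proof -
  have supp: "\<forall>x\<in>set_spmf (session W Q bd sp s0 t). Inv (snd x)" for t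
  proof (induction t)
    case 0
    then show ?case using build by simp
  next
    case (Suc t)
    then show ?case using Inv by (fastforce simp: set_bind_spmf)
  qed
  show "samples_independently W Q bd sp s0"
    unfolding samples_independently_def
  proof
    fix t
    show "map_spmf fst (session W Q bd sp s0 t) = spmf_of_pmf (replicate_pmf t (sample_law Q))"
    proof (induction t)
      case 0
      then show ?case using build by simp
    next
      case (Suc t)
      have "map_spmf fst (session W Q bd sp s0 (Suc t)) =
        bind_spmf (session W Q bd sp s0 t) (\<lambda>x. map_spmf (\<lambda>o'. fst x @ [o']) (map_spmf (outcome Q) (run W sp (snd x))))"
        by (simp add: map_spmf_bind_spmf o_def split_beta spmf.map_comp)
      also have "\<dots> = bind_spmf (session W Q bd sp s0 t)
          (\<lambda>x. map_spmf (\<lambda>o'. fst x @ [o']) (spmf_of_pmf (sample_law Q)))"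
        using supp[of t] law by (intro bind_spmf_cong refl) auto
      also have "\<dots> = bind_spmf (map_spmf fst (session W Q bd sp s0 t))
          (\<lambda>os. map_spmf (\<lambda>o'. os @ [o']) (spmf_of_pmf (sample_law Q)))"
        by (simp add: bind_map_spmf o_def)
      also have "\<dots> = spmf_of_pmf (replicate_pmf (Suc t) (sample_law Q))"
        unfolding Suc.IH replicate_pmf_snoc
        by (simp add: spmf_of_pmf_bind map_spmf_of_pmf)
      finally show ?case .
    qed
  qed
  have "expected_sample_time W Q bd sp s0 t \<le> (\<integral>\<^sup>+ x. V \<partial>measure_spmf (session W Q bd sp s0 t))"
    unfolding expected_sample_time_def using supp[of t] time by (intro nn_integral_mono_AE) auto
  also have "\<dots> = V * emeasure (measure_spmf (session W Q bd sp s0 t)) (space (measure_spmf (session W Q bd sp s0 t)))"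
    by simp
  also have "\<dots> \<le> V * 1"
    by (intro mult_left_mono subprob_space.emeasure_space_le_1 subprob_space_measure_spmf) simp
  finally show "expected_sample_time W Q bd sp s0 t \<le> V" by simp
qed

section \<open>Reading the encoded query\<close>

definition positions :: "join_query \<Rightarrow> attribute set \<Rightarrow> nat set" where
  "positions Q Z = {p. p < length (attributes Q) \<and> attributes Q ! p \<in> Z}"

text \<open>What a program may be specialised to. The bounds and the tuples are left out, which is
  why there are only finitely many shapes for given m and k.\<close>

definition shape_of ::
  "join_query \<Rightarrow> degree_constraint list \<Rightarrow> (nat set \<times> nat set) list \<times> nat set list" where
  "shape_of Q cs = (map (\<lambda>(X, Y, N). (positions Q X, positions Q Y)) cs,
     map (\<lambda>R. positions Q (schema R)) Q)"

lemma nth_concat_take: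
  assumes "i < length xss" "j < length (xss ! i)"
  shows "concat xss ! (length (concat (take i xss)) + j) = xss ! i ! j"
    "length (concat (take i xss)) + j < length (concat xss)"
proof -
  have "concat xss = concat (take i xss @ xss ! i # drop (Suc i) xss)"
    using id_take_nth_drop[OF assms(1)] by simp
  then have e: "concat xss = concat (take i xss) @ (xss ! i) @ concat (drop (Suc i) xss)" by simp
  show "concat xss ! (length (concat (take i xss)) + j) = xss ! i ! j"
    unfolding e using assms(2) by (simp add: nth_append)
  show "length (concat (take i xss)) + j < length (concat xss)"
    unfolding e using assms(2) by simp
qed

lemma length_concat_take_uniform:
  assumes "\<And>ys. ys \<in> set xss \<Longrightarrow> length ys = l" "i \<le> length xss"
  shows "length (concat (take i xss)) = i * l"
  using assms(2)
proof (induction i)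
  case (Suc i)
  then show ?case using assms(1)[of "xss ! i"] by (simp add: take_Suc_conv_app_nth)
qed simp

text \<open>One input together with the orders \<open>cs\<close> and \<open>uss\<close> in which its
  constraints and tuples are written to memory. The query has a relation; the empty query is dealt
  with in \<open>empty_query\<close>.\<close>

locale problem =
  fixes m k w W :: nat and Q :: join_query and DC :: "degree_constraint set"
    and cs :: "degree_constraint list" and uss :: "tuple list list"
  assumes Q: "is_join Q" "length Q = m" "card (join_schema Q) = k"
    and DC: "degree_constraints Q DC" and cons: "consistent Q DC" and fits: "fits_word w Q DC"
    and cs: "distinct cs" "set cs = DC"
    and uss: "list_all2 (\<lambda>R us. distinct us \<and> set us = tuples R) Q uss"
    and m: "0 < m" and wW: "w \<le> W" and cs_small: "length cs < 2 ^ W"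
begin

definition ats where "ats = attributes Q"

definition nc where "nc = length cs"
definition cX where "cX c = fst (fst (shape_of Q cs) ! c)"
definition cY where "cY c = snd (fst (shape_of Q cs) ! c)"
definition rS where "rS \<rho> = snd (shape_of Q cs) ! \<rho>"
definition bnd :: "nat \<Rightarrow> nat" where "bnd c = snd (snd (cs ! c))"
definition len where "len \<rho> = length (uss ! \<rho>)"
definition val :: "nat \<Rightarrow> nat \<Rightarrow> nat \<Rightarrow> nat" where
  "val \<rho> \<tau> p = (case (uss ! \<rho> ! \<tau>) (ats ! p) of None \<Rightarrow> 0 | Some x \<Rightarrow> x)"
definition rels :: "nat list list" where "rels = map2 (encode_relation ats) Q uss"
definition xs where "xs = length cs # concat (map (encode_constraint ats) cs) @ concat rels"
definition M where "M = mem (initial W xs)"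
definition base where "base \<rho> = 1 + nc * (2 * k + 1) + length (concat (take \<rho> rels))"

lemma ats: "distinct ats" "set ats = join_schema Q" "length ats = k"
  using finite_join_schema[OF Q(1)] Q(3) by (auto simp: ats_def attributes_def)

lemma pos_iff: "p \<in> positions Q Z \<longleftrightarrow> p < k \<and> ats ! p \<in> Z"
  using ats(3) by (simp add: positions_def ats_def)

lemma sets:
  "c < nc \<Longrightarrow> cX c = positions Q (fst (cs ! c))"
  "c < nc \<Longrightarrow> cY c = positions Q (fst (snd (cs ! c)))"
  "\<rho> < m \<Longrightarrow> rS \<rho> = positions Q (schema (Q ! \<rho>))"
  using Q(2) by (auto simp: cX_def cY_def rS_def shape_of_def nc_def split_beta)

lemma cs_DC: "c < nc \<Longrightarrow> (fst (cs ! c), fst (snd (cs ! c)), bnd c) \<in> DC"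
  using cs(2) by (auto simp: nc_def bnd_def)

lemma constraint: "c < nc \<Longrightarrow> fst (cs ! c) \<subset> fst (snd (cs ! c)) \<and>
    fst (snd (cs ! c)) \<subseteq> join_schema Q \<and> 1 \<le> bnd c \<and> bnd c < 2 ^ w"
  using bspec[OF conjunct1[OF DC[unfolded degree_constraints_def]] cs_DC[of c]]
    bspec[OF conjunct2[OF conjunct2[OF conjunct2[OF fits[unfolded fits_word_def]]]] cs_DC[of c]]
  by simp

lemma w1: "1 \<le> w" using fits by (simp add: fits_word_def)

lemma pow_le: "(2::nat) ^ w \<le> 2 ^ W" using wW by (intro power_increasing) auto

lemma relation: "\<rho> < m \<Longrightarrow> length uss = m \<and> distinct (uss ! \<rho>) \<and> set (uss ! \<rho>) = tuples (Q ! \<rho>) \<and>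
    Q ! \<rho> \<in> set Q \<and> is_relation (Q ! \<rho>) \<and> schema (Q ! \<rho>) \<subseteq> join_schema Q"
proof -
  assume r: "\<rho> < m"
  have R: "Q ! \<rho> \<in> set Q" using r Q(2) by simp
  then have "is_relation (Q ! \<rho>)" "schema (Q ! \<rho>) \<subseteq> join_schema Q"
    using Q(1) by (auto simp: is_join_def join_schema_def)
  then show ?thesis
    using R r Q(2) list_all2_lengthD[OF uss] list_all2_nthD[OF uss, of \<rho>] by simp
qed

lemma tuple:
  assumes "\<rho> < m" "\<tau> < len \<rho>"
  shows "uss ! \<rho> ! \<tau> \<in> tuples (Q ! \<rho>)" "dom (uss ! \<rho> ! \<tau>) = schema (Q ! \<rho>)"
proof -
  show t: "uss ! \<rho> ! \<tau> \<in> tuples (Q ! \<rho>)"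
    using relation[OF assms(1)] nth_mem[of \<tau> "uss ! \<rho>"] assms(2) by (auto simp: len_def)
  then show "dom (uss ! \<rho> ! \<tau>) = schema (Q ! \<rho>)"
    using relation[OF assms(1)] by (auto simp: is_relation_def)
qed

lemma val_eq: "\<rho> < m \<Longrightarrow> \<tau> < len \<rho> \<Longrightarrow> p \<in> rS \<rho> \<Longrightarrow> (uss ! \<rho> ! \<tau>) (ats ! p) = Some (val \<rho> \<tau> p)"
  using tuple(2)[of \<rho> \<tau>] by (auto simp: sets pos_iff val_def dom_def split: option.splits)

lemma val_small: "\<rho> < m \<Longrightarrow> \<tau> < len \<rho> \<Longrightarrow> val \<rho> \<tau> p < 2 ^ w"
proof -
  assume r: "\<rho> < m" and \<tau>: "\<tau> < len \<rho>"
  have "\<forall>x\<in>ran (uss ! \<rho> ! \<tau>). x < 2 ^ w"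
    using fits tuple(1)[OF r \<tau>] relation[OF r] unfolding fits_word_def by blast
  then show ?thesis by (auto simp: val_def ranI split: option.splits)
qed

lemma sum_len: "(\<Sum>\<rho><m. len \<rho>) = input_size Q"
proof -
  have "input_size Q = (\<Sum>\<rho><m. card (tuples (Q ! \<rho>)))"
    unfolding input_size_def using Q(2) by (simp add: sum_list_sum_nth atLeast0LessThan)
  also have "\<dots> = (\<Sum>\<rho><m. len \<rho>)"
    using relation distinct_card by (intro sum.cong) (fastforce simp: len_def)+
  finally show ?thesis by simp
qed

text \<open>Bounds of constraints are at least 1, so the cardinality constraints exclude empty
  relations.\<close>

lemma IN: "input_size Q < 2 ^ w" "1 \<le> input_size Q"
proof -
  show "input_size Q < 2 ^ w" using fits by (simp add: fits_word_def)
  have R: "Q ! 0 \<in> set Q" using Q(2) m by simp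
  define N where "N = (MIN R'\<in>{R'\<in>set Q. schema R' = schema (Q ! 0)}. card (tuples R'))"
  have "({}, schema (Q ! 0), N) \<in> DC" using DC R by (auto simp: degree_constraints_def N_def)
  then have "1 \<le> N" using DC by (auto simp: degree_constraints_def)
  also have "N \<le> card (tuples (Q ! 0))" unfolding N_def using R by (intro Min_le) auto
  also have "\<dots> = len 0" using relation[OF m] distinct_card[of "uss ! 0"] by (simp add: len_def)
  also have "\<dots> \<le> (\<Sum>\<rho><m. len \<rho>)" using m by (intro member_le_sum) auto
  finally show "1 \<le> input_size Q" by (simp add: sum_len)
qed

lemma len_enc: "length (encode_set ats Z) = k" "length (encode_tuple ats u) = k"
  "length (encode_constraint ats c) = 2 * k + 1"
  using ats(3) by (auto simp: encode_set_def encode_tuple_def encode_constraint_def split: prod.splits)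

lemma rels_nth: "\<rho> < m \<Longrightarrow> rels ! \<rho> = encode_relation ats (Q ! \<rho>) (uss ! \<rho>)"
  using relation[of \<rho>] Q(2) by (simp add: rels_def)

lemma len_rels: "length rels = m"
  using relation[OF m] Q(2) by (simp add: rels_def)

lemma len_rel: "\<rho> < m \<Longrightarrow> length (rels ! \<rho>) = k + 1 + len \<rho> * k"
proof -
  assume r: "\<rho> < m"
  have "length (concat (map (encode_tuple ats) us)) = length us * k" for us
    by (induction us) (auto simp: len_enc)
  then show ?thesis by (simp add: rels_nth[OF r] encode_relation_def len_enc len_def)
qed

lemma base_Suc: "\<rho> < m \<Longrightarrow> base (Suc \<rho>) = base \<rho> + (k + 1) + len \<rho> * k"
  using len_rels len_rel[of \<rho>] by (simp add: base_def take_Suc_conv_app_nth)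

lemma len_cenc: "length (concat (map (encode_constraint ats) cs)) = nc * (2 * k + 1)"
proof -
  have "length (concat (take nc (map (encode_constraint ats) cs))) = nc * (2 * k + 1)"
    by (rule length_concat_take_uniform) (auto simp: len_enc nc_def)
  then show ?thesis by (simp add: nc_def)
qed

lemma M_small: "a < length xs \<Longrightarrow> xs ! a < 2 ^ W \<Longrightarrow> M a = xs ! a"
  by (simp add: M_def initial_def)

lemma M_0: "M 0 = nc"
  using cs_small by (subst M_small) (auto simp: xs_def nc_def)

lemma M_constraint:
  assumes "c < nc" "j < 2 * k + 1" "encode_constraint ats (cs ! c) ! j < 2 ^ W"
  shows "M (1 + c * (2 * k + 1) + j) = encode_constraint ats (cs ! c) ! j"
proof -
  have l: "length (concat (take c (map (encode_constraint ats) cs))) = c * (2 * k + 1)"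
    using assms(1) by (intro length_concat_take_uniform) (auto simp: len_enc nc_def)
  note n = nth_concat_take[of c "map (encode_constraint ats) cs" j, unfolded l]
  have 1: "concat (map (encode_constraint ats) cs) ! (c * (2 * k + 1) + j) = encode_constraint ats (cs ! c) ! j"
    "c * (2 * k + 1) + j < length (concat (map (encode_constraint ats) cs))"
    using n assms by (auto simp: len_enc nc_def)
  have 2: "1 + c * (2 * k + 1) + j = Suc (c * (2 * k + 1) + j)" by simp
  have "xs ! (1 + c * (2 * k + 1) + j) = encode_constraint ats (cs ! c) ! j"
    unfolding xs_def 2 nth_Cons_Suc using 1 by (subst nth_append) simp
  moreover have "1 + c * (2 * k + 1) + j < length xs"
    unfolding xs_def 2 using 1(2) by simp
  ultimately show ?thesis using assms(3) by (simp add: M_small)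
qed

lemma M_relation:
  assumes "\<rho> < m" "j < length (rels ! \<rho>)" "rels ! \<rho> ! j < 2 ^ W"
  shows "M (base \<rho> + j) = rels ! \<rho> ! j"
proof -
  note n = nth_concat_take[of \<rho> rels j]
  have 1: "concat rels ! (length (concat (take \<rho> rels)) + j) = rels ! \<rho> ! j"
    "length (concat (take \<rho> rels)) + j < length (concat rels)"
    using n assms len_rels by auto
  have 2: "base \<rho> + j = Suc (length (concat (map (encode_constraint ats) cs)) + (length (concat (take \<rho> rels)) + j))"
    unfolding base_def len_cenc by simp
  have "xs ! (base \<rho> + j) = rels ! \<rho> ! j"
    unfolding xs_def 2 nth_Cons_Suc using 1 by (simp only: nth_append_length_plus)
  moreover have "base \<rho> + j < length xs"
    unfolding xs_def 2 using 1(2) by simp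
  ultimately show ?thesis using assms(3) by (simp add: M_small)
qed

lemma M_bnd: "c < nc \<Longrightarrow> M (1 + c * (2 * k + 1) + 2 * k) = bnd c"
proof -
  assume c: "c < nc"
  have "encode_constraint ats (cs ! c) ! (2 * k) = bnd c"
    using ats(3) by (simp add: encode_constraint_def bnd_def encode_set_def nth_append split_beta)
  then show ?thesis using M_constraint[OF c, of "2 * k"] constraint[OF c] pow_le by simp
qed

lemma W1: "1 < (2::nat) ^ W"
  using w1 wW by (intro one_less_power) auto

lemma M_flag: "c < nc \<Longrightarrow> p < k \<Longrightarrow> M (1 + c * (2 * k + 1) + p) = of_bool (p \<in> cX c)"
  "c < nc \<Longrightarrow> p < k \<Longrightarrow> M (1 + c * (2 * k + 1) + (k + p)) = of_bool (p \<in> cY c)"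
proof -
  assume c: "c < nc" and p: "p < k"
  have "encode_constraint ats (cs ! c) ! p = of_bool (p \<in> cX c)"
    using ats(3) p c by (simp add: encode_constraint_def encode_set_def nth_append split_beta sets pos_iff)
  then show "M (1 + c * (2 * k + 1) + p) = of_bool (p \<in> cX c)"
    using M_constraint[OF c, of p] p W1 by simp
  have "encode_constraint ats (cs ! c) ! (k + p) = of_bool (p \<in> cY c)"
    using ats(3) p c by (simp add: encode_constraint_def encode_set_def nth_append split_beta sets pos_iff)
  then show "M (1 + c * (2 * k + 1) + (k + p)) = of_bool (p \<in> cY c)"
    using M_constraint[OF c, of "k + p"] p W1 by simp
qed

lemma M_schema: "\<rho> < m \<Longrightarrow> p < k \<Longrightarrow> M (base \<rho> + p) = of_bool (p \<in> rS \<rho>)"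
proof -
  assume r: "\<rho> < m" and p: "p < k"
  have "rels ! \<rho> ! p = of_bool (p \<in> rS \<rho>)"
    using ats(3) p r by (simp add: rels_nth encode_relation_def encode_set_def nth_append sets pos_iff)
  then show ?thesis using M_relation[OF r, of p] p W1 len_rel[OF r] by simp
qed

lemma M_len: "\<rho> < m \<Longrightarrow> M (base \<rho> + k) = len \<rho>"
proof -
  assume r: "\<rho> < m"
  have "rels ! \<rho> ! k = len \<rho>"
    using r by (simp add: rels_nth encode_relation_def nth_append len_enc len_def)
  moreover have "len \<rho> < 2 ^ W"
  proof -
    have "len \<rho> \<le> (\<Sum>\<rho><m. len \<rho>)" using r by (intro member_le_sum) auto
    then show ?thesis unfolding sum_len using IN(1) pow_le by linarith
  qed
  ultimately show ?thesis using M_relation[OF r, of k] len_rel[OF r] by simp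
qed

lemma M_val: "\<rho> < m \<Longrightarrow> \<tau> < len \<rho> \<Longrightarrow> p < k \<Longrightarrow> M (base \<rho> + k + 1 + \<tau> * k + p) = val \<rho> \<tau> p"
proof -
  assume r: "\<rho> < m" and \<tau>: "\<tau> < len \<rho>" and p: "p < k"
  let ?ts = "map (encode_tuple ats) (uss ! \<rho>)"
  have l: "length (concat (take \<tau> ?ts)) = \<tau> * k"
    using \<tau> by (intro length_concat_take_uniform) (auto simp: len_enc len_def)
  note n = nth_concat_take[of \<tau> ?ts p, unfolded l]
  have 1: "concat ?ts ! (\<tau> * k + p) = encode_tuple ats (uss ! \<rho> ! \<tau>) ! p" "\<tau> * k + p < length (concat ?ts)"
    using n \<tau> p by (auto simp: len_enc len_def)
  have v: "encode_tuple ats (uss ! \<rho> ! \<tau>) ! p = val \<rho> \<tau> p"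
    using p ats(3) by (simp add: encode_tuple_def val_def)
  have a: "rels ! \<rho> ! (k + Suc (\<tau> * k + p)) = val \<rho> \<tau> p"
    unfolding rels_nth[OF r] encode_relation_def using 1(1) v
    by (simp add: nth_append len_enc)
  have b: "k + Suc (\<tau> * k + p) < length (rels ! \<rho>)"
    using 1(2) by (simp add: rels_nth[OF r] encode_relation_def len_enc)
  have "val \<rho> \<tau> p < 2 ^ W" using val_small[OF r \<tau>, of p] pow_le by linarith
  then have "M (base \<rho> + (k + Suc (\<tau> * k + p))) = val \<rho> \<tau> p"
    using M_relation[OF r b] unfolding a by simp
  moreover have "base \<rho> + (k + Suc (\<tau> * k + p)) = base \<rho> + k + 1 + \<tau> * k + p" by simp
  ultimately show ?thesis by (simp only:)
qed

lemma inst: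
  assumes "shape k m nc nG sg cX cY rS rel YY lev cl" "shape.C0 k m nc nG cl * w \<le> W"
  shows "inst k m nc nG sg cX cY rS rel YY lev cl w W len val bnd M base"
proof -
  interpret shape k m nc nG sg cX cY rS rel YY lev cl by fact
  show ?thesis
  proof
    show "base 0 = 1 + nc * (2 * k + 1)" by (simp add: base_def)
    show "(\<Sum>\<rho><m. len \<rho>) < 2 ^ w" "1 \<le> (\<Sum>\<rho><m. len \<rho>)" using IN by (simp_all add: sum_len)
  qed (use assms w1 base_Suc M_len M_val M_bnd constraint in auto)
qed

section \<open>The join as a set of lists of values\<close>

definition J :: "nat list set" where
  "J = {t. length t = k \<and> (\<forall>\<rho><m. \<exists>\<tau><len \<rho>. \<forall>p\<in>rS \<rho>. t ! p = val \<rho> \<tau> p)}"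

definition tup :: "nat list \<Rightarrow> tuple" where "tup t = map_of (zip ats t)"

lemma tup_nth: "length t = k \<Longrightarrow> p < k \<Longrightarrow> tup t (ats ! p) = Some (t ! p)"
  using map_of_zip_nth[of ats t p] ats by (simp add: tup_def)

lemma dom_tup: "length t = k \<Longrightarrow> dom (tup t) = join_schema Q"
  using ats by (simp add: tup_def)

lemma ats_nth: "A \<in> join_schema Q \<Longrightarrow> \<exists>p<k. ats ! p = A"
  using ats by (metis in_set_conv_nth)

lemma restrict_tup:
  assumes "length t = k" "\<rho> < m" "\<tau> < len \<rho>"
  shows "tup t |` schema (Q ! \<rho>) = uss ! \<rho> ! \<tau> \<longleftrightarrow> (\<forall>p\<in>rS \<rho>. t ! p = val \<rho> \<tau> p)"
proof
  assume e: "tup t |` schema (Q ! \<rho>) = uss ! \<rho> ! \<tau>"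
  show "\<forall>p\<in>rS \<rho>. t ! p = val \<rho> \<tau> p"
  proof
    fix p assume p: "p \<in> rS \<rho>"
    then have "p < k" "ats ! p \<in> schema (Q ! \<rho>)" using assms(2) by (auto simp: sets pos_iff)
    then have "(uss ! \<rho> ! \<tau>) (ats ! p) = Some (t ! p)"
      using tup_nth[OF assms(1)] by (simp flip: e)
    then show "t ! p = val \<rho> \<tau> p" using val_eq[OF assms(2,3) p] by simp
  qed
next
  assume a: "\<forall>p\<in>rS \<rho>. t ! p = val \<rho> \<tau> p"
  show "tup t |` schema (Q ! \<rho>) = uss ! \<rho> ! \<tau>"
  proof
    fix A
    show "(tup t |` schema (Q ! \<rho>)) A = (uss ! \<rho> ! \<tau>) A"
    proof (cases "A \<in> schema (Q ! \<rho>)")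
      case True
      then obtain p where p: "p < k" "ats ! p = A" using ats_nth relation[OF assms(2)] by blast
      then have "p \<in> rS \<rho>" using True assms(2) by (simp add: sets pos_iff)
      then show ?thesis using a val_eq[OF assms(2,3)] tup_nth[OF assms(1) p(1)] True p(2) by auto
    next
      case False
      then have "A \<notin> dom (uss ! \<rho> ! \<tau>)" using tuple(2)[OF assms(2,3)] by simp
      then show ?thesis using False by (simp add: domIff)
    qed
  qed
qed

lemma tup_join: "length t = k \<Longrightarrow> tup t \<in> join Q \<longleftrightarrow> t \<in> J"
proof -
  assume t: "length t = k"
  have "tup t |` schema (Q ! \<rho>) \<in> tuples (Q ! \<rho>) \<longleftrightarrow> (\<exists>\<tau><len \<rho>. \<forall>p\<in>rS \<rho>. t ! p = val \<rho> \<tau> p)"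
    if r: "\<rho> < m" for \<rho>
  proof -
    have "tup t |` schema (Q ! \<rho>) \<in> tuples (Q ! \<rho>) \<longleftrightarrow>
        (\<exists>\<tau><len \<rho>. tup t |` schema (Q ! \<rho>) = uss ! \<rho> ! \<tau>)"
      using relation[OF r] by (metis in_set_conv_nth len_def)
    then show ?thesis using restrict_tup[OF t r] by auto
  qed
  then show ?thesis
    using t dom_tup[OF t] Q(2) by (auto simp: join_def J_def set_conv_nth)
qed

lemma bij_tup: "bij_betw tup J (join Q)"
  unfolding bij_betw_def
proof
  show "inj_on tup J"
  proof (rule inj_onI)
    fix t t' assume a: "t \<in> J" "t' \<in> J" "tup t = tup t'"
    then have l: "length t = k" "length t' = k" by (auto simp: J_def)
    show "t = t'"
    proof (rule nth_equalityI)
      fix p assume "p < length t"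
      then show "t ! p = t' ! p" using tup_nth[OF l(1), of p] tup_nth[OF l(2), of p] a(3) l by simp
    qed (simp add: l)
  qed
  have "u \<in> tup ` J" if u: "u \<in> join Q" for u
  proof -
    define t where "t = map (\<lambda>A. the (u A)) ats"
    have l: "length t = k" using ats by (simp add: t_def)
    have du: "dom u = join_schema Q" using u by (simp add: join_def)
    have "tup t = u"
    proof
      fix A
      show "tup t A = u A"
      proof (cases "A \<in> join_schema Q")
        case True
        then obtain p where p: "p < k" "ats ! p = A" using ats_nth by blast
        have "u A \<noteq> None" using True du by auto
        then show ?thesis using tup_nth[OF l p(1)] p ats(3) by (auto simp: t_def)
      next
        case False
        then have "A \<notin> dom (tup t)" "A \<notin> dom u" using dom_tup[OF l] du by auto
        then show ?thesis by (simp add: domIff)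
      qed
    qed
    then show ?thesis using tup_join[OF l] u by auto
  qed
  moreover have "tup t \<in> join Q" if "t \<in> J" for t
    using that tup_join[of t] by (auto simp: J_def)
  ultimately show "tup ` J = join Q" by auto
qed

lemma cover: assumes "p < k" shows "\<exists>\<rho><m. p \<in> rS \<rho>"
proof -
  have "ats ! p \<in> join_schema Q" using ats assms nth_mem by metis
  then obtain R where "R \<in> set Q" "ats ! p \<in> schema R" by (auto simp: join_schema_def)
  then obtain \<rho> where "\<rho> < m" "ats ! p \<in> schema (Q ! \<rho>)" using Q(2) by (metis in_set_conv_nth)
  then show ?thesis using assms by (auto simp: sets pos_iff)
qed

lemma guard:
  assumes c: "c < nc" and t: "length t = k" and ys: "set ys = cY c"
  shows "\<exists>\<rho><m. cY c \<subseteq> rS \<rho> \<and>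
      card ((\<lambda>\<tau>. map (val \<rho> \<tau>) ys) ` {\<tau>. \<tau> < len \<rho> \<and> (\<forall>p\<in>cX c. val \<rho> \<tau> p = t ! p)}) \<le> bnd c"
proof -
  define X Y where "X = fst (cs ! c)" and "Y = fst (snd (cs ! c))"
  have XY: "X \<subset> Y" "Y \<subseteq> join_schema Q" using constraint[OF c] by (auto simp: X_def Y_def)
  obtain R where "R \<in> set Q" "guards R (X, Y, bnd c)"
    using cons cs_DC[OF c] by (auto simp: consistent_def X_def Y_def)
  then obtain \<rho> where r: "\<rho> < m" and R: "guards (Q ! \<rho>) (X, Y, bnd c)"
    using Q(2) by (metis in_set_conv_nth)
  have YS: "Y \<subseteq> schema (Q ! \<rho>)" using R by (simp add: guards_def)
  then have sub: "cY c \<subseteq> rS \<rho>" using c r by (auto simp: sets pos_iff Y_def)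
  define deg where "deg u = card {v |` Y | v. v \<in> tuples (Q ! \<rho>) \<and> v |` X = u}" for u
  have finT: "finite (tuples (Q ! \<rho>))" using relation[OF r] by (simp add: is_relation_def)
  have fimg: "finite {v |` Y | v. v \<in> tuples (Q ! \<rho>) \<and> v |` X = u}" for u
    using finT by (rule finite_subset[rotated, OF finite_imageI[of _ "\<lambda>v. v |` Y"]]) auto
  have deg_le: "deg u \<le> card (tuples (Q ! \<rho>))" for u
  proof -
    have "deg u \<le> card ((\<lambda>v. v |` Y) ` tuples (Q ! \<rho>))"
      unfolding deg_def using finT by (intro card_mono) auto
    also have "\<dots> \<le> card (tuples (Q ! \<rho>))" by (rule card_image_le[OF finT])
    finally show ?thesis .
  qed
  define u where "u = tup t |` X"
  have du: "dom u = X" using dom_tup[OF t] XY by (auto simp: u_def)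
  \<comment> \<open>The maximum in \<open>degree\<close> ranges over infinitely many
    \<open>u\<close>; it is a genuine maximum because no degree exceeds the size of the
    relation.\<close>
  have "deg ` {u. dom u = X} \<subseteq> {..card (tuples (Q ! \<rho>))}" using deg_le by blast
  then have "finite (deg ` {u. dom u = X})" by (rule finite_subset) simp
  moreover have "deg u \<in> deg ` {u. dom u = X}" using du by blast
  ultimately have "deg u \<le> Max (deg ` {u. dom u = X})" by (rule Max_ge)
  then have deg: "deg u \<le> bnd c" using R by (simp add: guards_def degree_def deg_def[abs_def])
  define f where "f v = map (\<lambda>p. case v (ats ! p) of None \<Rightarrow> 0 | Some x \<Rightarrow> x) ys" for v :: tuple
  have "(\<lambda>\<tau>. map (val \<rho> \<tau>) ys) ` {\<tau>. \<tau> < len \<rho> \<and> (\<forall>p\<in>cX c. val \<rho> \<tau> p = t ! p)} \<subseteq>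
      f ` {v |` Y | v. v \<in> tuples (Q ! \<rho>) \<and> v |` X = u}"
  proof
    fix y assume "y \<in> (\<lambda>\<tau>. map (val \<rho> \<tau>) ys) ` {\<tau>. \<tau> < len \<rho> \<and> (\<forall>p\<in>cX c. val \<rho> \<tau> p = t ! p)}"
    then obtain \<tau> where \<tau>: "y = map (val \<rho> \<tau>) ys" "\<tau> < len \<rho>" "\<And>p. p \<in> cX c \<Longrightarrow> val \<rho> \<tau> p = t ! p"
      by auto
    define v where "v = uss ! \<rho> ! \<tau>"
    have "v |` X = u"
    proof
      fix A
      show "(v |` X) A = u A"
      proof (cases "A \<in> X")
        case True
        then obtain p where p: "p < k" "ats ! p = A" using ats_nth XY by blast
        then have "p \<in> cX c" "p \<in> cY c" using True XY c by (auto simp: sets pos_iff X_def Y_def)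
        then have "v A = Some (t ! p)" using val_eq[OF r \<tau>(2), of p] sub \<tau>(3) p by (auto simp: v_def)
        then show ?thesis using True tup_nth[OF t p(1)] p(2) by (simp add: u_def)
      qed (simp add: u_def)
    qed
    moreover have "f (v |` Y) = y"
      using ys c unfolding f_def \<tau>(1) by (auto simp: sets pos_iff Y_def val_def v_def)
    moreover have "v \<in> tuples (Q ! \<rho>)" using tuple(1)[OF r \<tau>(2)] by (simp add: v_def)
    ultimately show "y \<in> f ` {v |` Y | v. v \<in> tuples (Q ! \<rho>) \<and> v |` X = u}" by blast
  qed
  then have "card ((\<lambda>\<tau>. map (val \<rho> \<tau>) ys) ` {\<tau>. \<tau> < len \<rho> \<and> (\<forall>p\<in>cX c. val \<rho> \<tau> p = t ! p)}) \<le>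
      card (f ` {v |` Y | v. v \<in> tuples (Q ! \<rho>) \<and> v |` X = u})"
    using fimg by (intro card_mono) auto
  also have "\<dots> \<le> deg u" unfolding deg_def by (rule card_image_le[OF fimg])
  finally show ?thesis using deg r sub by (intro exI[of _ \<rho>]) auto
qed

lemma polymat_ge_positions:
  assumes f: "\<And>c. c < nc \<Longrightarrow> (\<Prod>p\<in>cY c - cX c. 2 ^ f p) \<le> bnd c"
  shows "(\<Prod>p<k. 2 ^ f p) \<le> polymat (join_schema Q) DC"
proof -
  define ix where "ix A = (THE p. p < k \<and> ats ! p = A)" for A
  have ix: "ix (ats ! p) = p" if "p < k" for p
    unfolding ix_def using that ats by (auto simp: nth_eq_iff_index_eq intro!: the_equality)
  have re: "(\<Prod>A\<in>(!) ats ` P. 2 ^ f (ix A)) = (\<Prod>p\<in>P. 2 ^ f p :: nat)" if "P \<subseteq> {..<k}" for P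
  proof -
    have "inj_on ((!) ats) P" using that ats by (intro inj_on_nth) auto
    then show ?thesis using that by (auto simp: prod.reindex ix intro!: prod.cong)
  qed
  have "(\<Prod>A\<in>join_schema Q. 2 ^ f (ix A)) \<le> polymat (join_schema Q) DC"
  proof (rule polymat_ge[OF Q(1) DC])
    fix X Y N assume "(X, Y, N) \<in> DC"
    then obtain c where c: "c < nc" "cs ! c = (X, Y, N)" using cs(2) by (metis in_set_conv_nth nc_def)
    have "Y \<subseteq> join_schema Q" using constraint[OF c(1)] c(2) by simp
    then have "(!) ats ` (cY c - cX c) = Y - X"
      using c ats_nth by (fastforce simp: sets pos_iff image_iff)
    moreover have "cY c - cX c \<subseteq> {..<k}" using c by (auto simp: sets pos_iff)
    ultimately show "(\<Prod>A\<in>Y - X. 2 ^ f (ix A)) \<le> N"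
      using re[of "cY c - cX c"] f[OF c(1)] c(2) by (simp add: bnd_def)
  qed
  moreover have "(!) ats ` {..<k} = join_schema Q" using ats by (auto simp: set_conv_nth)
  moreover have "real (\<Prod>A\<in>(!) ats ` {..<k}. 2 ^ f (ix A)) = real (\<Prod>p<k. 2 ^ f p)"
    using re[of "{..<k}"] by simp
  ultimately show ?thesis by simp
qed

end

section \<open>Recognising the shape of an input\<close>

definition shapes :: "nat \<Rightarrow> nat \<Rightarrow> ((nat set \<times> nat set) list \<times> nat set list) set" where
  "shapes k m = {cs. set cs \<subseteq> Pow {..<k} \<times> Pow {..<k} \<and> length cs \<le> 2 ^ (2 * k)} \<times>
     {ss. set ss \<subseteq> Pow {..<k} \<and> length ss = m}"

lemma finite_shapes: "finite (shapes k m)"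
  unfolding shapes_def by (intro finite_cartesian_product finite_lists_length_le finite_lists_length_eq) auto

text \<open>A product with a factor 0 is 0 whatever the rest is. So if the number of constraints
  differs, the other factors may read memory at addresses that mean something else.\<close>

definition shape_test :: "nat \<Rightarrow> nat \<Rightarrow> (nat set \<times> nat set) list \<times> nat set list \<Rightarrow> expr" where
  "shape_test k m sh = Op Mul (Op Eq (Mem (Num 0)) (Num (length (fst sh))))
     (Op Mul
       (conj_expr (map (\<lambda>(c, p). Op Eq (Mem (Num (1 + c * (2 * k + 1) + p)))
          (Num (of_bool (p \<in> fst (fst sh ! c))))) (List.product [0..<length (fst sh)] [0..<k])))
     (Op Mul
       (conj_expr (map (\<lambda>(c, p). Op Eq (Mem (Num (1 + c * (2 * k + 1) + (k + p))))
          (Num (of_bool (p \<in> snd (fst sh ! c))))) (List.product [0..<length (fst sh)] [0..<k])))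
       (conj_expr (map (\<lambda>(\<rho>, p). Op Eq (Mem (Op Add (shape.baseE k (length (fst sh)) \<rho>) (Num p)))
          (Num (of_bool (p \<in> snd sh ! \<rho>)))) (List.product [0..<m] [0..<k])))))"

context problem
begin

lemma shape_in_shapes: "length cs \<le> 2 ^ (2 * k) \<Longrightarrow> shape_of Q cs \<in> shapes k m"
  using Q(2) by (auto simp: shapes_def shape_of_def pos_iff)

lemma static_exists:
  assumes "acyclic_constraints DC"
  shows "\<exists>sg nG rel YY lev cl. shape k m nc nG sg cX cY rS rel YY lev cl"
proof -
  let ?r = "inv_image (dependency_graph DC) ((!) ats)"
  have "acyclic ?r" using assms by (intro acyclic_inv_image) (simp add: acyclic_constraints_def)
  from topological_order_exists[OF _ this, of "{..<k}"] obtain sg where sg: "distinct sg" "set sg = {..<k}"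
    "\<And>a b. a < length sg \<Longrightarrow> b < length sg \<Longrightarrow> (sg ! a, sg ! b) \<in> ?r \<Longrightarrow> a < b" by auto
  have len_sg: "length sg = k" using distinct_card[OF sg(1)] sg(2) by simp
  define GS where "GS = {(\<rho>, Z, i). \<rho> < m \<and> Z \<subseteq> rS \<rho> \<and> i < k \<and> sg ! i \<in> Z}"
  have rSk: "rS \<rho> \<subseteq> {..<k}" if "\<rho> < m" for \<rho> using that by (auto simp: sets pos_iff)
  have "GS \<subseteq> {..<m} \<times> Pow {..<k} \<times> {..<k}" using rSk by (auto simp: GS_def)
  then have "finite GS" by (rule finite_subset) auto
  then obtain gl where gl: "set gl = GS" using finite_list by blast
  define rel YY lev where "rel g = fst (gl ! g)" and "YY g = fst (snd (gl ! g))" and "lev g = snd (snd (gl ! g))" for g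
  define CL where "CL = {c. length c = k \<and> (\<forall>i<k. c ! i < length gl \<and> lev (c ! i) = i)}"
  have "CL \<subseteq> {c. set c \<subseteq> {..<length gl} \<and> length c = k}"
    by (auto simp: CL_def set_conv_nth)
  then have "finite CL" by (rule finite_subset) (simp add: finite_lists_length_eq)
  then obtain cl where cl: "set cl = CL" using finite_list by blast
  have "shape k m nc (length gl) sg cX cY rS rel YY lev cl"
  proof
    show "distinct sg" "set sg = {..<k}" by fact+
    show "rS \<rho> \<subseteq> {..<k} \<and> rS \<rho> \<noteq> {}" if r: "\<rho> < m" for \<rho>
    proof -
      \<comment> \<open>Constraints have X properly inside Y; for a cardinality constraint this
        means that the schema is nonempty.\<close>
      define N where "N = (MIN R'\<in>{R'\<in>set Q. schema R' = schema (Q ! \<rho>)}. card (tuples R'))"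
      have "({}, schema (Q ! \<rho>), N) \<in> DC"
        using DC relation[OF r] by (auto simp: degree_constraints_def N_def)
      then have "schema (Q ! \<rho>) \<noteq> {}" using DC by (auto simp: degree_constraints_def)
      then obtain A where A: "A \<in> schema (Q ! \<rho>)" by blast
      then obtain p where "p < k" "ats ! p = A" using ats_nth relation[OF r] by blast
      then have "p \<in> rS \<rho>" using A r by (simp add: sets pos_iff)
      then show ?thesis using rSk[OF r] by auto
    qed
    show "cX c \<subseteq> cY c \<and> cY c \<subseteq> {..<k}" if "c < nc" for c
      using that constraint[OF that] by (auto simp: sets pos_iff)
    show "a < b" if c: "c < nc" and ab: "a < k" "b < k" "sg ! a \<in> cX c" "sg ! b \<in> cY c - cX c" for c a b
    proof (rule sg(3))
      have "sg ! b < k" using ab(2) sg(2) len_sg nth_mem by blast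
      then show "(sg ! a, sg ! b) \<in> ?r"
        using cs_DC[OF c] ab(3,4) c by (auto simp: dependency_graph_def sets pos_iff)
    qed (use ab len_sg in auto)
    show "rel g < m \<and> YY g \<subseteq> rS (rel g) \<and> lev g < k \<and> sg ! lev g \<in> YY g" if "g < length gl" for g
    proof -
      have "gl ! g \<in> GS" using that gl by auto
      then show ?thesis by (auto simp: GS_def rel_def YY_def lev_def split_beta)
    qed
    show "\<exists>g<length gl. rel g = \<rho> \<and> YY g = Z \<and> lev g = i"
      if "\<rho> < m" "Z \<subseteq> rS \<rho>" "i < k" "sg ! i \<in> Z" for \<rho> Z i
    proof -
      have "(\<rho>, Z, i) \<in> set gl" using that gl by (auto simp: GS_def)
      then obtain g where "g < length gl" "gl ! g = (\<rho>, Z, i)" by (metis in_set_conv_nth)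
      then show ?thesis by (intro exI[of _ g]) (auto simp: rel_def YY_def lev_def)
    qed
    show "set cl = {c. length c = k \<and> (\<forall>i<k. c ! i < length gl \<and> lev (c ! i) = i)}"
      using cl by (simp add: CL_def)
  qed
  then show ?thesis by blast
qed

lemma shape_test:
  assumes sh: "shape k m nc nG sg cX cY rS rel YY lev cl" and CW: "shape.C0 k m nc nG cl * w \<le> W"
    and s: "mem s = M" and sh': "sh' \<in> shapes k m" "length (fst sh') < 2 ^ W"
  shows "eval W s (shape_test k m sh') \<noteq> 0 \<longleftrightarrow> sh' = shape_of Q cs"
proof -
  interpret inst k m nc nG sg cX cY rS rel YY lev cl w W len val bnd M base
    by (rule inst[OF sh CW])
  have nc': "length (fst (shape_of Q cs)) = nc" by (simp add: shape_of_def nc_def)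
  have p0: "0 < (2::nat) ^ W" by simp
  show ?thesis
  proof (cases "length (fst sh') = nc")
    case False
    then have "eval W s (Op Eq (Mem (Num 0)) (Num (length (fst sh')))) = 0"
      using s sh'(2) M_0 by simp
    then have "eval W s (shape_test k m sh') = 0" by (simp add: shape_test_def)
    then show ?thesis using False nc' by auto
  next
    case True
    have numb: "eval W s (Num (of_bool b)) = of_bool b" for b using W1 by simp
    have flag: "eval W s (Op Eq e (Num (of_bool b))) = of_bool (a = b)" if "eval W s e = of_bool a" for e a b
      using that W1 numb[of b] by (simp del: eval.simps(1))
    have addr: "1 + c * (2 * k + 1) + j < 2 ^ W" if c: "c < nc" and j: "j < 2 * k" for c j
    proof -
      obtain d where "nc = Suc (c + d)" using c less_imp_Suc_add by blast
      then show ?thesis using j by (intro small, unfold C0_def) (simp add: algebra_simps)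
    qed
    have e0: "eval W s (Op Eq (Mem (Num 0)) (Num (length (fst sh')))) = of_bool True"
      using s sh'(2) M_0 True W1 by simp
    have e1: "eval W s (conj_expr (map (\<lambda>(c, p). Op Eq (Mem (Num (1 + c * (2 * k + 1) + p)))
          (Num (of_bool (p \<in> fst (fst sh' ! c))))) (List.product [0..<length (fst sh')] [0..<k]))) =
        of_bool (\<forall>(c, p)\<in>set (List.product [0..<nc] [0..<k]). (p \<in> cX c) = (p \<in> fst (fst sh' ! c)))"
      unfolding True
    proof (subst eval_conj_expr_map[where P = "\<lambda>(c, p). (p \<in> cX c) = (p \<in> fst (fst sh' ! c))"])
      fix x assume "x \<in> set (List.product [0..<nc] [0..<k])"
      then obtain c p where x: "x = (c, p)" "c < nc" "p < k" by auto
      have "eval W s (Mem (Num (1 + c * (2 * k + 1) + p))) = of_bool (p \<in> cX c)"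
        using s M_flag(1)[OF x(2,3)] addr[OF x(2), of "p"] x(3) by simp
      from flag[OF this] show "eval W s (case x of (c, p) \<Rightarrow> Op Eq (Mem (Num (1 + c * (2 * k + 1) + p)))
          (Num (of_bool (p \<in> fst (fst sh' ! c))))) =
        of_bool (case x of (c, p) \<Rightarrow> (p \<in> cX c) = (p \<in> fst (fst sh' ! c)))"
        unfolding x(1) by simp
    qed (use w wW in auto)
    have e2: "eval W s (conj_expr (map (\<lambda>(c, p). Op Eq (Mem (Num (1 + c * (2 * k + 1) + (k + p))))
          (Num (of_bool (p \<in> snd (fst sh' ! c))))) (List.product [0..<length (fst sh')] [0..<k]))) =
        of_bool (\<forall>(c, p)\<in>set (List.product [0..<nc] [0..<k]). (p \<in> cY c) = (p \<in> snd (fst sh' ! c)))"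
      unfolding True
    proof (subst eval_conj_expr_map[where P = "\<lambda>(c, p). (p \<in> cY c) = (p \<in> snd (fst sh' ! c))"])
      fix x assume "x \<in> set (List.product [0..<nc] [0..<k])"
      then obtain c p where x: "x = (c, p)" "c < nc" "p < k" by auto
      have "eval W s (Mem (Num (1 + c * (2 * k + 1) + (k + p)))) = of_bool (p \<in> cY c)"
        using s M_flag(2)[OF x(2,3)] addr[OF x(2), of "(k + p)"] x(3) by simp
      from flag[OF this] show "eval W s (case x of (c, p) \<Rightarrow> Op Eq (Mem (Num (1 + c * (2 * k + 1) + (k + p))))
          (Num (of_bool (p \<in> snd (fst sh' ! c))))) =
        of_bool (case x of (c, p) \<Rightarrow> (p \<in> cY c) = (p \<in> snd (fst sh' ! c)))"
        unfolding x(1) by simp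
    qed (use w wW in auto)
    have e3: "eval W s (conj_expr (map (\<lambda>(\<rho>, p). Op Eq (Mem (Op Add (shape.baseE k (length (fst sh')) \<rho>) (Num p)))
          (Num (of_bool (p \<in> snd sh' ! \<rho>)))) (List.product [0..<m] [0..<k]))) =
        of_bool (\<forall>(\<rho>, p)\<in>set (List.product [0..<m] [0..<k]). (p \<in> rS \<rho>) = (p \<in> snd sh' ! \<rho>))"
      unfolding True
    proof (subst eval_conj_expr_map[where P = "\<lambda>(\<rho>, p). (p \<in> rS \<rho>) = (p \<in> snd sh' ! \<rho>)"])
      fix x assume "x \<in> set (List.product [0..<m] [0..<k])"
      then obtain \<rho> p where x: "x = (\<rho>, p)" "\<rho> < m" "p < k" by auto
      have "base \<rho> + p < 2 ^ W" "p < 2 ^ W" using address[OF x(2)] x(3) by auto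
      then have "eval W s (Mem (Op Add (baseE \<rho>) (Num p))) = of_bool (p \<in> rS \<rho>)"
        using s x eval_baseE[OF s, of \<rho>] M_schema[OF x(2,3)] by simp
      then show "eval W s (case x of (\<rho>, p) \<Rightarrow> Op Eq (Mem (Op Add (baseE \<rho>) (Num p)))
          (Num (of_bool (p \<in> snd sh' ! \<rho>)))) =
        of_bool (case x of (\<rho>, p) \<Rightarrow> (p \<in> rS \<rho>) = (p \<in> snd sh' ! \<rho>))"
        using numb W1 x(1) by (simp del: eval.simps(1,3) add: eval.simps(5))
    qed (use w wW in auto)
    have mul: "eval W s (Op Mul a b) = of_bool (P \<and> R)"
      if "eval W s a = of_bool P" "eval W s b = of_bool R" for a b P R
      using that W1 by simp
    have "eval W s (shape_test k m sh') = of_bool (True \<and>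
        ((\<forall>(c, p)\<in>set (List.product [0..<nc] [0..<k]). (p \<in> cX c) = (p \<in> fst (fst sh' ! c))) \<and>
         ((\<forall>(c, p)\<in>set (List.product [0..<nc] [0..<k]). (p \<in> cY c) = (p \<in> snd (fst sh' ! c))) \<and>
          (\<forall>(\<rho>, p)\<in>set (List.product [0..<m] [0..<k]). (p \<in> rS \<rho>) = (p \<in> snd sh' ! \<rho>)))))"
      unfolding shape_test_def by (intro mul e0 e1 e2 e3)
    then have ev: "eval W s (shape_test k m sh') \<noteq> 0 \<longleftrightarrow>
        (\<forall>c<nc. \<forall>p<k. ((p \<in> cX c) = (p \<in> fst (fst sh' ! c))) \<and> ((p \<in> cY c) = (p \<in> snd (fst sh' ! c)))) \<and>
        (\<forall>\<rho><m. \<forall>p<k. (p \<in> rS \<rho>) = (p \<in> snd sh' ! \<rho>))"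
      by auto
    show ?thesis
    proof
      assume "eval W s (shape_test k m sh') \<noteq> 0"
      then have a: "\<And>c p. c < nc \<Longrightarrow> p < k \<Longrightarrow>
          ((p \<in> cX c) = (p \<in> fst (fst sh' ! c))) \<and> ((p \<in> cY c) = (p \<in> snd (fst sh' ! c)))"
        "\<And>\<rho> p. \<rho> < m \<Longrightarrow> p < k \<Longrightarrow> (p \<in> rS \<rho>) = (p \<in> snd sh' ! \<rho>)"
        using ev by auto
      have "fst sh' = fst (shape_of Q cs)"
      proof (rule nth_equalityI)
        fix c assume "c < length (fst sh')"
        then have c: "c < nc" using True by simp
        have "fst sh' ! c \<in> Pow {..<k} \<times> Pow {..<k}"
          using sh'(1) c True nth_mem[of c "fst sh'"] by (auto simp: shapes_def)
        then have "fst (fst sh' ! c) \<subseteq> {..<k}" "snd (fst sh' ! c) \<subseteq> {..<k}" by auto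
        moreover have "cX c \<subseteq> {..<k}" "cY c \<subseteq> {..<k}" using XY[OF c] by auto
        ultimately have "fst (fst sh' ! c) = cX c" "snd (fst sh' ! c) = cY c"
          using a(1)[OF c] by blast+
        then show "fst sh' ! c = fst (shape_of Q cs) ! c"
          by (simp add: cX_def cY_def prod_eq_iff)
      qed (simp add: True nc')
      moreover have "snd sh' = snd (shape_of Q cs)"
      proof (rule nth_equalityI)
        show l: "length (snd sh') = length (snd (shape_of Q cs))"
          using sh'(1) Q(2) by (auto simp: shapes_def shape_of_def)
        fix \<rho> assume r': "\<rho> < length (snd sh')"
        then have r: "\<rho> < m" using l Q(2) by (simp add: shape_of_def)
        have "set (snd sh') \<subseteq> Pow {..<k}" using sh'(1) by (auto simp: shapes_def)
        then have "snd sh' ! \<rho> \<subseteq> {..<k}" using nth_mem[OF r'] by blast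
        moreover have "rS \<rho> \<subseteq> {..<k}" using S[OF r] by simp
        ultimately have "snd sh' ! \<rho> = rS \<rho>" using a(2)[OF r] by blast
        then show "snd sh' ! \<rho> = snd (shape_of Q cs) ! \<rho>" by (simp add: rS_def)
      qed
      ultimately show "sh' = shape_of Q cs" by (simp add: prod_eq_iff)
    next
      assume "sh' = shape_of Q cs"
      then show "eval W s (shape_test k m sh') \<noteq> 0"
        using ev by (simp add: cX_def cY_def rS_def)
    qed
  qed
qed

end

definition input_words ::
  "join_query \<Rightarrow> degree_constraint list \<Rightarrow> tuple list list \<Rightarrow> nat list" where
  "input_words Q cs uss = length cs # concat (map (encode_constraint (attributes Q)) cs)
     @ concat (map2 (encode_relation (attributes Q)) Q uss)"

text \<open>The contract between a specialised pair of programs and the dispatcher. The second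
  conjunct makes room for the constant cost of dispatching. \<open>Inv\<close> fixes the memory, so
  that the tests give the same answer at every sampling operation.\<close>

definition works ::
  "nat \<Rightarrow> nat \<Rightarrow> join_query \<Rightarrow> degree_constraint set \<Rightarrow> program \<Rightarrow> program \<Rightarrow> machine \<Rightarrow> bool" where
  "works C W Q DC bd sp s0 \<longleftrightarrow>
     expected_time W bd s0 \<le> ennreal (real C * real (input_size Q)) \<and>
     1 \<le> real C * (polymat (join_schema Q) DC / max 1 (real (output_size Q))) \<and>
     (\<exists>s1 Inv. run W bd s0 = return_spmf s1 \<and> Inv s1 \<and>
       (\<forall>s. Inv s \<longrightarrow> mem s = mem s0 \<and>
         map_spmf (outcome Q) (run W sp s) = spmf_of_pmf (sample_law Q) \<and>
         (\<forall>s'\<in>set_spmf (run W sp s). Inv s') \<and>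
         expected_time W sp s \<le>
           ennreal (real C * (polymat (join_schema Q) DC / max 1 (real (output_size Q))))))"

context problem
begin

lemma xs: "xs = input_words Q cs uss"
  by (simp add: xs_def input_words_def rels_def ats_def)

text \<open>The bijection \<open>tup\<close> carries the law over from lists of values to tuples,
  and the flag in \<open>out\<close> shows that the invariant survives.\<close>

lemma sample_correct:
  assumes smp: "sampler W k zr cr trial seeds seedsE J enc Inv"
    and a: "real seeds \<le> real a * polymat (join_schema Q) DC"
    and s: "Inv s"
  shows "map_spmf (outcome Q) (run W (sampler.sample zr cr trial seedsE) s) = spmf_of_pmf (sample_law Q)"
    "\<forall>s'\<in>set_spmf (run W (sampler.sample zr cr trial seedsE) s). Inv s'"
    "expected_time W (sampler.sample zr cr trial seedsE) s \<le>
      ennreal (real ((3 + sampler.K trial) * (a + 1)) *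
        (polymat (join_schema Q) DC / max 1 (real (output_size Q))))"
    "1 \<le> real (a + 1) * (polymat (join_schema Q) DC / max 1 (real (output_size Q)))"
proof -
  interpret sampler W k zr cr trial seeds seedsE J enc Inv by fact
  define law where "law = run W sample s"
  have finJ: "finite J" by (rule fin)
  have JJ: "join Q = tup ` J" "inj_on tup J" using bij_tup by (auto simp: bij_betw_def)
  have out: "outcome Q s = map_option tup (fst (out s))" for s
  proof -
    have "map (\<lambda>i. reg s (Suc i)) [0..<length (attributes Q)] = vals s"
      using ats(3) by (simp add: vals_def ats_def)
    then show ?thesis by (simp add: outcome_def out_def tup_def ats_def)
  qed
  have lw: "map_spmf out law = (if J = {} then return_spmf (None, True)
     else spmf_of_pmf (map_pmf (\<lambda>t. (Some t, True)) (pmf_of_set J)))"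
    unfolding law_def by (rule law_sample[OF s])
  have "map_spmf (outcome Q) law = map_spmf (\<lambda>x. map_option tup (fst x)) (map_spmf out law)"
    unfolding spmf.map_comp by (intro map_spmf_cong) (auto simp: out)
  also have "\<dots> = spmf_of_pmf (sample_law Q)"
  proof (cases "J = {}")
    case True
    then show ?thesis unfolding lw by (simp add: sample_law_def JJ(1))
  next
    case False
    then have "map_spmf (\<lambda>x. map_option tup (fst x)) (map_spmf out law) =
        spmf_of_pmf (map_pmf Some (map_pmf tup (pmf_of_set J)))"
      unfolding lw by (simp add: map_spmf_of_pmf pmf.map_comp o_def)
    also have "map_pmf tup (pmf_of_set J) = pmf_of_set (join Q)"
      unfolding JJ(1) by (rule map_pmf_of_set_inj[OF JJ(2) False finJ])
    finally show ?thesis using False JJ(1) by (simp add: sample_law_def)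
  qed
  finally show "map_spmf (outcome Q) (run W sample s) = spmf_of_pmf (sample_law Q)"
    by (simp add: law_def)
  have "Inv s'" if "s' \<in> set_spmf law" for s'
  proof -
    have "out s' \<in> set_spmf (map_spmf out law)" using that by simp
    then have "snd (out s')" unfolding lw using fin by (auto split: if_splits)
    then show ?thesis by (simp add: out_def)
  qed
  then show "\<forall>s'\<in>set_spmf (run W sample s). Inv s'" by (simp add: law_def)
  define p where "p = polymat (join_schema Q) DC"
  define mx where "mx = max 1 (real (output_size Q))"
  have p1: "1 \<le> p" unfolding p_def by (rule polymat_ge_1[OF Q(1) DC])
  have oc: "output_size Q = card J" unfolding output_size_def JJ(1) by (rule card_image[OF JJ(2)])
  have mx: "1 \<le> mx" by (simp add: mx_def)
  \<comment> \<open>Distinct tuples have distinct seeds, so the output size is bounded by a multiple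
    of the polymatroid bound, and additive constants can be absorbed.\<close>
  have "real (card J) \<le> real seeds" using card_le by simp
  then have "mx \<le> (real a + 1) * p"
    using a p1 by (auto simp: mx_def oc p_def[symmetric] algebra_simps intro: order_trans[OF _ add_mono])
  then show "1 \<le> real (a + 1) * (polymat (join_schema Q) DC / max 1 (real (output_size Q)))"
    using mx by (simp add: p_def[symmetric] mx_def[symmetric] field_simps)
  from \<open>mx \<le> (real a + 1) * p\<close> have 1: "3 \<le> 3 * ((real a + 1) * p / mx)" using mx by (simp add: field_simps)
  have "real seeds \<le> (real a + 1) * p" using a p1 by (simp add: p_def[symmetric] algebra_simps)
  then have "real K * real seeds / mx \<le> real K * ((real a + 1) * p) / mx"
    using mx by (intro divide_right_mono mult_left_mono) auto
  then have "3 + real K * real seeds / mx \<le> 3 * ((real a + 1) * p / mx) + real K * ((real a + 1) * p) / mx"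
    using 1 by simp
  also have "\<dots> = real ((3 + K) * (a + 1)) * (p / mx)"
    using mx by (simp add: field_simps)
  finally have "3 + real K * real seeds / mx \<le> real ((3 + K) * (a + 1)) * (p / mx)" .
  then show "expected_time W sample s \<le> ennreal (real ((3 + K) * (a + 1)) *
        (polymat (join_schema Q) DC / max 1 (real (output_size Q))))"
    using order_trans[OF expected_time_sample[OF s] ennreal_leI]
    by (simp add: p_def mx_def oc)
qed

end

text \<open>Programs and constants are fixed by the shape alone, before words, query and tuples are
  known.\<close>

lemma shape_works:
  "\<exists>bd sp C c0. \<forall>w W Q DC cs uss.
     problem m k w W Q DC cs uss \<and> acyclic_constraints DC \<and> shape_of Q cs = sh \<and> c0 * w \<le> W \<longrightarrow>
     works C W Q DC bd sp (initial W (input_words Q cs uss)) \<and>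
     (\<forall>s sh'. mem s = mem (initial W (input_words Q cs uss)) \<and> sh' \<in> shapes k m \<and>
        length (fst sh') < 2 ^ W \<longrightarrow> (eval W s (shape_test k m sh') \<noteq> 0 \<longleftrightarrow> sh' = sh))"
proof -
  define X where "X = (\<lambda>c. fst (fst sh ! c))"
  define Y where "Y = (\<lambda>c. snd (fst sh ! c))"
  define S where "S = (\<lambda>\<rho>. snd sh ! \<rho>)"
  define n where "n = length (fst sh)"
  show ?thesis
  proof (cases "\<exists>sg nG rel YY lev cl. shape k m n nG sg X Y S rel YY lev cl")
    \<comment> \<open>By \<open>static_exists\<close> no acyclic input has this shape, so any
      program will do.\<close>
    case False
    have "\<not> (problem m k w W Q DC cs uss \<and> acyclic_constraints DC \<and> shape_of Q cs = sh)" for w W Q DC cs uss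
    proof
      assume a: "problem m k w W Q DC cs uss \<and> acyclic_constraints DC \<and> shape_of Q cs = sh"
      interpret problem m k w W Q DC cs uss using a by blast
      have "cX = X" "cY = Y" "rS = S" "nc = n"
        using a by (auto simp: fun_eq_iff cX_def cY_def rS_def X_def Y_def S_def n_def nc_def shape_of_def)
      then show False using static_exists False a by metis
    qed
    then show ?thesis by blast
  next
    case True
    then obtain sg nG rel YY lev cl where sh: "shape k m n nG sg X Y S rel YY lev cl" by blast
    interpret sh: shape k m n nG sg X Y S rel YY lev cl by fact
    define C where "C = (15 + 8 * k ^ k + 18 * nG) + (3 + sampler.K sh.trial) * (length cl * 2 ^ k + 1)"
    define sp where "sp = sampler.sample (k + 1) (k + 2) sh.trial sh.seedsE"
    have "works C W Q DC sh.build sp (initial W (input_words Q cs uss)) \<and>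
     (\<forall>s sh'. mem s = mem (initial W (input_words Q cs uss)) \<and> sh' \<in> shapes k m \<and>
        length (fst sh') < 2 ^ W \<longrightarrow> (eval W s (shape_test k m sh') \<noteq> 0 \<longleftrightarrow> sh' = sh))"
      if a: "problem m k w W Q DC cs uss \<and> acyclic_constraints DC \<and> shape_of Q cs = sh \<and> sh.C0 * w \<le> W"
      for w W Q DC cs uss
    proof -
      interpret P: problem m k w W Q DC cs uss using a by blast
      have eq: "P.cX = X" "P.cY = Y" "P.rS = S" "P.nc = n"
        using a by (auto simp: fun_eq_iff P.cX_def P.cY_def P.rS_def X_def Y_def S_def n_def P.nc_def shape_of_def)
      have shP: "shape k m P.nc nG sg P.cX P.cY P.rS rel YY lev cl" unfolding eq by (rule sh)
      have CW: "shape.C0 k m P.nc nG cl * w \<le> W" unfolding eq using a by blast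
      interpret I: inst k m n nG sg X Y S rel YY lev cl w W P.len P.val P.bnd P.M P.base
        using P.inst[OF shP CW] unfolding eq .
      define s0 where "s0 = initial W (input_words Q cs uss)"
      have s0: "mem s0 = P.M" "table s0 = (\<lambda>_. 0)"
        by (simp_all add: s0_def P.M_def P.xs initial_def)
      have IN: "I.IN = input_size Q" using P.sum_len by (simp add: I.IN_def)
      note bt = I.build[OF s0]
      have t: "expected_time W sh.build s0 \<le> ennreal (real C * real (input_size Q))"
      proof -
        have "expected_time W sh.build s0 \<le> of_nat ((15 + 8 * k ^ k + 18 * nG) * I.IN)"
          by (rule execs_run(2)[OF bt])
        also have "\<dots> \<le> of_nat (C * input_size Q)"
          unfolding IN C_def by (intro of_nat_mono mult_right_mono) auto
        finally show ?thesis by (simp add: ennreal_of_nat_eq_real_of_nat)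
      qed
      obtain s1 where s1: "run W sh.build s0 = return_spmf s1" "mem s1 = P.M" "I.ready (table s1)"
        using execs_run(1)[OF bt] by blast
      interpret R: ready k m n nG sg X Y S rel YY lev cl w W P.len P.val P.bnd P.M P.base "table s1"
        by unfold_locales (rule s1(3))
      have J: "I.Jn = P.J" by (simp add: I.Jn_def P.J_def eq)
      have good: "\<exists>c\<in>set cl. R.good c t" if t: "t \<in> I.Jn" for t
      proof (rule R.good_exists[OF t])
        show "\<exists>\<rho><m. p \<in> S \<rho>" if "p < k" for p using P.cover[OF that] by (simp add: eq)
        have l: "length t = k" using t by (simp add: I.Jn_def)
        show "\<exists>\<rho><m. Y c \<subseteq> S \<rho> \<and>
          card ((\<lambda>\<tau>. map (P.val \<rho> \<tau>) (sh.ps (Y c) k)) ` {\<tau>. \<tau> < P.len \<rho> \<and> (\<forall>p\<in>X c. P.val \<rho> \<tau> p = t ! p)})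
            \<le> P.bnd c" if c: "c < n" for c
          using P.guard[of c t "sh.ps (Y c) k"] c l sh.set_ps_k[of "Y c"] sh.XY[OF c] by (simp add: eq)
      qed
      define Inv where "Inv s \<longleftrightarrow> mem s = P.M \<and> table s = table s1" for s :: machine
      have smp: "sampler W k (k + 1) (k + 2) sh.trial R.seeds sh.seedsE P.J R.enc Inv"
        using R.sampler[OF good] unfolding J Inv_def by simp
      have "real R.seeds \<le> real (length cl * 2 ^ k) * polymat (join_schema Q) DC"
      proof -
        obtain f where f: "I.feas f" "R.B = 2 ^ k * (\<Prod>p<k. 2 ^ f p)"
          using R.B by (auto simp: I.bound_ok_def)
        have "(\<Prod>p<k. 2 ^ f p) \<le> polymat (join_schema Q) DC"
          using f(1) by (intro P.polymat_ge_positions) (auto simp: I.feas_def eq)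
        then have "real (length cl * 2 ^ k) * (\<Prod>p<k. 2 ^ f p) \<le> real (length cl * 2 ^ k) * polymat (join_schema Q) DC"
          by (rule mult_left_mono) simp
        then show ?thesis by (simp add: R.seeds_def f(2))
      qed
      note sc = P.sample_correct[OF smp this, folded sp_def]
      have time: "expected_time W sp s \<le>
           ennreal (real C * (polymat (join_schema Q) DC / max 1 (real (output_size Q))))" if "Inv s" for s
      proof -
        have "0 \<le> polymat (join_schema Q) DC / max 1 (real (output_size Q))"
          using polymat_ge_1[OF P.Q(1) P.DC] by simp
        then have "real ((3 + sampler.K sh.trial) * (length cl * 2 ^ k + 1)) *
            (polymat (join_schema Q) DC / max 1 (real (output_size Q))) \<le>
          real C * (polymat (join_schema Q) DC / max 1 (real (output_size Q)))"
          by (intro mult_right_mono) (simp_all only: C_def of_nat_le_iff le_add2)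
        then show ?thesis using order_trans[OF sc(3)[OF that] ennreal_leI] by blast
      qed
      have Inv1: "Inv s1" using s1 by (simp add: Inv_def)
      have big: "1 \<le> real C * (polymat (join_schema Q) DC / max 1 (real (output_size Q)))"
      proof -
        have "0 \<le> polymat (join_schema Q) DC / max 1 (real (output_size Q))"
          using polymat_ge_1[OF P.Q(1) P.DC] by simp
        moreover have "length cl * 2 ^ k + 1 \<le> C"
          unfolding C_def by (simp add: add_mult_distrib)
        ultimately have "real (length cl * 2 ^ k + 1) * (polymat (join_schema Q) DC / max 1 (real (output_size Q))) \<le>
          real C * (polymat (join_schema Q) DC / max 1 (real (output_size Q)))"
          by (intro mult_right_mono) (simp_all only: of_nat_le_iff)
        then show ?thesis using sc(4)[OF Inv1] by linarith
      qed
      have "works C W Q DC sh.build sp s0"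
        unfolding works_def
      proof (intro conjI t big exI[of _ s1] exI[of _ Inv] allI impI ballI)
        show "run W sh.build s0 = return_spmf s1" "Inv s1" using s1 by (auto simp: Inv_def)
        fix s assume s: "Inv s"
        show "mem s = mem s0" using s s0(1) by (simp add: Inv_def)
        show "map_spmf (outcome Q) (run W sp s) = spmf_of_pmf (sample_law Q)" by (rule sc(1)[OF s])
        show "\<And>s'. s' \<in> set_spmf (run W sp s) \<Longrightarrow> Inv s'" using sc(2)[OF s] by blast
        show "expected_time W sp s \<le>
           ennreal (real C * (polymat (join_schema Q) DC / max 1 (real (output_size Q))))" by (rule time[OF s])
      qed
      moreover have "eval W s (shape_test k m sh') \<noteq> 0 \<longleftrightarrow> sh' = sh"
        if "mem s = mem s0" "sh' \<in> shapes k m" "length (fst sh') < 2 ^ W" for s sh'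
        using P.shape_test[OF shP CW _ that(2,3), of s] that(1) s0(1) a by simp
      ultimately show ?thesis by (simp add: s0_def)
    qed
    then show ?thesis by blast
  qed
qed

text \<open>A pair (X, Y) carries at most one bound, so it is enough to count pairs of sets of
  attributes.\<close>

lemma card_constraints_le:
  assumes Q: "is_join Q" and DC: "degree_constraints Q DC"
  shows "card DC \<le> 2 ^ (2 * card (join_schema Q))"
proof -
  let ?f = "\<lambda>(X, Y, N). (X, Y)" and ?P = "Pow (join_schema Q) \<times> Pow (join_schema Q)"
  have u: "N = N'" if "(X, Y, N) \<in> DC" "(X, Y, N') \<in> DC" for X Y N N'
    using DC that unfolding degree_constraints_def by blast
  have b: "X \<subset> Y \<and> Y \<subseteq> join_schema Q" if "(X, Y, N) \<in> DC" for X Y N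
    using DC that unfolding degree_constraints_def by blast
  have "inj_on ?f DC" using u by (fastforce simp: inj_on_def)
  moreover have "?f ` DC \<subseteq> ?P" using b by fastforce
  moreover have "finite ?P" using finite_join_schema[OF Q] by simp
  ultimately have "card DC \<le> card ?P" by (metis card_image card_mono)
  also have "\<dots> = 2 ^ (2 * card (join_schema Q))"
    using finite_join_schema[OF Q] by (simp add: card_cartesian_product card_Pow mult_2 power_add)
  finally show ?thesis .
qed

text \<open>Without relations the input size is 0 and the construction may not take a single step.
  The join consists of the empty tuple, so sampling only has to report success.\<close>

lemma empty_query:
  assumes W: "1 \<le> W" and Q: "Q = []" and DC: "degree_constraints Q DC"
  shows "samples_independently W Q [] [SetReg 0 (Num 1)] s0"
    "expected_sample_time W Q [] [SetReg 0 (Num 1)] s0 t \<le>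
      ennreal (polymat (join_schema Q) DC / max 1 (real (output_size Q)))"
proof -
  have join: "join Q = {Map.empty}" by (auto simp: join_def join_schema_def Q)
  have "(1::nat) < 2 ^ W" using W by (intro one_less_power) auto
  then have st: "steps W 1 ([SetReg 0 (Num 1)], s) = return_pmf ([], s\<lparr>reg := (reg s)(0 := 1)\<rparr>)" for s
    by (simp add: One_nat_def bind_return_pmf)
  have run: "run W [SetReg 0 (Num 1)] s = return_spmf (s\<lparr>reg := (reg s)(0 := 1)\<rparr>)" for s
    using run_steps_return[OF st[of s]] by (simp add: run_def)
  have law: "map_spmf (outcome Q) (run W [SetReg 0 (Num 1)] s) = spmf_of_pmf (sample_law Q)" for s
    by (simp add: run sample_law_def join[unfolded Q] pmf_of_set_singleton outcome_def attributes_def join_schema_def Q)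
  have time: "expected_time W [SetReg 0 (Num 1)] s \<le>
      ennreal (polymat (join_schema Q) DC / max 1 (real (output_size Q)))" for s
  proof -
    have "expected_time W [SetReg 0 (Num 1)] s \<le> 1"
      using expected_time_steps_return[OF st[of s]] by simp
    also have "\<dots> \<le> ennreal (polymat (join_schema Q) DC / max 1 (real (output_size Q)))"
      using polymat_ge_1[OF _ DC] by (simp add: output_size_def join[unfolded Q] is_join_def Q)
    finally show ?thesis .
  qed
  have build: "run W [] s0 = return_spmf s0" by (simp add: run_def)
  note laws = session_laws[where Inv = "\<lambda>_. True", OF build TrueI law TrueI time]
  show "samples_independently W Q [] [SetReg 0 (Num 1)] s0" by (rule laws(1))
  show "expected_sample_time W Q [] [SetReg 0 (Num 1)] s0 t \<le>
      ennreal (polymat (join_schema Q) DC / max 1 (real (output_size Q)))" by (rule laws(2))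
qed

theorem theorem3p1:
  fixes m k :: nat
  shows "\<exists>(build :: program) (sample :: program) (C :: real) (c :: nat).
    \<forall>(w :: nat) (Q :: join_query) (DC :: degree_constraint set) (xs :: nat list).
      is_join Q \<and> length Q = m \<and> card (join_schema Q) = k \<and>
      degree_constraints Q DC \<and> acyclic_constraints DC \<and> consistent Q DC \<and>
      fits_word w Q DC \<and> xs \<in> encodings Q DC \<longrightarrow>
      (let W = c * w; s = initial W xs in
        expected_time W build s \<le> ennreal (C * real (input_size Q)) \<and>
        samples_independently W Q build sample s \<and>
        (\<forall>t. expected_sample_time W Q build sample s t \<le>
           ennreal (C * (polymat (join_schema Q) DC / max 1 (real (output_size Q))))))"
proof (cases "m = 0")
  case True
  show ?thesis
    by (rule exI[of _ "[]"], rule exI[of _ "[SetReg 0 (Num 1)]"], rule exI[of _ 1], rule exI[of _ 1])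
      (use True empty_query in \<open>auto simp: Let_def fits_word_def\<close>)
next
  case False
  obtain bd sp C c0 where works: "\<And>sh w W Q DC cs uss.
     problem m k w W Q DC cs uss \<and> acyclic_constraints DC \<and> shape_of Q cs = sh \<and> c0 sh * w \<le> W \<Longrightarrow>
     works (C sh) W Q DC (bd sh) (sp sh) (initial W (input_words Q cs uss)) \<and>
     (\<forall>s sh'. mem s = mem (initial W (input_words Q cs uss)) \<and> sh' \<in> shapes k m \<and>
        length (fst sh') < 2 ^ W \<longrightarrow> (eval W s (shape_test k m sh') \<noteq> 0 \<longleftrightarrow> sh' = sh))"
    using shape_works[of m k] by metis
  obtain shs where shs: "set shs = shapes k m" using finite_list[OF finite_shapes] by blast
  define build where "build = dispatch (map (\<lambda>sh. (shape_test k m sh, bd sh)) shs)"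
  define sample where "sample = dispatch (map (\<lambda>sh. (shape_test k m sh, sp sh)) shs)"
  \<comment> \<open>The sum dominates the constant of each shape, and the factor pays for the tests
    of the dispatcher.\<close>
  define D where "D = (length shs + 1) * (\<Sum>sh\<in>set shs. C sh)"
  \<comment> \<open>The summand \<open>2 * k + 1\<close> ensures that the number of constraints of
    any shape fits in a word.\<close>
  define c where "c = (\<Sum>sh\<in>set shs. c0 sh) + 2 * k + 1"
  have main: "expected_time (c * w) build (initial (c * w) xs) \<le> ennreal (real D * real (input_size Q)) \<and>
      samples_independently (c * w) Q build sample (initial (c * w) xs) \<and>
      (\<forall>t. expected_sample_time (c * w) Q build sample (initial (c * w) xs) t \<le>
         ennreal (real D * (polymat (join_schema Q) DC / max 1 (real (output_size Q)))))"
    if a: "is_join Q" "length Q = m" "card (join_schema Q) = k" "degree_constraints Q DC"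
      "acyclic_constraints DC" "consistent Q DC" "fits_word w Q DC" "xs \<in> encodings Q DC"
    for w Q DC xs
  proof -
    define W where "W = c * w"
    have w1: "1 \<le> w" using a(7) by (simp add: fits_word_def)
    have mul: "c' * w \<le> W" if "c' \<le> c" for c' unfolding W_def using that by (rule mult_right_mono) simp
    have lt: "n < 2 ^ W" if "n \<le> 2 ^ (2 * k)" for n :: nat
    proof -
      have "(2 * k + 1) * 1 \<le> (2 * k + 1) * w" using w1 by (rule mult_left_mono) simp
      also have "\<dots> \<le> W" by (rule mul) (simp add: c_def)
      finally have "(2::nat) ^ (2 * k) < 2 ^ W" by (intro power_strict_increasing) auto
      then show ?thesis using that by linarith
    qed
    obtain cs uss where e: "xs = input_words Q cs uss" "distinct cs" "set cs = DC"
      "list_all2 (\<lambda>R us. distinct us \<and> set us = tuples R) Q uss"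
      using a(8) by (auto simp: encodings_def input_words_def)
    have len: "length cs \<le> 2 ^ (2 * k)"
      using card_constraints_le[OF a(1,4)] distinct_card[OF e(2)] a(3) e(3) by simp
    have wW: "w \<le> W" using mul[of 1] by (simp add: c_def)
    have m0: "0 < m" using False by simp
    interpret P: problem m k w W Q DC cs uss
      by unfold_locales (fact a e wW m0 lt[OF len])+
    define sh where "sh = shape_of Q cs"
    have sh: "sh \<in> set shs" using P.shape_in_shapes[OF len] by (simp add: sh_def shs)
    have "c0 sh \<le> (\<Sum>sh\<in>set shs. c0 sh)" using sh by (intro member_le_sum) auto
    then have "c0 sh * w \<le> W" by (intro mul) (simp add: c_def)
    then have prem: "problem m k w W Q DC cs uss \<and> acyclic_constraints DC \<and> shape_of Q cs = sh \<and> c0 sh * w \<le> W"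
      using a(5) P.problem_axioms by (simp add: sh_def)
    have wk: "works (C sh) W Q DC (bd sh) (sp sh) (initial W xs)"
      and test: "\<And>s sh'. mem s = mem (initial W xs) \<Longrightarrow> sh' \<in> shapes k m \<Longrightarrow> length (fst sh') < 2 ^ W \<Longrightarrow>
        (eval W s (shape_test k m sh') \<noteq> 0 \<longleftrightarrow> sh' = sh)"
      using works[OF prem] unfolding e(1) by blast+
    have len': "length (fst sh') < 2 ^ W" if "sh' \<in> shapes k m" for sh'
      using that by (intro lt) (auto simp: shapes_def)
    have disp: "\<exists>n\<le>length shs. steps W n (dispatch (map (\<lambda>sh. (shape_test k m sh, p sh)) shs), s) =
        return_pmf (p sh, s)" if s: "mem s = mem (initial W xs)" for p s
    proof -
      have "\<exists>n\<le>length (map (\<lambda>sh. (shape_test k m sh, p sh)) shs).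
          steps W n (dispatch (map (\<lambda>sh. (shape_test k m sh, p sh)) shs), s) = return_pmf (p sh, s)"
      proof (rule dispatch_steps)
        show "(shape_test k m sh, p sh) \<in> set (map (\<lambda>sh. (shape_test k m sh, p sh)) shs)" using sh by auto
        show "eval W s (shape_test k m sh) \<noteq> 0" using test[OF s] sh len' by (simp add: shs)
        fix e' P' assume "(e', P') \<in> set (map (\<lambda>sh. (shape_test k m sh, p sh)) shs)" "eval W s e' \<noteq> 0"
        then obtain sh' where "sh' \<in> set shs" "e' = shape_test k m sh'" "P' = p sh'"
          "eval W s (shape_test k m sh') \<noteq> 0" by auto
        then show "P' = p sh" using test[OF s] len' by (simp add: shs)
      qed
      then show ?thesis by simp
    qed
    have run_disp: "run W (dispatch (map (\<lambda>sh. (shape_test k m sh, p sh)) shs)) s = run W (p sh) s"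
      "expected_time W (dispatch (map (\<lambda>sh. (shape_test k m sh, p sh)) shs)) s \<le>
        of_nat (length shs) + expected_time W (p sh) s" if s: "mem s = mem (initial W xs)" for p s
    proof -
      obtain n where n: "n \<le> length shs" "steps W n (dispatch (map (\<lambda>sh. (shape_test k m sh, p sh)) shs), s) =
        return_pmf (p sh, s)" using disp[OF s] by blast
      show "run W (dispatch (map (\<lambda>sh. (shape_test k m sh, p sh)) shs)) s = run W (p sh) s"
        by (rule run_steps_return[OF n(2)])
      show "expected_time W (dispatch (map (\<lambda>sh. (shape_test k m sh, p sh)) shs)) s \<le>
        of_nat (length shs) + expected_time W (p sh) s"
        by (rule order_trans[OF expected_time_steps_return[OF n(2)]]) (intro add_right_mono of_nat_mono n(1))
    qed
    define p where "p = polymat (join_schema Q) DC / max 1 (real (output_size Q))"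
    have CD: "(length shs + 1) * C sh \<le> D"
      unfolding D_def using sh by (intro mult_left_mono member_le_sum) auto
    note wk' = wk[unfolded works_def, folded p_def]
    then have t: "expected_time W (bd sh) (initial W xs) \<le> ennreal (real (C sh) * real (input_size Q))"
      and p1: "1 \<le> real (C sh) * p" by simp_all
    from wk' obtain s1 Inv where
      s1: "run W (bd sh) (initial W xs) = return_spmf s1" "Inv s1" and
      all: "\<forall>s. Inv s \<longrightarrow> mem s = mem (initial W xs) \<and>
         map_spmf (outcome Q) (run W (sp sh) s) = spmf_of_pmf (sample_law Q) \<and>
         (\<forall>s'\<in>set_spmf (run W (sp sh) s). Inv s') \<and>
         expected_time W (sp sh) s \<le> ennreal (real (C sh) * p)"
      by (elim conjE exE) (rule that)
    have I: "mem s = mem (initial W xs)"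
        "map_spmf (outcome Q) (run W (sp sh) s) = spmf_of_pmf (sample_law Q)"
        "s' \<in> set_spmf (run W (sp sh) s) \<Longrightarrow> Inv s'"
        "expected_time W (sp sh) s \<le> ennreal (real (C sh) * p)" if "Inv s" for s s'
      using all[rule_format, OF that] by auto
    have p0: "0 \<le> p" using polymat_ge_1[OF a(1,4)] by (simp add: p_def)
    have Csh: "1 \<le> C sh" using p1 by (cases "C sh = 0") auto
    \<comment> \<open>At most \<open>length shs\<close> tests are made; as \<open>C sh * x\<close>
      is at least 1, each of them is charged as one further copy of it.\<close>
    have grow: "ennreal (real (length shs)) + ennreal (real (C sh) * x) \<le> ennreal (real D * x)"
      if x: "0 \<le> x" "1 \<le> real (C sh) * x" for x
    proof -
      have "real (length shs) * 1 + real (C sh) * x \<le> real (length shs) * (real (C sh) * x) + real (C sh) * x"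
        using x by (intro add_right_mono mult_left_mono) auto
      also have "\<dots> = real ((length shs + 1) * C sh) * x" by (simp add: algebra_simps)
      also have "\<dots> \<le> real D * x" using CD x(1) by (intro mult_right_mono) (simp_all only: of_nat_le_iff)
      finally have "ennreal (real (length shs) + real (C sh) * x) \<le> ennreal (real D * x)"
        by (intro ennreal_leI) simp
      then show ?thesis using x by (subst ennreal_plus[symmetric]) auto
    qed
    have "1 \<le> real (C sh) * real (input_size Q)"
      using mult_mono[of 1 "real (C sh)" 1 "real (input_size Q)"] Csh P.IN(2) by simp
    then have gIN: "ennreal (real (length shs)) + ennreal (real (C sh) * real (input_size Q)) \<le>
        ennreal (real D * real (input_size Q))" by (intro grow) auto
    have "expected_time W build (initial W xs) \<le> ennreal (real D * real (input_size Q))"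
      unfolding build_def
      by (rule order_trans[OF run_disp(2)[OF refl, where p = bd] order_trans[OF add_mono[OF _ t] gIN]])
        (simp add: ennreal_of_nat_eq_real_of_nat)
    moreover have T: "expected_time W sample s \<le> ennreal (real D * p)" if "Inv s" for s
      unfolding sample_def
      by (rule order_trans[OF run_disp(2)[OF I(1)[OF that], where p = sp] order_trans[OF add_mono[OF _ I(4)[OF that]] grow[OF p0 p1]]])
        (simp add: ennreal_of_nat_eq_real_of_nat)
    have rb: "run W build (initial W xs) = return_spmf s1"
      unfolding build_def run_disp(1)[OF refl] by (rule s1(1))
    have rs: "run W sample s = run W (sp sh) s" if "Inv s" for s
      unfolding sample_def by (rule run_disp(1)[OF I(1)[OF that]])
    have "map_spmf (outcome Q) (run W sample s) = spmf_of_pmf (sample_law Q)" if "Inv s" for s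
      unfolding rs[OF that] by (rule I(2)[OF that])
    moreover have "Inv s'" if "Inv s" "s' \<in> set_spmf (run W sample s)" for s s'
      using that(2) unfolding rs[OF that(1)] by (rule I(3)[OF that(1)])
    ultimately show ?thesis
      using session_laws[of W build "initial W xs" s1 Inv Q sample, OF rb s1(2)] T
      unfolding W_def p_def by blast
  qed
  show ?thesis
  proof (rule exI[of _ build], rule exI[of _ sample], rule exI[of _ "real D"], rule exI[of _ c],
      intro allI impI)
    fix w Q DC xs
    assume "is_join Q \<and> length Q = m \<and> card (join_schema Q) = k \<and>
      degree_constraints Q DC \<and> acyclic_constraints DC \<and> consistent Q DC \<and>
      fits_word w Q DC \<and> xs \<in> encodings Q DC"
    then show "let W = c * w; s = initial W xs in
        expected_time W build s \<le> ennreal (real D * real (input_size Q)) \<and>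
        samples_independently W Q build sample s \<and>
        (\<forall>t. expected_sample_time W Q build sample s t \<le>
           ennreal (real D * (polymat (join_schema Q) DC / max 1 (real (output_size Q)))))"
      unfolding Let_def by (elim conjE) (rule main)
  qed
qed

end
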